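(* Assume that: (a) $\mathcal{F}$ is a Fréchet space of real and even entire maps that contains all real and even polynomial maps and whose topology is finer than the topology of local uniform convergence on $\mathbb{C}$; (b) $E$ is a countable dense subset of $\mathbb{C}$ that is symmetric with respect to the real axis and the imaginary axis, and such that $E\cap(\mathbb{R}\cup i\mathbb{R})$ is dense in $\mathbb{R}\cup i\mathbb{R}$; (c) $\Lambda$ is a dense subset of $\mathbb{C}$ that is symmetric with respect to the real axis and such that $\Lambda\cap\mathbb{R}$ is dense in $\mathbb{R}$. Then the set of $f\in\mathcal{F}$ such that $f^{-1}(E)=E$, every periodic point of $f$ lies in $E$, and the multiplier of $f$ at each of its cycles lies in $\Lambda$, is dense in $\mathcal{F}$.
   Context: An entire map $f$ is real if $f(\bar z)=\overline{f(z)}$ for all $z$, and even if $f(-z)=f(z)$ for all $z$. For a cycle $\{z,\dots,f^{\circ(n-1)}(z)\}$ of exact period $n$, the multiplier of $f$ at this cycle is $(f^{\circ n})'(z)$. *)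

theory Defs
  imports "HOL-Complex_Analysis.Complex_Analysis" "HOL-Computational_Algebra.Polynomial"
begin

definition real_map :: "(complex \<Rightarrow> complex) \<Rightarrow> bool" where
  "real_map f \<longleftrightarrow> (\<forall>z. f (cnj z) = cnj (f z))"

definition even_map :: "(complex \<Rightarrow> complex) \<Rightarrow> bool" where
  "even_map f \<longleftrightarrow> (\<forall>z. f (- z) = f z)"

definition real_function_space :: "(complex \<Rightarrow> complex) set \<Rightarrow> bool" where
  "real_function_space F \<longleftrightarrow> (\<lambda>z. 0) \<in> F \<and> (\<forall>f\<in>F. \<forall>g\<in>F. (\<lambda>z. f z + g z) \<in> F)
     \<and> (\<forall>f\<in>F. \<forall>c::real. (\<lambda>z. complex_of_real c * f z) \<in> F)"

definition seminorm_on :: "(complex \<Rightarrow> complex) set \<Rightarrow> ((complex \<Rightarrow> complex) \<Rightarrow> real) \<Rightarrow> bool" where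
  "seminorm_on F q \<longleftrightarrow> (\<forall>f\<in>F. 0 \<le> q f) \<and> (\<forall>f\<in>F. \<forall>g\<in>F. q (\<lambda>z. f z + g z) \<le> q f + q g)
     \<and> (\<forall>f\<in>F. \<forall>c::real. q (\<lambda>z. complex_of_real c * f z) = \<bar>c\<bar> * q f)"

definition frechet_space :: "(complex \<Rightarrow> complex) topology \<Rightarrow> bool" where
  "frechet_space T \<longleftrightarrow> real_function_space (topspace T) \<and>
    (\<exists>p :: nat \<Rightarrow> (complex \<Rightarrow> complex) \<Rightarrow> real.
       (\<forall>n. seminorm_on (topspace T) (p n)) \<and>
       (\<forall>f\<in>topspace T. (\<forall>n. p n f = 0) \<longrightarrow> f = (\<lambda>z. 0)) \<and>
       (\<forall>U. openin T U \<longleftrightarrow> U \<subseteq> topspace T \<and>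
            (\<forall>f\<in>U. \<exists>N. \<exists>\<epsilon>>0. {g\<in>topspace T. \<forall>n\<le>N. p n (\<lambda>z. g z - f z) < \<epsilon>} \<subseteq> U)) \<and>
       (\<forall>x :: nat \<Rightarrow> (complex \<Rightarrow> complex). (\<forall>k. x k \<in> topspace T) \<longrightarrow>
          (\<forall>n. \<forall>\<epsilon>>0. \<exists>M. \<forall>k\<ge>M. \<forall>l\<ge>M. p n (\<lambda>z. x k z - x l z) < \<epsilon>) \<longrightarrow>
          (\<exists>y\<in>topspace T. \<forall>n. (\<lambda>k. p n (\<lambda>z. x k z - y z)) \<longlonglongrightarrow> 0)))"

definition finer_than_local_uniform :: "(complex \<Rightarrow> complex) topology \<Rightarrow> bool" where
  "finer_than_local_uniform T \<longleftrightarrow>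
    (\<forall>f\<in>topspace T. \<forall>K. compact K \<longrightarrow> (\<forall>\<epsilon>>0. \<exists>U. openin T U \<and> f \<in> U \<and>
        (\<forall>g\<in>U. \<forall>z\<in>K. cmod (g z - f z) < \<epsilon>)))"

definition periodic_point :: "(complex \<Rightarrow> complex) \<Rightarrow> complex \<Rightarrow> bool" where
  "periodic_point f z \<longleftrightarrow> (\<exists>n>0. (f ^^ n) z = z)"

definition exact_period :: "(complex \<Rightarrow> complex) \<Rightarrow> nat \<Rightarrow> complex \<Rightarrow> bool" where
  "exact_period f n z \<longleftrightarrow> 0 < n \<and> (f ^^ n) z = z \<and> (\<forall>m. 0 < m \<and> m < n \<longrightarrow> (f ^^ m) z \<noteq> z)"

text \<open>Multiplier of f at the cycle of z (z of exact period n).\<close>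
definition multiplier :: "(complex \<Rightarrow> complex) \<Rightarrow> nat \<Rightarrow> complex \<Rightarrow> complex" where
  "multiplier f n z = deriv (f ^^ n) z"

end

theory Submission
  imports Defs
begin

text \<open>
  The function is built as a limit of \<open>f\<^sub>k \<in> F\<close>, together with polynomials \<open>Q\<^sub>k\<close> such that \<open>Q\<^sub>k\<close> divides
  \<open>f\<^sub>k\<^sub>+\<^sub>1 - f\<^sub>k\<close>, so that values and derivatives at the zeros of \<open>Q\<^sub>k\<close> are never changed again.
  A root of \<open>f = e\<close> that is not yet a zero of \<open>Q\<close> is moved into \<open>E\<close> by interpolation at one point. For a cycle
  not contained in the zero set of \<open>Q\<close>, one moves its points one after the other to new points of \<open>E\<close>
  that shadow the cycle, closing up at a point where \<open>Q \<noteq> 0\<close>, and then adjusts the derivative there. All these points are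
  chosen outside the finite set used so far, so no unwanted cycle appears among the zeros of \<open>Q\<close>.
  Jensen's inequality bounds the number of roots in a disc for all nearby functions, so a state with the maximal
  number of settled roots has no unsettled ones. If all zeros of \<open>f - e\<close> in a disc are zeros of \<open>Q\<close>, then
  \<open>\<bar>f - e\<bar> \<ge> c \<bar>Q\<bar>\<^sup>M\<close> there, so every \<open>g\<close> with \<open>\<bar>g - f\<bar> < c \<bar>Q\<bar>\<^sup>M\<close> away from the zeros of \<open>Q\<close> has the same property; replacing
  \<open>Q\<close> by \<open>Q\<^sup>M\<close> preserves what has been achieved, and similarly for \<open>f\<^sup>n - id\<close>.
\<close>

section \<open>Entire functions and their iterates\<close>

text \<open>Four obstacles shape the proof. A real and even map is fixed on
  \<open>sym_class u\<close> by its value at \<open>u\<close>, is real on both axes and has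
  derivative 0 at 0. So interpolation uses powers of \<open>z^2\<close>, points on the axes move
  along the axes, 0 is frozen from the start, and a cycle equal to its own conjugate has multiplier
  \<open>l * cnj l\<close>, with \<open>l\<close> the product of the derivatives over half of it.
  The seminorms are arbitrary and say nothing about products: a correction \<open>Q * H\<close> is
  known to be small only through small coefficients in a family of bounded degree, so interpolants
  are real quadratics times controlled factors. As \<open>E\<close> is merely dense, roots and cycle
  points must move to nearby nodes, and the estimates must be uniform in the node. Finally, the
  limit need not differ from an approximant by a multiple of its polynomial; only an inequality |g -
  f| <= \<delta> |Q| survives, and it fixes derivatives because all zeros of \<open>Q\<close> are
  multiple.\<close>

lemma entire_isCont:
  assumes "f holomorphic_on UNIV"
  shows "isCont f z"
  using assms by (meson UNIV_I continuous_on_eq_continuous_at holomorphic_on_imp_continuous_on open_UNIV)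

lemma entire_has_deriv:
  assumes "f holomorphic_on UNIV"
  shows "(f has_field_derivative deriv f z) (at z)"
  using assms holomorphic_derivI[of f UNIV z] by simp

lemma entire_bounded_on_cball:
  fixes f :: "complex \<Rightarrow> complex"
  assumes "f holomorphic_on UNIV"
  shows "\<exists>B>0. \<forall>z\<in>cball a R. cmod (f z) \<le> B"
proof -
  have "continuous_on (cball a R) f"
    by (meson assms holomorphic_on_imp_continuous_on holomorphic_on_subset subset_UNIV)
  then have "bounded (f ` cball a R)"
    by (intro compact_imp_bounded compact_continuous_image) auto
  then show ?thesis
    unfolding bounded_pos by auto
qed

lemma entire_lipschitz_on_cball:
  fixes f :: "complex \<Rightarrow> complex"
  assumes f: "f holomorphic_on UNIV"
  shows "\<exists>L>0. \<forall>x\<in>cball a R. \<forall>y\<in>cball a R. cmod (f x - f y) \<le> L * cmod (x - y)"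
proof -
  have "deriv f holomorphic_on UNIV"
    using f by (simp add: holomorphic_deriv)
  then obtain B where "B > 0" and B: "\<forall>z\<in>cball a R. cmod (deriv f z) \<le> B"
    using entire_bounded_on_cball by blast
  have "cmod (f x - f y) \<le> B * cmod (x - y)" if "x \<in> cball a R" "y \<in> cball a R" for x y
  proof (rule field_differentiable_bound[of "cball a R" f "deriv f"])
    show "(f has_field_derivative deriv f z) (at z within cball a R)" for z
      using entire_has_deriv[OF f] has_field_derivative_at_within by blast
  qed (use B that in auto)
  then show ?thesis using \<open>B > 0\<close> by blast
qed

lemma holomorphic_on_funpow:
  fixes f :: "complex \<Rightarrow> complex"
  assumes "f holomorphic_on UNIV"
  shows "(f ^^ n) holomorphic_on UNIV"
proof (induction n)
  case (Suc n)
  then show ?case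
    using holomorphic_on_compose_gen[OF Suc assms] by (simp add: o_def)
qed (simp add: id_def)

text \<open>Jensen's inequality in its simplest form: dividing out a zero halves the bound.\<close>

lemma cmod_le_half_power_card_zeros:
  assumes "r > 0" "finite Z" "G holomorphic_on UNIV" "Z \<subseteq> cball z0 r"
    and "\<forall>z\<in>Z. G z = 0" "\<forall>z\<in>cball z0 (3 * r). cmod (G z) \<le> M"
  shows "cmod (G z0) \<le> M / 2 ^ card Z"
  using assms(2-6)
proof (induction Z arbitrary: G M rule: finite_induct)
  case empty
  then show ?case using \<open>r > 0\<close> by auto
next
  case (insert a Z)
  define H where "H = (\<lambda>z. if z = a then deriv G a else G z / (z - a))"
  have "G a = 0" using insert by auto
  have H: "H holomorphic_on UNIV"
    using pole_lemma_open[OF insert.prems(1), of a] \<open>G a = 0\<close> unfolding H_def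
    by (simp cong: if_cong)
  have GH: "G z = (z - a) * H z" for z
    using \<open>G a = 0\<close> by (simp add: H_def)
  have a: "dist z0 a \<le> r" using insert by auto
  \<comment> \<open>On the sphere of radius \<open>3 * r\<close> the divisor \<open>z - a\<close>
    has modulus at least \<open>2 * r\<close>, while at the centre it has modulus at most
    \<open>r\<close>; the ratio is the factor 1/2 gained per zero.\<close>
  have "cmod (H z) \<le> M / (2 * r)" if z: "z \<in> cball z0 (3 * r)" for z
  proof (rule maximum_modulus_frontier[of H "cball z0 (3 * r)"])
    show "cmod (H z) \<le> M / (2 * r)" if "z \<in> frontier (cball z0 (3 * r))" for z
    proof -
      have z: "dist z0 z = 3 * r" using that \<open>r > 0\<close> by (simp add: frontier_cball)
      have za: "cmod (z - a) \<ge> 2 * r"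
        using a z dist_triangle[of z0 z a] by (simp add: dist_norm norm_minus_commute)
      have "cmod (G z) \<le> M" using insert.prems(4) z by auto
      then have "2 * r * cmod (H z) \<le> M"
        using za GH[of z] mult_right_mono[OF za, of "cmod (H z)"] by (simp add: norm_mult)
      then show ?thesis using \<open>r > 0\<close> by (simp add: field_simps)
    qed
    show "continuous_on (closure (cball z0 (3 * r))) H" "H holomorphic_on interior (cball z0 (3 * r))"
      using H by (meson holomorphic_on_imp_continuous_on holomorphic_on_subset subset_UNIV)+
  qed (use z in auto)
  moreover have "H z = 0" if "z \<in> Z" for z
    using that insert GH[of z] by auto
  ultimately have "cmod (H z0) \<le> M / (2 * r) / 2 ^ card Z"
    using insert.IH[OF H, of "M / (2 * r)"] insert.prems by auto
  then have "r * cmod (H z0) \<le> M / 2 ^ card (insert a Z)"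
    using \<open>r > 0\<close> insert.hyps by (simp add: field_simps)
  moreover have "cmod (G z0) \<le> r * cmod (H z0)"
    using GH[of z0] a by (simp add: norm_mult dist_norm mult_right_mono)
  ultimately show ?case by linarith
qed

text \<open>For \<open>G\<close> close to \<open>F\<close>, the value \<open>G z0\<close> stays away
  from 0 and \<open>G\<close> stays bounded on a large disc, so Jensen's inequality centred at
  \<open>z0\<close> yields one bound for all such \<open>G\<close>. Multiplicities are ignored: only
  distinct settled points will be counted.\<close>

lemma card_zeros_locally_bounded:
  assumes F: "F holomorphic_on UNIV" and z0: "F z0 \<noteq> 0"
  shows "\<exists>B R \<delta>. \<delta> > 0 \<and> (\<forall>G. G holomorphic_on UNIV \<and> (\<forall>z\<in>cball 0 R. cmod (G z - F z) < \<delta>) \<longrightarrow>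
           finite {z \<in> cball 0 \<rho>. G z = 0} \<and> card {z \<in> cball 0 \<rho>. G z = 0} \<le> B)"
proof -
  \<comment> \<open>The radii ensure that \<open>cball 0 \<rho>\<close> lies in
    \<open>cball z0 r\<close> and \<open>cball z0 (3 * r)\<close> in
    \<open>cball 0 R\<close>.\<close>
  define r where "r = \<bar>\<rho>\<bar> + cmod z0 + 1"
  define R where "R = 3 * r + cmod z0"
  have "r > 0" by (simp add: r_def add_nonneg_pos)
  obtain M where "M > 0" and M: "\<forall>z\<in>cball 0 R. cmod (F z) \<le> M"
    using entire_bounded_on_cball[OF F] by blast
  define \<delta> where "\<delta> = cmod (F z0) / 2"
  have "\<delta> > 0" using z0 by (simp add: \<delta>_def)
  obtain B :: nat where B: "(M + \<delta>) / \<delta> < 2 ^ B"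
    using real_arch_pow[of 2 "(M + \<delta>) / \<delta>"] by auto
  have "finite Z \<and> card Z \<le> B"
    if G: "G holomorphic_on UNIV" "\<forall>z\<in>cball 0 R. cmod (G z - F z) < \<delta>"
      and Z: "Z = {z \<in> cball 0 \<rho>. G z = 0}" for G Z
  proof -
    have *: "card Y \<le> B" if Y: "finite Y" "Y \<subseteq> Z" for Y
    proof -
      have "cmod (G z0) \<le> (M + \<delta>) / 2 ^ card Y"
      proof (rule cmod_le_half_power_card_zeros[OF \<open>r > 0\<close>, of Y G z0])
        show "Y \<subseteq> cball z0 r"
        proof
          fix y assume "y \<in> Y"
          then have "cmod y \<le> \<rho>" using Y Z by auto
          then show "y \<in> cball z0 r"
            using norm_triangle_ineq4[of z0 y] by (simp add: r_def dist_norm)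
        qed
        show "\<forall>z\<in>cball z0 (3 * r). cmod (G z) \<le> M + \<delta>"
        proof
          fix z assume "z \<in> cball z0 (3 * r)"
          then have "cmod z \<le> R"
            using norm_triangle_ineq2[of z z0] by (simp add: R_def dist_norm norm_minus_commute)
          then have "cmod (G z - F z) < \<delta>" "cmod (F z) \<le> M" using G M by auto
          then show "cmod (G z) \<le> M + \<delta>"
            using norm_triangle_ineq2[of "G z" "F z"] by linarith
        qed
      qed (use Y Z G in auto)
      moreover have "cmod (G z0) > \<delta>"
      proof -
        have "cmod (G z0 - F z0) < \<delta>" using G \<open>r > 0\<close> by (simp add: R_def)
        then show ?thesis
          using norm_triangle_ineq2[of "F z0" "F z0 - G z0"]
          by (simp add: \<delta>_def norm_minus_commute)
      qed
      ultimately have "\<delta> < (M + \<delta>) / 2 ^ card Y" by linarith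
      then have "2 ^ card Y < (M + \<delta>) / \<delta>"
        using \<open>\<delta> > 0\<close> by (simp add: field_simps)
      then have "(2::real) ^ card Y < 2 ^ B" using B by linarith
      then show ?thesis by simp
    qed
    have "finite Z"
    proof (rule ccontr)
      assume "infinite Z"
      then obtain Y where "Y \<subseteq> Z" "card Y = Suc B" "finite Y"
        using infinite_arbitrarily_large by metis
      then show False using *[of Y] by simp
    qed
    then show ?thesis using *[of Z] by simp
  qed
  then show ?thesis using \<open>\<delta> > 0\<close> by blast
qed

text \<open>A Lojasiewicz-type inequality. At a zero of order \<open>m\<close>, \<open>F\<close> is
  comparable to the \<open>m\<close>-th power of the distance, while each \<open>h j\<close>
  vanishes there and is Lipschitz; elsewhere \<open>F\<close> is locally bounded below, and
  compactness does the rest. All exponents from \<open>M0\<close> on are allowed so that roots and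
  cycles can later share one. For roots the family is \<open>Q\<close> alone, for cycles it is
  \<open>Q\<close> along the first \<open>n\<close> iterates.\<close>

lemma compact_power_lower_bound:
  fixes F :: "complex \<Rightarrow> complex" and h :: "nat \<Rightarrow> complex \<Rightarrow> complex"
  assumes F: "F holomorphic_on UNIV" and nz: "F z0 \<noteq> 0"
    and h: "\<And>j. h j holomorphic_on UNIV"
    and zeros: "\<And>a j. a \<in> cball 0 \<rho> \<Longrightarrow> F a = 0 \<Longrightarrow> j < n \<Longrightarrow> h j a = 0"
  shows "\<exists>M0\<ge>1. \<forall>M\<ge>M0. \<exists>c>0. \<forall>z\<in>cball 0 \<rho>. c * (\<Sum>j<n. cmod (h j z)) ^ M \<le> cmod (F z)"
proof -
  define \<Phi> where "\<Phi> = (\<lambda>z. \<Sum>j<n. cmod (h j z))"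
  have \<Phi>0: "\<Phi> z \<ge> 0" for z by (simp add: \<Phi>_def sum_nonneg)
  have \<Phi>cont: "continuous_on A \<Phi>" for A
    unfolding \<Phi>_def using h
    by (intro continuous_intros) (meson holomorphic_on_imp_continuous_on holomorphic_on_subset subset_UNIV)
  have bdd: "\<exists>P\<ge>1. \<forall>z\<in>cball a R. \<Phi> z \<le> P" for a R
  proof -
    have "bounded (\<Phi> ` cball a R)"
      by (intro compact_imp_bounded compact_continuous_image \<Phi>cont) auto
    then obtain P where "\<forall>z\<in>cball a R. \<bar>\<Phi> z\<bar> \<le> P" unfolding bounded_iff by auto
    then show ?thesis by (intro exI[of _ "max 1 P"]) (auto simp: max_def intro: order_trans[OF abs_ge_self])
  qed
  have loc: "\<exists>r>0. \<exists>M\<ge>(1::nat). \<exists>c>0. \<forall>z\<in>ball a r. c * \<Phi> z ^ M \<le> cmod (F z)"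
    if a: "a \<in> cball 0 \<rho>" for a
  proof (cases "F a = 0")
    case False
    obtain P where P: "P \<ge> 1" "\<forall>z\<in>cball a 1. \<Phi> z \<le> P" using bdd by blast
    have "isCont F a" using entire_isCont[OF F] .
    then obtain r where "r > 0" and r: "\<And>z. dist z a < r \<Longrightarrow> dist (F z) (F a) < cmod (F a) / 2"
      using False unfolding continuous_at_eps_delta by (metis half_gt_zero zero_less_norm_iff)
    show ?thesis
    proof (intro exI conjI ballI)
      show "min r 1 > 0" using \<open>r > 0\<close> by simp
      show "(1::nat) \<ge> 1" by simp
      show "cmod (F a) / (2 * P) > 0" using False P by simp
      fix z assume z: "z \<in> ball a (min r 1)"
      have "cmod (F a) / 2 \<le> cmod (F z)"
        using r[of z] z norm_triangle_ineq2[of "F a" "F z"]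
        by (simp add: dist_norm norm_minus_commute)
      moreover have "\<Phi> z \<le> P" using z P by auto
      then have "cmod (F a) / (2 * P) * \<Phi> z \<le> cmod (F a) / (2 * P) * P"
        using P by (intro mult_left_mono) auto
      ultimately show "cmod (F a) / (2 * P) * \<Phi> z ^ 1 \<le> cmod (F z)"
        using P by simp
    qed
  next
    case True
    have "\<not> F constant_on UNIV"
      using nz True unfolding constant_on_def by (metis UNIV_I)
    then obtain g r m where m: "0 < m" "0 < r" "g holomorphic_on ball a r"
      and Fg: "\<And>w. w \<in> ball a r \<Longrightarrow> F w = (w - a) ^ m * g w"
      and g0: "\<And>w. w \<in> ball a r \<Longrightarrow> g w \<noteq> 0"
      using holomorphic_factor_zero_nonconstant[OF F _ _ _ True] by (metis UNIV_I connected_UNIV open_UNIV)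
    have "\<exists>L>0. \<forall>z\<in>cball a 1. cmod (h j z) \<le> L * cmod (z - a)" if "j < n" for j
    proof -
      obtain L where "L > 0" "\<forall>x\<in>cball a 1. \<forall>y\<in>cball a 1. cmod (h j x - h j y) \<le> L * cmod (x - y)"
        using entire_lipschitz_on_cball[OF h[of j], of a 1] by blast
      then show ?thesis
        using zeros[OF a True that] by (intro exI[of _ L]) (metis centre_in_cball diff_zero zero_le_one)
    qed
    then obtain L where L: "\<And>j. j < n \<Longrightarrow> L j > 0"
      "\<And>j z. j < n \<Longrightarrow> z \<in> cball a 1 \<Longrightarrow> cmod (h j z) \<le> L j * cmod (z - a)"
      by metis
    define LL where "LL = (\<Sum>j<n. L j) + 1"
    have "(\<Sum>j<n. L j) \<ge> 0" using L(1) by (intro sum_nonneg) (auto intro: less_imp_le)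
    then have "LL > 0" by (simp add: LL_def)
    have \<Phi>L: "\<Phi> z \<le> LL * cmod (z - a)" if "z \<in> cball a 1" for z
    proof -
      have "\<Phi> z \<le> (\<Sum>j<n. L j * cmod (z - a))"
        unfolding \<Phi>_def using L that by (intro sum_mono) auto
      also have "\<dots> \<le> LL * cmod (z - a)"
        by (simp add: LL_def sum_distrib_right algebra_simps)
      finally show ?thesis .
    qed
    define s where "s = min 1 (r / 2)"
    have "s > 0" using m by (simp add: s_def)
    have "compact (g ` cball a s)"
      using m by (intro compact_continuous_image holomorphic_on_imp_continuous_on
        holomorphic_on_subset[OF m(3)]) (auto simp: s_def)
    moreover have "0 \<notin> g ` cball a s" using g0 m by (force simp: s_def)
    ultimately obtain c where "c > 0" and c: "\<forall>w\<in>g ` cball a s. c \<le> dist 0 w"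
      using separate_point_closed[of "g ` cball a s" 0] compact_imp_closed by blast
    show ?thesis
    proof (intro exI conjI ballI)
      show "s > 0" by fact
      show "m \<ge> 1" using m by simp
      show "c / LL ^ m > 0" using \<open>c > 0\<close> \<open>LL > 0\<close> by simp
      fix z assume z: "z \<in> ball a s"
      have "\<Phi> z ^ m \<le> (LL * cmod (z - a)) ^ m"
        using z \<Phi>0 by (intro power_mono \<Phi>L) (auto simp: s_def)
      then have "c / LL ^ m * \<Phi> z ^ m \<le> c / LL ^ m * (LL * cmod (z - a)) ^ m"
        using \<open>c > 0\<close> \<open>LL > 0\<close> by (intro mult_left_mono) auto
      also have "\<dots> = c * cmod (z - a) ^ m"
        using \<open>LL > 0\<close> by (simp add: power_mult_distrib)
      also have "\<dots> \<le> cmod (g z) * cmod (z - a) ^ m"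
        using c z by (intro mult_right_mono) (auto simp: dist_norm)
      also have "\<dots> = cmod (F z)"
        using Fg[of z] z m by (simp add: s_def norm_mult norm_power)
      finally show "c / LL ^ m * \<Phi> z ^ m \<le> cmod (F z)" .
    qed
  qed
  have "\<forall>a\<in>cball 0 \<rho>. \<exists>t. fst t > 0 \<and> fst (snd t) \<ge> (1::nat) \<and> snd (snd t) > 0 \<and>
      (\<forall>z\<in>ball a (fst t). snd (snd t) * \<Phi> z ^ fst (snd t) \<le> cmod (F z))"
  proof
    fix a assume "a \<in> cball (0::complex) \<rho>"
    then obtain r M c where "r > 0" "M \<ge> (1::nat)" "c > 0" "\<forall>z\<in>ball a r. c * \<Phi> z ^ M \<le> cmod (F z)"
      using loc by blast
    then show "\<exists>t. fst t > 0 \<and> fst (snd t) \<ge> (1::nat) \<and> snd (snd t) > 0 \<and>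
      (\<forall>z\<in>ball a (fst t). snd (snd t) * \<Phi> z ^ fst (snd t) \<le> cmod (F z))"
      by (intro exI[of _ "(r, M, c)"]) simp
  qed
  then obtain t where t: "\<forall>a\<in>cball 0 \<rho>. fst (t a) > 0 \<and> fst (snd (t a)) \<ge> (1::nat) \<and> snd (snd (t a)) > 0 \<and>
      (\<forall>z\<in>ball a (fst (t a)). snd (snd (t a)) * \<Phi> z ^ fst (snd (t a)) \<le> cmod (F z))"
    by (rule bchoice[THEN exE])
  define r M c where "r = fst \<circ> t" and "M = fst \<circ> snd \<circ> t" and "c = snd \<circ> snd \<circ> t"
  have r: "\<And>a. a \<in> cball 0 \<rho> \<Longrightarrow> r a > 0"
    and M: "\<And>a. a \<in> cball 0 \<rho> \<Longrightarrow> M a \<ge> (1::nat)"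
    and c: "\<And>a. a \<in> cball 0 \<rho> \<Longrightarrow> c a > 0"
    and b: "\<And>a z. a \<in> cball 0 \<rho> \<Longrightarrow> z \<in> ball a (r a) \<Longrightarrow> c a * \<Phi> z ^ M a \<le> cmod (F z)"
    using t by (auto simp: r_def M_def c_def)
  obtain I where I: "I \<subseteq> cball 0 \<rho>" "finite I" "cball 0 \<rho> \<subseteq> (\<Union>a\<in>I. ball a (r a))"
  proof (rule compactE_image[of "cball 0 \<rho>" "cball 0 \<rho>" "\<lambda>a. ball a (r a)"])
    show "cball 0 \<rho> \<subseteq> (\<Union>a\<in>cball 0 \<rho>. ball a (r a))" using r by force
  qed auto
  obtain P where P: "P \<ge> 1" "\<forall>z\<in>cball 0 \<rho>. \<Phi> z \<le> P" using bdd by blast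
  define c0 where "c0 = Min (insert 1 (c ` I))"
  have "c0 > 0" using c I by (auto simp: c0_def)
  \<comment> \<open>The sum of the local exponents dominates each of them; the surplus power of
    \<Phi> is absorbed by \<open>P ^ N\<close>, since \<open>P \<ge> 1\<close>.\<close>
  show ?thesis
  proof (intro exI[of _ "(\<Sum>a\<in>I. M a) + 1"] conjI allI impI exI ballI)
    fix N assume N: "N \<ge> (\<Sum>a\<in>I. M a) + 1"
    show "c0 / P ^ N > 0" using P \<open>c0 > 0\<close> by simp
    fix z :: complex assume z: "z \<in> cball 0 \<rho>"
    then obtain a where a: "a \<in> I" "z \<in> ball a (r a)" using I by auto
    have "M a \<le> N" using a I member_le_sum[of a I M] N by simp
    then have "\<Phi> z ^ N = \<Phi> z ^ M a * \<Phi> z ^ (N - M a)" by (simp flip: power_add)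
    also have "\<dots> \<le> \<Phi> z ^ M a * P ^ (N - M a)"
      using P z \<Phi>0 by (intro mult_left_mono power_mono) auto
    also have "\<dots> \<le> \<Phi> z ^ M a * P ^ N"
      using P \<Phi>0 by (intro mult_left_mono power_increasing) auto
    finally have "c0 / P ^ N * \<Phi> z ^ N \<le> c0 / P ^ N * (\<Phi> z ^ M a * P ^ N)"
      using \<open>c0 > 0\<close> P by (intro mult_left_mono) auto
    also have "\<dots> = c0 * \<Phi> z ^ M a" using P by simp
    also have "\<dots> \<le> c a * \<Phi> z ^ M a"
      using a I \<Phi>0 by (intro mult_right_mono) (auto simp: c0_def)
    also have "\<dots> \<le> cmod (F z)" using b a I by blast
    finally show "c0 / P ^ N * (\<Sum>j<n. cmod (h j z)) ^ N \<le> cmod (F z)"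
      by (simp add: \<Phi>_def)
  qed simp
qed

lemma poly_entire: "poly p holomorphic_on (UNIV :: complex set)"
  unfolding holomorphic_on_def field_differentiable_def
  using poly_DERIV has_field_derivative_at_within by blast

text \<open>In the step, \<open>g u - f v\<close> splits into \<open>g u - f u\<close> and
  \<open>f u - f v\<close>. The first is controlled by \<open>Q\<close> at \<open>u\<close>, which
  differs from \<open>Q\<close> at \<open>v\<close> by a multiple of |u - v|; the induction
  hypothesis and \<open>M \<ge> 1\<close> bound this by a multiple of the sum. The second is
  Lipschitz. The bound has the same shape as the left side of
  \<open>compact_power_lower_bound\<close>, with which it will be compared.\<close>

lemma iterate_perturbation_bound:
  assumes f: "f holomorphic_on UNIV" and M: "M \<ge> 1"
  shows "\<exists>C>0. \<exists>R>0. \<forall>\<delta> g. 0 \<le> \<delta> \<and> \<delta> \<le> 1 \<and>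
           (\<forall>z\<in>cball 0 R. cmod (g z - f z) \<le> \<delta> * cmod (poly Q z) ^ M) \<longrightarrow>
           (\<forall>z\<in>cball 0 \<rho>. cmod ((g ^^ n) z - (f ^^ n) z)
               \<le> C * \<delta> * (\<Sum>j<n. cmod (poly Q ((f ^^ j) z))) ^ M)"
proof (induction n)
  case 0
  have "\<exists>R::real. R > 0" by (rule exI[of _ 1]) simp
  then show ?case using M by (intro exI[of _ "1::real"]) auto
next
  case (Suc n)
  define \<Phi> where "\<Phi> = (\<lambda>n z. \<Sum>j<n. cmod (poly Q ((f ^^ j) z)))"
  have \<Phi>0: "\<Phi> n z \<ge> 0" for n z by (simp add: \<Phi>_def sum_nonneg)
  obtain C R where "C > 0" "R > 0" and IH: "\<And>\<delta> g z. 0 \<le> \<delta> \<Longrightarrow> \<delta> \<le> 1 \<Longrightarrow>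
           (\<forall>z\<in>cball 0 R. cmod (g z - f z) \<le> \<delta> * cmod (poly Q z) ^ M) \<Longrightarrow> z \<in> cball 0 \<rho> \<Longrightarrow>
           cmod ((g ^^ n) z - (f ^^ n) z) \<le> C * \<delta> * \<Phi> n z ^ M"
    using Suc.IH unfolding \<Phi>_def by blast
  obtain B0 where "B0 > 0" and B0: "\<And>z. z \<in> cball 0 \<rho> \<Longrightarrow> cmod ((f ^^ n) z) \<le> B0"
    using entire_bounded_on_cball[OF holomorphic_on_funpow[OF f]] by blast
  have "continuous_on (cball 0 \<rho>) (\<Phi> n)"
    unfolding \<Phi>_def
    by (intro continuous_intros)
       (meson f holomorphic_on_funpow holomorphic_on_imp_continuous_on holomorphic_on_subset subset_UNIV)
  then have "bounded (\<Phi> n ` cball 0 \<rho>)"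
    by (intro compact_imp_bounded compact_continuous_image) auto
  then obtain P where "P > 0" and P: "\<And>z. z \<in> cball 0 \<rho> \<Longrightarrow> \<Phi> n z \<le> P"
    unfolding bounded_pos using \<Phi>0 by auto
  \<comment> \<open>A radius that contains \<open>v\<close> and every possible \<open>u\<close>,
    since the \<open>n\<close>-th iterates differ by at most \<open>C * P ^ M\<close> when
    \<open>\<delta> \<le> 1\<close>.\<close>
  define B1 where "B1 = B0 + C * P ^ M"
  have "B0 \<le> B1" "B1 > 0" using \<open>B0 > 0\<close> \<open>C > 0\<close> \<open>P > 0\<close> by (auto simp: B1_def add_pos_pos)
  obtain Lf where "Lf > 0" and Lf: "\<And>x y. x \<in> cball 0 B1 \<Longrightarrow> y \<in> cball 0 B1 \<Longrightarrow> cmod (f x - f y) \<le> Lf * cmod (x - y)"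
    using entire_lipschitz_on_cball[OF f, of 0 B1] by blast
  obtain LQ where "LQ > 0" and LQ: "\<And>x y. x \<in> cball 0 B1 \<Longrightarrow> y \<in> cball 0 B1 \<Longrightarrow> cmod (poly Q x - poly Q y) \<le> LQ * cmod (x - y)"
    using entire_lipschitz_on_cball[OF poly_entire, of 0 B1] by blast
  define D where "D = 1 + LQ * C * P ^ (M - 1)"
  have "D > 0" using \<open>LQ > 0\<close> \<open>C > 0\<close> \<open>P > 0\<close> by (auto simp: D_def add_pos_pos)
  show ?case
  proof (intro exI conjI allI impI ballI)
    show "D ^ M + Lf * C > 0" using \<open>D > 0\<close> \<open>Lf > 0\<close> \<open>C > 0\<close> by (simp add: add_pos_pos)
    show "max R B1 > 0" using \<open>R > 0\<close> by simp
    fix \<delta> :: real and g :: "complex \<Rightarrow> complex" and z :: complex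
    assume "0 \<le> \<delta> \<and> \<delta> \<le> 1 \<and> (\<forall>z\<in>cball 0 (max R B1). cmod (g z - f z) \<le> \<delta> * cmod (poly Q z) ^ M)"
      and z: "z \<in> cball 0 \<rho>"
    then have \<delta>: "0 \<le> \<delta>" "\<delta> \<le> 1"
      and gR: "\<forall>z\<in>cball 0 R. cmod (g z - f z) \<le> \<delta> * cmod (poly Q z) ^ M"
      and gB: "\<forall>z\<in>cball 0 B1. cmod (g z - f z) \<le> \<delta> * cmod (poly Q z) ^ M" by auto
    define u v \<Psi> where "u = (g ^^ n) z" and "v = (f ^^ n) z" and "\<Psi> = \<Phi> (Suc n) z"
    have \<Psi>: "\<Phi> n z \<le> \<Psi>" "cmod (poly Q v) + \<Phi> n z = \<Psi>" by (auto simp: \<Psi>_def v_def \<Phi>_def)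
    have uv: "cmod (u - v) \<le> C * \<delta> * \<Phi> n z ^ M" unfolding u_def v_def by (rule IH[OF \<delta> gR z])
    also have "\<dots> \<le> C * 1 * P ^ M"
      using \<open>C > 0\<close> \<delta> P[OF z] \<Phi>0 by (intro mult_mono power_mono) auto
    finally have "cmod u \<le> B1"
      using B0[OF z] norm_triangle_ineq2[of u v] by (simp add: B1_def v_def)
    then have u: "u \<in> cball 0 B1" by simp
    have v: "v \<in> cball 0 B1" using B0[OF z] \<open>B0 \<le> B1\<close> by (simp add: v_def)
    have "\<Phi> n z ^ M = \<Phi> n z ^ (M - 1) * \<Phi> n z" using M by (cases M) auto
    also have "\<dots> \<le> P ^ (M - 1) * \<Phi> n z"
      using P[OF z] \<Phi>0 by (intro mult_right_mono power_mono) auto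
    finally have "C * \<delta> * \<Phi> n z ^ M \<le> C * 1 * (P ^ (M - 1) * \<Phi> n z)"
      using \<delta> \<open>C > 0\<close> \<Phi>0 by (intro mult_mono) auto
    then have "LQ * cmod (u - v) \<le> LQ * (C * (P ^ (M - 1) * \<Phi> n z))"
      using uv \<open>LQ > 0\<close> by (intro mult_left_mono) auto
    then have "cmod (poly Q u) \<le> cmod (poly Q v) + LQ * C * P ^ (M - 1) * \<Phi> n z"
      using LQ[OF u v] norm_triangle_ineq2[of "poly Q u" "poly Q v"] by (simp add: mult.assoc)
    also have "\<dots> \<le> \<Psi> + LQ * C * P ^ (M - 1) * \<Psi>"
      using \<Psi> \<Phi>0[of n z] \<open>LQ > 0\<close> \<open>C > 0\<close> \<open>P > 0\<close> by (intro add_mono mult_left_mono) auto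
    finally have "cmod (poly Q u) \<le> D * \<Psi>" by (simp add: D_def algebra_simps)
    then have "\<delta> * cmod (poly Q u) ^ M \<le> \<delta> * (D * \<Psi>) ^ M"
      using \<delta> by (intro mult_left_mono power_mono) auto
    then have 1: "cmod (g u - f u) \<le> \<delta> * (D ^ M * \<Psi> ^ M)"
      using gB u by (force simp: power_mult_distrib)
    have "cmod (f u - f v) \<le> Lf * (C * \<delta> * \<Phi> n z ^ M)"
      using Lf[OF u v] mult_left_mono[OF uv, of Lf] \<open>Lf > 0\<close> by linarith
    also have "\<dots> \<le> Lf * (C * \<delta> * \<Psi> ^ M)"
      using \<open>Lf > 0\<close> \<open>C > 0\<close> \<delta> \<Psi> \<Phi>0 by (intro mult_left_mono power_mono) auto
    finally have 2: "cmod (f u - f v) \<le> Lf * (C * \<delta> * \<Psi> ^ M)" .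
    have "cmod (g u - f v) \<le> (D ^ M + Lf * C) * \<delta> * \<Psi> ^ M"
      using 1 2 norm_triangle_ineq[of "g u - f u" "f u - f v"] by (simp add: algebra_simps)
    then show "cmod ((g ^^ Suc n) z - (f ^^ Suc n) z)
        \<le> (D ^ M + Lf * C) * \<delta> * (\<Sum>j<Suc n. cmod (poly Q ((f ^^ j) z))) ^ M"
      by (simp add: u_def v_def \<Psi>_def \<Phi>_def)
  qed
qed

text \<open>Dividing the bound by \<open>z - a\<close> makes the right side tend to 0 at a multiple
  zero. An inequality is assumed rather than divisibility by \<open>Q\<close>, because this is all
  that is known about the limit map.\<close>

lemma deriv_eq_of_tangent:
  assumes f: "f holomorphic_on UNIV" and g: "g holomorphic_on UNIV"
    and Q: "poly Q a = 0" "poly (pderiv Q) a = 0"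
    and R: "cmod a < R" and close: "\<forall>z\<in>cball 0 R. cmod (g z - f z) \<le> \<delta> * cmod (poly Q z)"
  shows "g a = f a" "deriv g a = deriv f a"
proof -
  have "cmod (g a - f a) \<le> \<delta> * cmod (poly Q a)" using close R by auto
  then show ga: "g a = f a" using Q by simp
  have "((\<lambda>z. (poly Q z - poly Q a) / (z - a)) \<longlongrightarrow> 0) (at a)"
    using poly_DERIV[of Q a] Q by (simp add: has_field_derivative_iff)
  then have lim: "((\<lambda>z. \<delta> * cmod (poly Q z / (z - a))) \<longlongrightarrow> 0) (at a)"
    using Q by (intro tendsto_mult_right_zero tendsto_norm_zero) simp
  have "((\<lambda>z. (g z - f z) / (z - a)) \<longlongrightarrow> 0) (at a)"
  proof (rule Lim_null_comparison[OF _ lim])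
    have "\<forall>\<^sub>F z in at a. z \<in> ball 0 R"
      using R by (intro eventually_at_in_open') auto
    then show "\<forall>\<^sub>F z in at a. cmod ((g z - f z) / (z - a)) \<le> \<delta> * cmod (poly Q z / (z - a))"
    proof eventually_elim
      case (elim z)
      then show ?case using close by (auto simp: norm_divide divide_right_mono)
    qed
  qed
  then have "((\<lambda>z. g z - f z) has_field_derivative 0) (at a)"
    using ga by (simp add: has_field_derivative_iff)
  moreover have "((\<lambda>z. g z - f z) has_field_derivative deriv g a - deriv f a) (at a)"
    by (intro derivative_intros entire_has_deriv f g)
  ultimately show "deriv g a = deriv f a" using DERIV_unique by fastforce
qed

section \<open>Multipliers and exact periods along an orbit\<close>

lemma deriv_funpow:
  assumes "f holomorphic_on UNIV"
  shows "deriv (f ^^ n) z = (\<Prod>i<n. deriv f ((f ^^ i) z))"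
proof (induction n)
  case 0
  then show ?case by (simp add: id_def)
next
  case (Suc n)
  have "((\<lambda>x. f ((f ^^ n) x)) has_field_derivative deriv f ((f ^^ n) z) * deriv (f ^^ n) z) (at z)"
    using DERIV_chain2 entire_has_deriv assms holomorphic_on_funpow by blast
  then show ?case using Suc by (simp add: DERIV_imp_deriv o_def mult.commute)
qed

lemma exact_period_image:
  assumes f: "f holomorphic_on UNIV" and z: "exact_period f n z"
  shows "exact_period f n (f z)" "multiplier f n (f z) = multiplier f n z"
proof -
  have n: "n > 0" "(f ^^ n) z = z" using z by (auto simp: exact_period_def)
  have shift: "(f ^^ m) (f z) = f ((f ^^ m) z)" for m by (simp add: funpow_swap1)
  have "(f ^^ m) (f z) \<noteq> f z" if m: "0 < m" "m < n" for m
  proof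
    assume "(f ^^ m) (f z) = f z"
    then have "(f ^^ (n - 1)) ((f ^^ Suc m) z) = (f ^^ (n - 1)) (f z)"
      using shift by simp
    moreover have "(f ^^ (n - 1)) ((f ^^ Suc m) z) = (f ^^ m) ((f ^^ n) z)"
    proof -
      have "n - 1 + Suc m = m + n" using n by simp
      then show ?thesis by (metis comp_apply funpow_add)
    qed
    moreover have "(f ^^ (n - 1)) (f z) = z"
      using n by (metis One_nat_def Suc_diff_1 funpow_swap1 funpow_simps_right(2) o_apply)
    ultimately show False using n m z by (auto simp: exact_period_def)
  qed
  then show "exact_period f n (f z)" using n shift by (auto simp: exact_period_def)
  obtain k where k: "n = Suc k" using n by (cases n) auto
  have "multiplier f n (f z) = (\<Prod>i<Suc k. deriv f ((f ^^ Suc i) z))"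
    unfolding multiplier_def k deriv_funpow[OF f] by (simp add: shift)
  also have "\<dots> = (\<Prod>i<k. deriv f ((f ^^ Suc i) z)) * deriv f z"
    using n by (simp only: prod.lessThan_Suc k)
  also have "\<dots> = (\<Prod>i<Suc k. deriv f ((f ^^ i) z))"
    by (simp only: prod.lessThan_Suc_shift) simp
  finally show "multiplier f n (f z) = multiplier f n z"
    unfolding multiplier_def k deriv_funpow[OF f] .
qed

lemma exact_period_funpow:
  assumes f: "f holomorphic_on UNIV" and z: "exact_period f n z"
  shows "exact_period f n ((f ^^ k) z) \<and> multiplier f n ((f ^^ k) z) = multiplier f n z"
  by (induction k) (use z exact_period_image[OF f] in auto)

lemma real_map_funpow: "real_map f \<Longrightarrow> (f ^^ n) (cnj z) = cnj ((f ^^ n) z)"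
  by (induction n) (auto simp: real_map_def)

lemma real_map_deriv:
  assumes "f holomorphic_on UNIV" "real_map f"
  shows "deriv f (cnj z) = cnj (deriv f z)"
proof -
  have "(cnj \<circ> f \<circ> cnj has_field_derivative cnj (deriv f z)) (at (cnj z))"
    using has_field_derivative_cnj_cnj[of f "deriv f z" "cnj z"] entire_has_deriv[OF assms(1), of z] by simp
  moreover have "cnj \<circ> f \<circ> cnj = f" using assms(2) by (auto simp: real_map_def)
  ultimately show ?thesis by (simp add: DERIV_imp_deriv)
qed

lemma exact_period_cnj:
  assumes f: "f holomorphic_on UNIV" "real_map f"
  shows "exact_period f n (cnj z) \<longleftrightarrow> exact_period f n z"
    "multiplier f n (cnj z) = cnj (multiplier f n z)"
  using f by (auto simp: exact_period_def multiplier_def deriv_funpow real_map_funpow real_map_deriv)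

lemma exact_period_exists:
  assumes "periodic_point f z"
  shows "\<exists>n. exact_period f n z"
proof -
  define n where "n = (LEAST n. n > 0 \<and> (f ^^ n) z = z)"
  have ex: "\<exists>n. n > 0 \<and> (f ^^ n) z = z" using assms by (auto simp: periodic_point_def)
  have "n > 0 \<and> (f ^^ n) z = z" unfolding n_def by (rule LeastI_ex[OF ex])
  moreover have "\<not> (m > 0 \<and> (f ^^ m) z = z)" if "m < n" for m
    using that unfolding n_def by (rule not_less_Least)
  ultimately show ?thesis by (auto simp: exact_period_def)
qed

section \<open>Real and even polynomials\<close>

definition on_axes :: "complex \<Rightarrow> bool" where
  "on_axes u \<longleftrightarrow> Im u = 0 \<or> Re u = 0"

lemma on_axes_iff: "on_axes u \<longleftrightarrow> Im (u\<^sup>2) = 0"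
  by (auto simp: on_axes_def power2_eq_square)

lemma on_axes_cnj: "on_axes u \<Longrightarrow> cnj u = u \<or> cnj u = - u"
  by (auto simp: on_axes_def complex_eq_iff)

lemma real_even_value_real:
  assumes "real_map g" "even_map g" "on_axes u"
  shows "Im (g u) = 0"
proof -
  have "cnj (g u) = g u"
    using on_axes_cnj[OF assms(3)] assms(1,2) unfolding real_map_def even_map_def by metis
  then show ?thesis by (simp add: complex_eq_iff)
qed

definition real_even :: "complex poly \<Rightarrow> bool" where
  "real_even p \<longleftrightarrow> real_map (poly p) \<and> even_map (poly p)"

lemma real_even_0 [simp]: "real_even 0"
  and real_even_1 [simp]: "real_even 1"
  and real_even_add: "real_even p \<Longrightarrow> real_even r \<Longrightarrow> real_even (p + r)"
  and real_even_mult: "real_even p \<Longrightarrow> real_even r \<Longrightarrow> real_even (p * r)"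
  and real_even_smult: "real_even p \<Longrightarrow> real_even (smult (of_real c) p)"
  by (simp_all add: real_even_def real_map_def even_map_def)

lemma real_even_power: "real_even p \<Longrightarrow> real_even (p ^ n)"
  by (induction n) (auto intro: real_even_mult)

lemma real_even_prod: "(\<And>i. i \<in> I \<Longrightarrow> real_even (p i)) \<Longrightarrow> real_even (prod p I)"
  by (induction I rule: infinite_finite_induct) (auto intro: real_even_mult)

lemma real_even_square_var [simp]: "real_even [:0, 0, 1:]"
  by (simp add: real_even_def real_map_def even_map_def)

lemma real_even_quad [simp]: "real_even [:of_real a, 0, of_real b:]"
  by (simp add: real_even_def real_map_def even_map_def)

lemmas real_even_intros = real_even_add real_even_mult real_even_smult real_even_power real_even_prod

text \<open>The orbit of \<open>u\<close> under the group generated by negation and conjugation: the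
  points where a real and even map is determined, up to conjugation, by its value at
  \<open>u\<close>.\<close>

definition sym_class :: "complex \<Rightarrow> complex set" where
  "sym_class u = {u, - u, cnj u, - cnj u}"

lemma finite_sym_class [simp]: "finite (sym_class u)"
  by (simp add: sym_class_def)

lemma sym_class_self [simp]: "u \<in> sym_class u"
  by (simp add: sym_class_def)

lemma sym_class_symmetric: "x \<in> sym_class u \<longleftrightarrow> u \<in> sym_class x"
  by (auto simp: sym_class_def)

lemma sym_class_trans: "x \<in> sym_class u \<Longrightarrow> u \<in> sym_class v \<Longrightarrow> x \<in> sym_class v"
  by (auto simp: sym_class_def)

lemma real_even_sym_class:
  assumes "real_map g" "even_map g" "x \<in> sym_class u"
  shows "g x = g u \<or> g x = cnj (g u)"
  using assms by (auto simp: sym_class_def real_map_def even_map_def)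

lemma real_even_zero_sym_class:
  assumes "real_even p" "x \<in> sym_class u"
  shows "poly p x = 0 \<longleftrightarrow> poly p u = 0"
  using real_even_sym_class[of "poly p" x u] assms by (auto simp: real_even_def)

text \<open>On the axes the two quadratic factors coincide. Only one is kept there, so that the
  zeros are simple for \<open>u \<noteq> 0\<close> and the derivative at \<open>u\<close> can be
  steered. The price is a jump of \<open>sym_poly u\<close> when \<open>u\<close> reaches an
  axis.\<close>

definition sym_poly :: "complex \<Rightarrow> complex poly" where
  "sym_poly u = (if on_axes u then [:- (u\<^sup>2), 0, 1:] else [:- (u\<^sup>2), 0, 1:] * [:- ((cnj u)\<^sup>2), 0, 1:])"

lemma cnj_square_on_axes: "on_axes u \<Longrightarrow> (cnj u)\<^sup>2 = u\<^sup>2"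
  using on_axes_cnj[of u] by auto

lemma poly_sym_poly: "poly (sym_poly u) z =
    (if on_axes u then z\<^sup>2 - u\<^sup>2 else (z\<^sup>2 - u\<^sup>2) * (z\<^sup>2 - (cnj u)\<^sup>2))"
  by (simp add: sym_poly_def power2_eq_square algebra_simps)

lemma real_even_sym_poly [simp]: "real_even (sym_poly u)"
proof -
  have "cnj (poly (sym_poly u) z) = poly (sym_poly u) (cnj z)" for z
    using cnj_square_on_axes[of u] by (auto simp: poly_sym_poly)
  then show ?thesis
    by (auto simp: real_even_def real_map_def even_map_def) (auto simp: poly_sym_poly)
qed

lemma sym_poly_zero_iff: "poly (sym_poly u) z = 0 \<longleftrightarrow> z \<in> sym_class u"
proof (cases "on_axes u")
  case True
  then show ?thesis
    using on_axes_cnj[of u] by (auto simp: poly_sym_poly sym_class_def power2_eq_iff)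
next
  case False
  then show ?thesis by (auto simp: poly_sym_poly sym_class_def power2_eq_iff)
qed

lemma sym_poly_nonzero: "sym_poly u \<noteq> 0"
  by (auto simp: sym_poly_def)

lemma pderiv_sym_poly:
  assumes "u \<noteq> 0"
  shows "poly (pderiv (sym_poly u)) u \<noteq> 0"
proof (cases "on_axes u")
  case True
  then show ?thesis using assms by (simp add: sym_poly_def pderiv_pCons)
next
  case False
  have "Im ((cnj u)\<^sup>2) = - Im (u\<^sup>2)" by (simp add: power2_eq_square)
  then have "u\<^sup>2 \<noteq> (cnj u)\<^sup>2"
    using False unfolding on_axes_iff by (metis equal_neg_zero)
  moreover have "poly (pderiv (sym_poly u)) u = 2 * u * (u\<^sup>2 - (cnj u)\<^sup>2)"
    using False by (simp add: sym_poly_def pderiv_mult pderiv_pCons power2_eq_square algebra_simps)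
  ultimately show ?thesis using assms by simp
qed

text \<open>The coefficients are 1 and the elementary symmetric functions of \<open>u^2\<close> and
  its conjugate, or \<open>-u^2\<close> and 1 on the axes; \<open>1 + 2 * r^2 + r^4\<close>
  majorizes all of them in both cases. Seminorms of products are estimated through these
  coefficients.\<close>

lemma sym_poly_coeffs:
  assumes "cmod u \<le> r"
  shows "\<exists>a b c. sym_poly u = [:of_real a, 0, of_real b, 0, of_real c:] \<and>
           \<bar>a\<bar> \<le> (1 + r\<^sup>2)\<^sup>2 \<and> \<bar>b\<bar> \<le> (1 + r\<^sup>2)\<^sup>2 \<and> \<bar>c\<bar> \<le> (1 + r\<^sup>2)\<^sup>2"
proof -
  have r: "(cmod u)\<^sup>2 \<le> r\<^sup>2" using assms by (intro power_mono) auto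
  have B: "1 + 2 * r\<^sup>2 + r\<^sup>2 * r\<^sup>2 = (1 + r\<^sup>2)\<^sup>2" by (simp add: power2_eq_square algebra_simps)
  have r4: "r\<^sup>2 * r\<^sup>2 \<ge> 0" "r\<^sup>2 \<ge> 0" by auto
  have Re: "\<bar>Re (u\<^sup>2)\<bar> \<le> r\<^sup>2" using abs_Re_le_cmod[of "u\<^sup>2"] r by (simp add: norm_power)
  show ?thesis
  proof (cases "on_axes u")
    case True
    then have "u\<^sup>2 = of_real (Re (u\<^sup>2))" by (simp add: complex_eq_iff on_axes_iff del: Re_power2 Im_power2)
    then have "sym_poly u = [:of_real (- Re (u\<^sup>2)), 0, of_real 1, 0, of_real 0:]"
      using True by (simp add: sym_poly_def)
    moreover have "\<bar>- Re (u\<^sup>2)\<bar> \<le> (1 + r\<^sup>2)\<^sup>2" "\<bar>1\<bar> \<le> (1 + r\<^sup>2)\<^sup>2" "\<bar>0\<bar> \<le> (1 + r\<^sup>2)\<^sup>2"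
      using Re r4 B by linarith+
    ultimately show ?thesis by blast
  next
    case False
    have 1: "u\<^sup>2 * (cnj u)\<^sup>2 = of_real (((cmod u)\<^sup>2)\<^sup>2)"
      by (metis complex_norm_square of_real_power power_mult_distrib)
    have 2: "u\<^sup>2 + (cnj u)\<^sup>2 = of_real (2 * Re (u\<^sup>2))"
      by (metis complex_add_cnj complex_cnj_power)
    have "sym_poly u = [:u\<^sup>2 * (cnj u)\<^sup>2, 0, - (u\<^sup>2 + (cnj u)\<^sup>2), 0, 1:]"
      using False by (simp add: sym_poly_def)
    then have "sym_poly u = [:of_real (((cmod u)\<^sup>2)\<^sup>2), 0, of_real (- (2 * Re (u\<^sup>2))), 0, of_real 1:]"
      unfolding 1 2 by simp
    moreover have "\<bar>((cmod u)\<^sup>2)\<^sup>2\<bar> \<le> r\<^sup>2 * r\<^sup>2"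
      using r mult_mono[OF r r] by (simp add: power2_eq_square)
    then have "\<bar>((cmod u)\<^sup>2)\<^sup>2\<bar> \<le> (1 + r\<^sup>2)\<^sup>2" "\<bar>- (2 * Re (u\<^sup>2))\<bar> \<le> (1 + r\<^sup>2)\<^sup>2" "\<bar>1\<bar> \<le> (1 + r\<^sup>2)\<^sup>2"
      using Re r4 B by linarith+
    ultimately show ?thesis by blast
  qed
qed

text \<open>The real solution of \<open>a + b * u^2 = t\<close>: comparing imaginary parts gives the
  slope \<open>b\<close>, and real parts then give the constant \<open>a\<close>.\<close>

definition interp_slope :: "complex \<Rightarrow> complex \<Rightarrow> real" where
  "interp_slope u t = Im t / Im (u\<^sup>2)"

definition interp_const :: "complex \<Rightarrow> complex \<Rightarrow> real" where
  "interp_const u t = Re t - interp_slope u t * Re (u\<^sup>2)"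

definition interp_poly :: "complex \<Rightarrow> complex \<Rightarrow> complex poly" where
  "interp_poly u t = [:of_real (interp_const u t), 0, of_real (interp_slope u t):]"

lemma real_even_interp_poly [simp]: "real_even (interp_poly u t)"
  by (simp add: interp_poly_def)

text \<open>On the axes the slope is \<open>x / 0 = 0\<close>, and the interpolant is the real constant \<open>t\<close>.\<close>

lemma poly_interp_poly:
  assumes "on_axes u \<Longrightarrow> Im t = 0"
  shows "poly (interp_poly u t) u = t"
proof -
  have "poly (interp_poly u t) u = of_real (interp_const u t) + of_real (interp_slope u t) * u\<^sup>2"
    by (simp add: interp_poly_def power2_eq_square algebra_simps)
  also have "\<dots> = t"
    using assms by (auto simp: complex_eq_iff on_axes_iff interp_const_def interp_slope_def
        simp del: Re_power2 Im_power2)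
  finally show ?thesis .
qed

text \<open>Off the axes the denominators converge to a nonzero number. At a limit on the axes they
  would tend to 0 for nodes approaching from outside; nodes on the axes have slope exactly
  0.\<close>

lemma interp_tendsto_0:
  assumes u: "u \<longlonglongrightarrow> w" and t: "t \<longlonglongrightarrow> 0" and ax: "on_axes w \<Longrightarrow> \<forall>k. on_axes (u k)"
  shows "(\<lambda>k. interp_slope (u k) (t k)) \<longlonglongrightarrow> 0" "(\<lambda>k. interp_const (u k) (t k)) \<longlonglongrightarrow> 0"
proof -
  show s: "(\<lambda>k. interp_slope (u k) (t k)) \<longlonglongrightarrow> 0"
  proof (cases "on_axes w")
    case True
    then have "interp_slope (u k) (t k) = 0" for k
      using ax by (simp add: interp_slope_def on_axes_iff del: Im_power2)
    then show ?thesis by simp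
  next
    case False
    have "(\<lambda>k. Im (t k) / Im ((u k)\<^sup>2)) \<longlonglongrightarrow> Im 0 / Im (w\<^sup>2)"
      using False by (intro tendsto_intros u t) (simp add: on_axes_iff del: Im_power2)
    then show ?thesis by (simp add: interp_slope_def)
  qed
  have "(\<lambda>k. Re (t k) - interp_slope (u k) (t k) * Re ((u k)\<^sup>2)) \<longlonglongrightarrow> Re 0 - 0 * Re (w\<^sup>2)"
    by (intro tendsto_intros u t s)
  then show "(\<lambda>k. interp_const (u k) (t k)) \<longlonglongrightarrow> 0" by (simp add: interp_const_def)
qed

text \<open>A \<open>sym_poly\<close> has at most two factors of the form \<open>z^2 - v^2\<close>,
  each of modulus at most \<open>1 + R^2 + r^2\<close>; its square contributes four per
  node.\<close>

lemma poly_sym_prod_bound: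
  assumes "\<forall>j<m. cmod (w j) \<le> r" "cmod z \<le> R" "R \<ge> 0"
  shows "cmod (poly (\<Prod>j<m. (sym_poly (w j))\<^sup>2) z) \<le> (1 + R\<^sup>2 + r\<^sup>2) ^ (4 * m)"
  using assms(1)
proof (induction m)
  case 0
  then show ?case by simp
next
  case (Suc m)
  define B where "B = 1 + R\<^sup>2 + r\<^sup>2"
  have "B \<ge> 1" by (simp add: B_def)
  have z: "(cmod z)\<^sup>2 \<le> R\<^sup>2" using assms by (intro power_mono) auto
  have w: "(cmod (w m))\<^sup>2 \<le> r\<^sup>2" using Suc.prems by (intro power_mono) auto
  have *: "cmod (z\<^sup>2 - v\<^sup>2) \<le> B" if "cmod v = cmod (w m)" for v
    using norm_triangle_ineq4[of "z\<^sup>2" "v\<^sup>2"] z w that by (simp add: norm_power B_def)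
  have "cmod (poly (sym_poly (w m)) z) \<le> B\<^sup>2"
  proof (cases "on_axes (w m)")
    case True
    have "B \<le> B\<^sup>2" using \<open>B \<ge> 1\<close> by (simp add: power2_eq_square)
    then show ?thesis using *[of "w m"] True by (simp add: poly_sym_poly)
  next
    case False
    then show ?thesis
      using *[of "w m"] *[of "cnj (w m)"] \<open>B \<ge> 1\<close>
      by (simp add: poly_sym_poly norm_mult power2_eq_square mult_mono)
  qed
  then have "(cmod (poly (sym_poly (w m)) z))\<^sup>2 \<le> (B\<^sup>2)\<^sup>2" by (intro power_mono) auto
  then have "cmod (poly (\<Prod>j<m. (sym_poly (w j))\<^sup>2) z) * (cmod (poly (sym_poly (w m)) z))\<^sup>2
      \<le> B ^ (4 * m) * (B\<^sup>2)\<^sup>2"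
    using Suc \<open>B \<ge> 1\<close> by (intro mult_mono) (auto simp: B_def)
  also have "\<dots> = B ^ (4 * Suc m)" by (simp add: power_mult power_add eval_nat_numeral)
  finally show ?case by (simp add: norm_mult norm_power B_def)
qed

text \<open>Removing \<open>X\<close> leaves an open set, which still contains a point of
  \<open>S\<close> because \<open>S\<close> is infinite in the ball; density of \<open>D\<close> is
  applied at that point instead of \<open>w\<close>.\<close>

lemma dense_avoiding_finite:
  fixes w :: complex
  assumes "finite X" "\<epsilon> > 0" "w \<in> S" "S \<subseteq> closure D"
    and "\<And>d. d > 0 \<Longrightarrow> infinite (ball w d \<inter> S)"
  shows "\<exists>v\<in>D. v \<notin> X \<and> cmod (v - w) < \<epsilon>"
proof -
  obtain x where x: "x \<in> ball w \<epsilon> \<inter> S" "x \<notin> X"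
    using assms by (metis finite_subset subsetI)
  have "open (ball w \<epsilon> - X)" using assms(1) by (intro open_Diff finite_imp_closed) auto
  moreover have "x \<in> closure D" using x assms by auto
  ultimately obtain v where "v \<in> D" "v \<in> ball w \<epsilon> - X"
    using x by (metis DiffI IntE closure_iff_nhds_not_empty disjoint_iff order_refl)
  then show ?thesis by (auto simp: dist_norm norm_minus_commute)
qed

lemma infinite_ball_real:
  assumes "Im w = 0" "d > 0"
  shows "infinite (ball w d \<inter> {z. Im z = 0 \<and> z \<noteq> 0})"
proof -
  have "infinite {0<..<d}" using assms by simp
  moreover have "inj (\<lambda>t. w + of_real t)" by (auto simp: inj_def)
  ultimately have "infinite ((\<lambda>t. w + of_real t) ` {0<..<d})"
    by (metis finite_imageD inj_on_subset subset_UNIV)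
  moreover have "(\<lambda>t. w + of_real t) ` {0<..<d} \<subseteq> insert 0 (ball w d \<inter> {z. Im z = 0 \<and> z \<noteq> 0})"
    using assms by (auto simp: dist_norm)
  ultimately show ?thesis by (metis finite_insert finite_subset)
qed

text \<open>The topology is absent here: the lemmas take an arbitrary seminorm \<open>q\<close> on
  \<open>F\<close> instead, and only the final limit uses the family defining the topology.\<close>

locale target_sets =
  fixes F :: "(complex \<Rightarrow> complex) set" and E \<Lambda> :: "complex set"
  assumes space: "real_function_space F"
    and holo: "f \<in> F \<Longrightarrow> f holomorphic_on UNIV"
    and real: "f \<in> F \<Longrightarrow> real_map f"
    and even: "f \<in> F \<Longrightarrow> even_map f"
    and poly_mem: "real_even p \<Longrightarrow> poly p \<in> F"
    and E_countable: "countable E"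
    and E_dense: "closure E = UNIV"
    and E_sym: "z \<in> E \<Longrightarrow> cnj z \<in> E \<and> - cnj z \<in> E"
    and E_axes: "{z. Im z = 0 \<or> Re z = 0} \<subseteq> closure (E \<inter> {z. Im z = 0 \<or> Re z = 0})"
    and L_dense: "closure \<Lambda> = UNIV"
    and L_sym: "z \<in> \<Lambda> \<Longrightarrow> cnj z \<in> \<Lambda>"
    and L_real: "{z. Im z = 0} \<subseteq> closure (\<Lambda> \<inter> {z. Im z = 0})"
begin

section \<open>Approximation by points of \<open>E\<close> and \<Lambda>\<close>

lemma E_cnj_iff [simp]: "cnj z \<in> E \<longleftrightarrow> z \<in> E"
  using E_sym[of z] E_sym[of "cnj z"] by auto

lemma E_uminus_iff [simp]: "- z \<in> E \<longleftrightarrow> z \<in> E"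
proof -
  have "- z \<in> E" if "z \<in> E" for z
    using E_sym[of "cnj z"] that by simp
  from this[of z] this[of "- z"] show ?thesis by auto
qed

lemma E_sym_class: "x \<in> sym_class u \<Longrightarrow> x \<in> E \<longleftrightarrow> u \<in> E"
  by (auto simp: sym_class_def)

text \<open>Density is given on the union of the axes. At a nonzero real point the nearby
  approximants have nonzero real part, hence are real themselves; the origin, where the axes cross,
  is approached through a nonzero real \<open>x\<close>.\<close>

lemma E_near_real:
  assumes "finite X" "\<epsilon> > 0" "Im w = 0"
  shows "\<exists>v\<in>E. v \<notin> X \<and> cmod (v - w) < \<epsilon> \<and> Im v = 0"
proof -
  have "{z. Im z = 0 \<and> z \<noteq> 0} \<subseteq> closure (E \<inter> {z. Im z = 0})"
  proof
    fix z assume "z \<in> {z. Im z = 0 \<and> z \<noteq> 0}"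
    then have z: "Im z = 0" "Re z \<noteq> 0" by (auto simp: complex_eq_iff)
    then have "z \<in> closure (E \<inter> {z. Im z = 0 \<or> Re z = 0}) \<inter> {z. Re z \<noteq> 0}"
      using E_axes by auto
    moreover have "open {z. Re z \<noteq> 0}"
      by (intro open_Collect_neq continuous_intros)
    ultimately have "z \<in> closure ({z. Re z \<noteq> 0} \<inter> (E \<inter> {z. Im z = 0 \<or> Re z = 0}))"
      using open_Int_closure_subset[of "{z. Re z \<noteq> 0}"] by blast
    also have "\<dots> \<subseteq> closure (E \<inter> {z. Im z = 0})" by (intro closure_mono) auto
    finally show "z \<in> closure (E \<inter> {z. Im z = 0})" .
  qed
  moreover obtain x where x: "x \<in> ball w (\<epsilon> / 2) \<inter> {z. Im z = 0 \<and> z \<noteq> 0}"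
    using infinite_ball_real[OF assms(3), of "\<epsilon> / 2"] assms(2)
    by (metis all_not_in_conv finite.emptyI half_gt_zero)
  moreover have "infinite (ball x d \<inter> {z. Im z = 0 \<and> z \<noteq> 0})" if "d > 0" for d
    using infinite_ball_real[of x d] x that by auto
  ultimately obtain v where "v \<in> E \<inter> {z. Im z = 0}" "v \<notin> X" "cmod (v - x) < \<epsilon> / 2"
    using dense_avoiding_finite[of X "\<epsilon> / 2" x "{z. Im z = 0 \<and> z \<noteq> 0}" "E \<inter> {z. Im z = 0}"] assms
    by (metis (no_types, lifting) Int_iff half_gt_zero)
  moreover have "cmod (v - w) < \<epsilon>"
    using calculation(3) x norm_triangle_ineq[of "v - x" "x - w"]
    by (simp add: dist_norm norm_minus_commute field_simps)
  ultimately show ?thesis by auto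
qed

lemma E_near_any:
  assumes "finite X" "\<epsilon> > 0"
  shows "\<exists>v\<in>E. v \<notin> X \<and> cmod (v - w) < \<epsilon>"
proof (rule dense_avoiding_finite[of X \<epsilon> w UNIV E])
  show "infinite (ball w d \<inter> UNIV)" if "d > 0" for d
    using uncountable_infinite[OF uncountable_ball[OF that]] by simp
qed (use assms E_dense in auto)

lemma E_near:
  assumes "finite X" "\<epsilon> > 0"
  shows "\<exists>v\<in>E. v \<notin> X \<and> cmod (v - w) < \<epsilon> \<and> (Im w = 0 \<longrightarrow> Im v = 0)"
  using E_near_any[OF assms] E_near_real[OF assms] by (cases "Im w = 0") blast+

lemma E_near_axes:
  assumes "finite X" "\<epsilon> > 0"
  shows "\<exists>v\<in>E. v \<notin> X \<and> cmod (v - w) < \<epsilon> \<and> (on_axes w \<longrightarrow> on_axes v)"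
proof (cases "on_axes w")
  case True
  have "{z. Im z = 0 \<or> Re z = 0} \<subseteq> closure (E \<inter> {z. Im z = 0 \<or> Re z = 0})" by (rule E_axes)
  moreover have "infinite (ball w d \<inter> {z. Im z = 0 \<or> Re z = 0})" if "d > 0" for d
  proof -
    obtain s where s: "s = 1 \<or> s = \<i>" "\<And>t::real. w + s * of_real t \<in> {z. Im z = 0 \<or> Re z = 0}"
      using True unfolding on_axes_def
      by (metis (mono_tags, lifting) Im_complex_of_real Re_i_times add.right_neutral complex.sel
          mem_Collect_eq mult_1 neg_equal_0_iff_equal plus_complex.sel)
    have "infinite {0<..<d}" using that by simp
    moreover have "inj (\<lambda>t::real. w + s * of_real t)" using s by (auto simp: inj_def)
    ultimately have "infinite ((\<lambda>t. w + s * of_real t) ` {0<..<d})"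
      by (metis finite_imageD inj_on_subset subset_UNIV)
    moreover have "(\<lambda>t. w + s * of_real t) ` {0<..<d} \<subseteq> ball w d \<inter> {z. Im z = 0 \<or> Re z = 0}"
      using s by (auto simp: dist_norm norm_mult simp del: mem_Collect_eq)
    ultimately show ?thesis using finite_subset by blast
  qed
  ultimately show ?thesis
    using dense_avoiding_finite[of X \<epsilon> w "{z. Im z = 0 \<or> Re z = 0}"] assms True
    unfolding on_axes_def by blast
qed (use E_near_any[OF assms] in metis)

lemma L_near:
  assumes "\<epsilon> > 0"
  shows "\<exists>l\<in>\<Lambda>. cmod (l - w) < \<epsilon> \<and> (Im w = 0 \<longrightarrow> Im l = 0)"
proof (cases "Im w = 0")
  case True
  then have "w \<in> closure (\<Lambda> \<inter> {z. Im z = 0})" using L_real by auto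
  then show ?thesis using assms unfolding closure_approachable dist_norm by blast
next
  case False
  have "w \<in> closure \<Lambda>" using L_dense by simp
  then show ?thesis using False assms unfolding closure_approachable dist_norm by blast
qed

text \<open>For cycles equal to their own conjugate, whose multiplier is |l|^2. The argument of
  \<open>w\<close> is kept and only the modulus is changed, to the square root of a positive real
  element of \<Lambda>.\<close>

lemma L_near_norm_square:
  assumes "\<epsilon> > 0"
  shows "\<exists>l. cmod (l - w) < \<epsilon> \<and> l * cnj l \<in> \<Lambda>"
proof -
  define \<theta> where "\<theta> = (if w = 0 then 1 else sgn w)"
  have \<theta>: "cmod \<theta> = 1" "w = of_real (cmod w) * \<theta>"
    by (simp_all add: \<theta>_def norm_sgn) (simp add: sgn_eq)
  \<comment> \<open>The shift by \<open>\<epsilon> / 2\<close> makes the target modulus positive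
    even for \<open>w = 0\<close>, so that the element of \<Lambda> found near \<open>s^2\<close> is
    positive too.\<close>
  define s where "s = cmod w + \<epsilon> / 2"
  have "s > 0" using assms by (simp add: s_def add_nonneg_pos)
  have "isCont sqrt (s\<^sup>2)" by (rule isCont_real_sqrt)
  then obtain d where "d > 0" and d: "\<And>x. dist x (s\<^sup>2) < d \<Longrightarrow> dist (sqrt x) (sqrt (s\<^sup>2)) < \<epsilon> / 2"
    using assms unfolding continuous_at_eps_delta by (meson half_gt_zero)
  obtain l where l: "l \<in> \<Lambda>" "cmod (l - of_real (s\<^sup>2)) < min d (s\<^sup>2)" "Im l = 0"
    using L_near[of "min d (s\<^sup>2)" "of_real (s\<^sup>2)"] \<open>d > 0\<close> \<open>s > 0\<close> by auto
  have lr: "l = of_real (Re l)" using l by (simp add: complex_eq_iff)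
  have abs: "\<bar>Re l - s\<^sup>2\<bar> < min d (s\<^sup>2)"
    using l(2) abs_Re_le_cmod[of "l - of_real (s\<^sup>2)"] by simp
  then have "Re l > 0" by (auto simp: abs_if split: if_splits)
  have close: "\<bar>sqrt (Re l) - s\<bar> < \<epsilon> / 2"
    using d[of "Re l"] abs \<open>s > 0\<close> by (simp add: dist_real_def)
  define v where "v = of_real (sqrt (Re l)) * \<theta>"
  have "v - w = of_real (sqrt (Re l) - cmod w) * \<theta>" using \<theta> by (simp add: v_def algebra_simps)
  then have "cmod (v - w) = \<bar>sqrt (Re l) - cmod w\<bar>" using \<theta> by (simp add: norm_mult del: of_real_diff)
  also have "\<dots> < \<epsilon>" using close by (simp add: s_def abs_if split: if_splits)
  finally have "cmod (v - w) < \<epsilon>" .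
  moreover have "v * cnj v = l"
  proof -
    have "v * cnj v = of_real ((cmod v)\<^sup>2)" by (simp only: complex_norm_square)
    also have "\<dots> = l" using \<theta> \<open>Re l > 0\<close> lr by (simp add: v_def norm_mult)
    finally show ?thesis .
  qed
  ultimately show ?thesis using l by auto
qed

section \<open>Seminorms of products of polynomials\<close>

lemma seminorm_add:
  assumes "seminorm_on F q" "real_even p" "real_even r"
  shows "q (poly (p + r)) \<le> q (poly p) + q (poly r)"
  using assms poly_mem unfolding seminorm_on_def poly_add by blast

lemma seminorm_smult:
  assumes "seminorm_on F q" "real_even p"
  shows "q (poly (smult (of_real c) p)) = \<bar>c\<bar> * q (poly p)"
proof -
  have "poly (smult (of_real c) p) = (\<lambda>z. of_real c * poly p z)" by auto
  then show ?thesis using assms poly_mem unfolding seminorm_on_def by metis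
qed

lemma seminorm_nonneg:
  assumes "seminorm_on F q" "real_even p"
  shows "q (poly p) \<ge> 0"
  using assms poly_mem unfolding seminorm_on_def by blast

lemma seminorm_0:
  assumes "seminorm_on F q"
  shows "q (poly 0) = 0"
  using seminorm_smult[OF assms, of 0 0] by simp

lemma seminorm_quad:
  assumes q: "seminorm_on F q" and p: "real_even p"
  shows "q (poly (p * [:of_real a, 0, of_real b:])) \<le> \<bar>a\<bar> * q (poly p) + \<bar>b\<bar> * q (poly (p * [:0, 0, 1:]))"
proof -
  have "p * [:of_real a, 0, of_real b:] = smult (of_real a) p + smult (of_real b) (p * [:0, 0, 1:])"
    by (simp add: algebra_simps)
  moreover have "real_even (p * [:0, 0, 1:])" using p by (intro real_even_mult) auto
  ultimately show ?thesis
    using seminorm_add[OF q, of "smult (of_real a) p" "smult (of_real b) (p * [:0, 0, 1:])"]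
      seminorm_smult[OF q] p real_even_smult
    by metis
qed

text \<open>A seminorm need not respect multiplication, so the product is expanded into
  \<open>p\<close>, \<open>z^2 * p\<close> and \<open>z^4 * p\<close> with bounded real
  coefficients.\<close>

lemma seminorm_sym_poly:
  assumes q: "seminorm_on F q" and p: "real_even p" and u: "cmod u \<le> r"
  shows "q (poly (p * sym_poly u)) \<le>
    (1 + r\<^sup>2)\<^sup>2 * (q (poly p) + q (poly ([:0, 0, 1:] * p)) + q (poly ([:0, 0, 1:] * ([:0, 0, 1:] * p))))"
proof -
  obtain a b c where eq: "sym_poly u = [:of_real a, 0, of_real b, 0, of_real c:]"
    and abc: "\<bar>a\<bar> \<le> (1 + r\<^sup>2)\<^sup>2" "\<bar>b\<bar> \<le> (1 + r\<^sup>2)\<^sup>2" "\<bar>c\<bar> \<le> (1 + r\<^sup>2)\<^sup>2"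
    using sym_poly_coeffs[OF u] by blast
  define p1 p2 where "p1 = [:0, 0, 1:] * p" and "p2 = [:0, 0, 1:] * p1"
  have re: "real_even p1" "real_even p2"
    using p real_even_mult[OF real_even_square_var] by (auto simp: p1_def p2_def simp del: mult_pCons_left)
  have "p * sym_poly u = smult (of_real a) p + (smult (of_real b) p1 + smult (of_real c) p2)"
    by (simp add: eq p1_def p2_def algebra_simps)
  then have "q (poly (p * sym_poly u)) \<le> q (poly (smult (of_real a) p)) + (q (poly (smult (of_real b) p1)) + q (poly (smult (of_real c) p2)))"
    using seminorm_add[OF q, of "smult (of_real a) p" "smult (of_real b) p1 + smult (of_real c) p2"]
      seminorm_add[OF q, of "smult (of_real b) p1" "smult (of_real c) p2"] p re
    by (simp add: real_even_intros)
  also have "\<dots> = \<bar>a\<bar> * q (poly p) + (\<bar>b\<bar> * q (poly p1) + \<bar>c\<bar> * q (poly p2))"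
    using p re by (simp add: seminorm_smult[OF q])
  also have "\<dots> \<le> (1 + r\<^sup>2)\<^sup>2 * q (poly p) + ((1 + r\<^sup>2)\<^sup>2 * q (poly p1) + (1 + r\<^sup>2)\<^sup>2 * q (poly p2))"
    using p re abc seminorm_nonneg[OF q] by (intro add_mono mult_right_mono) auto
  finally show ?thesis by (simp add: p1_def p2_def algebra_simps)
qed

text \<open>The point is uniformity in the nodes: in \<open>close_cycle\<close> they vary along a
  sequence. The induction generalizes \<open>p\<close>, because each further factor is expanded into
  multiples of \<open>p\<close> by powers of \<open>z^2\<close>.\<close>

lemma seminorm_sym_prod_bound:
  assumes q: "seminorm_on F q" and p: "real_even p"
  shows "\<exists>C. \<forall>w :: nat \<Rightarrow> complex. (\<forall>j<m. cmod (w j) \<le> r) \<longrightarrow> q (poly (p * (\<Prod>j<m. (sym_poly (w j))\<^sup>2))) \<le> C"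
  using p
proof (induction m arbitrary: p)
  case 0
  then show ?case by auto
next
  case (Suc m)
  define x :: "complex poly" where "x = [:0, 0, 1:]"
  have x: "real_even x" by (simp add: x_def)
  \<comment> \<open>The squared factor for the new node is multiplied in two rounds, each raising
    the power of \<open>x\<close> by up to two; hence the constants \<open>C 0\<close> to
    \<open>C 4\<close> below.\<close>
  have "\<forall>i. \<exists>C. \<forall>w. (\<forall>j<m. cmod (w j) \<le> r) \<longrightarrow> q (poly ((x ^ i * p) * (\<Prod>j<m. (sym_poly (w j))\<^sup>2))) \<le> C"
    by (intro allI Suc.IH real_even_intros Suc.prems x)
  then obtain C where C: "\<And>i w. (\<forall>j<m. cmod (w j) \<le> r) \<Longrightarrow> q (poly ((x ^ i * p) * (\<Prod>j<m. (sym_poly (w j))\<^sup>2))) \<le> C i"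
    by metis
  define B where "B = (1 + r\<^sup>2)\<^sup>2"
  have "B \<ge> 0" by (simp add: B_def)
  have "q (poly (p * (\<Prod>j<Suc m. (sym_poly (w j))\<^sup>2))) \<le>
      B * (B * (C 0 + C (Suc 0) + C (Suc (Suc 0))) + B * (C (Suc 0) + C (Suc (Suc 0)) + C (Suc (Suc (Suc 0))))
        + B * (C (Suc (Suc 0)) + C (Suc (Suc (Suc 0))) + C (Suc (Suc (Suc (Suc 0))))))"
    if w: "\<forall>j<Suc m. cmod (w j) \<le> r" for w
  proof -
    define P s where "P = (\<Prod>j<m. (sym_poly (w j))\<^sup>2)" and "s = sym_poly (w m)"
    have wm: "cmod (w m) \<le> r" using w by simp
    have re: "real_even (x ^ i * p * P)" for i
      using Suc.prems x by (auto simp: P_def intro!: real_even_intros)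
    have sre: "real_even (x ^ i * p * P * s)" for i
      using real_even_mult[OF re real_even_sym_poly] by (simp add: s_def)
    have C': "q (poly (x ^ i * p * P)) \<le> C i" for i unfolding P_def using C w by auto
    have xx: "[:0, 0, 1:] * (x ^ i * p * P) = x ^ Suc i * p * P"
      "[:0, 0, 1:] * (x ^ i * p * P * s) = x ^ Suc i * p * P * s" for i
      unfolding x_def[symmetric] by (simp_all add: mult.assoc)
    have 1: "q (poly (x ^ i * p * P * s)) \<le> B * (C i + C (Suc i) + C (Suc (Suc i)))" for i
    proof -
      have "q (poly (x ^ i * p * P * s)) \<le> B * (q (poly (x ^ i * p * P)) + q (poly (x ^ Suc i * p * P)) + q (poly (x ^ Suc (Suc i) * p * P)))"
        by (rule seminorm_sym_poly[OF q re wm, unfolded xx, folded s_def B_def])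
      also have "\<dots> \<le> B * (C i + C (Suc i) + C (Suc (Suc i)))"
        by (intro mult_left_mono add_mono C' \<open>B \<ge> 0\<close>)
      finally show ?thesis .
    qed
    have "q (poly (x ^ 0 * p * P * s * s)) \<le> B * (q (poly (x ^ 0 * p * P * s)) + q (poly (x ^ Suc 0 * p * P * s)) + q (poly (x ^ Suc (Suc 0) * p * P * s)))"
      by (rule seminorm_sym_poly[OF q sre wm, unfolded xx, folded s_def B_def])
    also have "\<dots> \<le> B * (B * (C 0 + C (Suc 0) + C (Suc (Suc 0))) + B * (C (Suc 0) + C (Suc (Suc 0)) + C (Suc (Suc (Suc 0))))
        + B * (C (Suc (Suc 0)) + C (Suc (Suc (Suc 0))) + C (Suc (Suc (Suc (Suc 0))))))"
      by (intro mult_left_mono add_mono 1 \<open>B \<ge> 0\<close>)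
    also have "x ^ 0 * p * P * s * s = p * (\<Prod>j<Suc m. (sym_poly (w j))\<^sup>2)"
      unfolding P_def s_def prod.lessThan_Suc power2_eq_square[of "sym_poly (w m)"]
      by (simp only: power_0 mult_1 mult.assoc)
    finally show ?thesis .
  qed
  then show ?case by (intro exI allI impI)
qed

end

section \<open>Perturbations divisible by a polynomial\<close>

lemma pderiv_mult_at_zero:
  assumes "poly S u = 0"
  shows "poly (pderiv (Q * (S * P))) u = poly Q u * (poly (pderiv S) u * poly P u)"
  using assms by (simp add: pderiv_mult mult.commute)

lemma deriv_add_poly:
  assumes "f holomorphic_on UNIV"
  shows "deriv (\<lambda>z. f z + poly p z) u = deriv f u + poly (pderiv p) u"
  by (intro DERIV_imp_deriv DERIV_add entire_has_deriv[OF assms] poly_DERIV)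

text \<open>The gap below \<epsilon> is the room that \<open>near_trans\<close> leaves to a further
  perturbation.\<close>

lemma compact_strict_bound:
  fixes g :: "complex \<Rightarrow> real"
  assumes "compact S" "continuous_on S g" "\<forall>z\<in>S. g z < \<epsilon>"
  shows "\<exists>s<\<epsilon>. \<forall>z\<in>S. g z \<le> s"
proof (cases "S = {}")
  case True
  then show ?thesis by (intro exI[of _ "\<epsilon> - 1"]) auto
next
  case False
  then show ?thesis using continuous_attains_sup[OF assms(1) _ assms(2)] assms(3) by metis
qed

text \<open>Smallness of \<open>q\<close> gives convergence in \<open>F\<close>. Smallness of
  \<open>H\<close>, and not just of \<open>Q * H\<close>, bounds the perturbation by
  \<open>\<epsilon>\<close> times |Q| also close to the zeros of \<open>Q\<close>, as the tubes
  require.\<close>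

definition near :: "((complex \<Rightarrow> complex) \<Rightarrow> real) \<Rightarrow> real \<Rightarrow> real \<Rightarrow> (complex \<Rightarrow> complex) \<Rightarrow>
    complex poly \<Rightarrow> (complex \<Rightarrow> complex) \<Rightarrow> bool" where
  "near q R \<epsilon> f Q f' \<longleftrightarrow> (\<exists>H. real_even H \<and> f' = (\<lambda>z. f z + poly (Q * H) z) \<and>
     q (poly (Q * H)) < \<epsilon> \<and> (\<forall>z\<in>cball 0 R. cmod (poly H z) < \<epsilon>))"

lemma near_mono:
  assumes "near q R \<epsilon> f Q f'" "\<epsilon> \<le> \<epsilon>'" "R' \<le> R"
  shows "near q R' \<epsilon>' f Q f'"
proof -
  obtain H where "real_even H" "f' = (\<lambda>z. f z + poly (Q * H) z)" "q (poly (Q * H)) < \<epsilon>"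
    "\<forall>z\<in>cball 0 R. cmod (poly H z) < \<epsilon>"
    using assms(1) unfolding near_def by blast
  then show ?thesis unfolding near_def using assms(2,3)
    by (intro exI[of _ H]) (force intro: less_le_trans)
qed

lemma near_value:
  assumes "near q R \<epsilon> f Q f'" "poly Q a = 0"
  shows "f' a = f a"
  using assms unfolding near_def by auto

lemma near_deriv:
  assumes "near q R \<epsilon> f Q f'" "f holomorphic_on UNIV" "poly Q a = 0" "poly (pderiv Q) a = 0"
  shows "deriv f' a = deriv f a"
proof -
  obtain H where "f' = (\<lambda>z. f z + poly (Q * H) z)" using assms(1) unfolding near_def by blast
  then have "deriv f' a = deriv f a + poly (pderiv (Q * H)) a"
    using deriv_add_poly[OF assms(2)] by (simp only:)
  then show ?thesis using assms(3,4) by (simp add: pderiv_mult)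
qed

lemma near_close:
  assumes "near q R \<epsilon> f Q f'" "z \<in> cball 0 R"
  shows "cmod (f' z - f z) \<le> \<epsilon> * cmod (poly Q z)"
proof -
  obtain H where "f' = (\<lambda>z. f z + poly (Q * H) z)" "cmod (poly H z) < \<epsilon>"
    using assms unfolding near_def by blast
  then show ?thesis
    using mult_right_mono[of "cmod (poly H z)" \<epsilon> "cmod (poly Q z)"] by (simp add: norm_mult mult.commute)
qed

context target_sets
begin

lemma near_refl:
  assumes "seminorm_on F q" "\<epsilon> > 0"
  shows "near q R \<epsilon> f Q f"
  unfolding near_def by (rule exI[of _ 0]) (use assms(2) seminorm_0[OF assms(1)] in auto)

lemma near_mem:
  assumes "near q R \<epsilon> f Q f'" "f \<in> F" "real_even Q"
  shows "f' \<in> F"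
proof -
  obtain H where "real_even H" "f' = (\<lambda>z. f z + poly (Q * H) z)"
    using assms(1) unfolding near_def by blast
  moreover have "poly (Q * H) \<in> F" using calculation assms(3) poly_mem real_even_mult by blast
  ultimately show ?thesis using space assms(2) unfolding real_function_space_def by blast
qed

text \<open>Both conditions in \<open>near\<close> are strict, and \<open>K\<close> is bounded on
  the disc, so a small enough second move \<open>Q * K * J\<close> can be merged into the first as
  \<open>H + K * J\<close>. This is how finitely many moves are kept within one given
  distance.\<close>

lemma near_trans:
  assumes q: "seminorm_on F q" and Q: "real_even Q" and K: "real_even K" and f1: "near q R \<epsilon> f Q f1"
  shows "\<exists>d>0. \<forall>f2. near q R d f1 (Q * K) f2 \<longrightarrow> near q R \<epsilon> f Q f2"
proof -
  obtain H where H: "real_even H" "f1 = (\<lambda>z. f z + poly (Q * H) z)" "q (poly (Q * H)) < \<epsilon>"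
    "\<forall>z\<in>cball 0 R. cmod (poly H z) < \<epsilon>"
    using f1 unfolding near_def by blast
  obtain s where "s < \<epsilon>" and s: "\<forall>z\<in>cball 0 R. cmod (poly H z) \<le> s"
    using compact_strict_bound[of "cball 0 R" "\<lambda>z. cmod (poly H z)" \<epsilon>] H(4)
    by (force intro!: continuous_intros)
  obtain B where "B > 0" and B: "\<forall>z\<in>cball 0 R. cmod (poly K z) \<le> B"
    using entire_bounded_on_cball[OF poly_entire] by blast
  define d where "d = min (\<epsilon> - q (poly (Q * H))) ((\<epsilon> - s) / B)"
  have "d > 0" using H \<open>s < \<epsilon>\<close> \<open>B > 0\<close> by (simp add: d_def)
  moreover have "near q R \<epsilon> f Q f2" if f2: "near q R d f1 (Q * K) f2" for f2
  proof -
    obtain J where J: "real_even J" "f2 = (\<lambda>z. f1 z + poly (Q * K * J) z)" "q (poly (Q * K * J)) < d"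
      "\<forall>z\<in>cball 0 R. cmod (poly J z) < d"
      using f2 unfolding near_def by blast
    have eq: "Q * (H + K * J) = Q * H + Q * K * J" by (simp add: algebra_simps)
    have "q (poly (Q * H + Q * K * J)) < \<epsilon>"
      using seminorm_add[OF q, of "Q * H" "Q * K * J"] Q H J K by (simp add: real_even_intros d_def)
    moreover have "cmod (poly (H + K * J) z) < \<epsilon>" if z: "z \<in> cball 0 R" for z
    proof -
      have "cmod (poly K z) * cmod (poly J z) \<le> B * cmod (poly J z)"
        using B z by (intro mult_right_mono) auto
      also have "\<dots> < B * d" using J z \<open>B > 0\<close> by simp
      also have "B * d \<le> B * ((\<epsilon> - s) / B)"
        using \<open>B > 0\<close> by (intro mult_left_mono) (auto simp: d_def)
      also have "\<dots> = \<epsilon> - s" using \<open>B > 0\<close> by simp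
      finally have "cmod (poly K z * poly J z) < \<epsilon> - s" by (simp add: norm_mult)
      then show ?thesis
        using s z norm_triangle_ineq[of "poly H z" "poly K z * poly J z"] by fastforce
    qed
    moreover have "f2 = (\<lambda>z. f z + poly (Q * (H + K * J)) z)"
      unfolding eq by (simp add: H J algebra_simps)
    ultimately show ?thesis
      unfolding near_def using H J K eq by (intro exI[of _ "H + K * J"]) (auto intro: real_even_intros)
  qed
  ultimately show ?thesis by blast
qed

text \<open>The correcting factors \<open>G k\<close> may vary with the node, as long as they stay bounded.\<close>

lemma interp_seq:
  assumes q: "seminorm_on F q" and Q: "real_even Q" and G: "\<And>k. real_even (G k)"
    and C: "\<And>k. q (poly (Q * G k)) \<le> C" "\<And>k. q (poly (Q * G k * [:0, 0, 1:])) \<le> C"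
      "\<And>k z. z \<in> cball 0 R \<Longrightarrow> cmod (poly (G k) z) \<le> C"
    and u: "u \<longlonglongrightarrow> w" and t: "t \<longlonglongrightarrow> 0"
    and ax: "on_axes w \<Longrightarrow> \<forall>k. on_axes (u k) \<and> Im (t k) = 0" and "\<epsilon> > 0"
  shows "\<forall>\<^sub>F k in sequentially. \<exists>H. real_even H \<and> poly H (u k) = t k \<and>
           near q R \<epsilon> (f k) Q (\<lambda>z. f k z + poly (Q * (G k * H)) z)"
proof -
  define a b where "a k = \<bar>interp_const (u k) (t k)\<bar>" and "b k = \<bar>interp_slope (u k) (t k)\<bar>" for k
  have ab: "a \<longlonglongrightarrow> 0" "b \<longlonglongrightarrow> 0"
    unfolding a_def b_def using interp_tendsto_0[OF u t] ax by (auto intro!: tendsto_rabs_zero)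
  have "(\<lambda>k. (a k + b k) * C) \<longlonglongrightarrow> (0 + 0) * C" "(\<lambda>k. C * (a k + b k * R\<^sup>2)) \<longlonglongrightarrow> C * (0 + 0 * R\<^sup>2)"
    by (intro tendsto_intros ab)+
  then have ev: "\<forall>\<^sub>F k in sequentially. (a k + b k) * C < \<epsilon>" "\<forall>\<^sub>F k in sequentially. C * (a k + b k * R\<^sup>2) < \<epsilon>"
    using \<open>\<epsilon> > 0\<close> by (auto dest: order_tendstoD(2))
  \<comment> \<open>Interpolation at a node on the axes needs real data. If the limit is off the
    axes, so are the nodes eventually, and there is no condition.\<close>
  have "\<forall>\<^sub>F k in sequentially. on_axes (u k) \<longrightarrow> Im (t k) = 0"
  proof (cases "on_axes w")
    case False
    have "(\<lambda>k. Im ((u k)\<^sup>2)) \<longlonglongrightarrow> Im (w\<^sup>2)" by (intro tendsto_intros u)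
    then have "\<forall>\<^sub>F k in sequentially. Im ((u k)\<^sup>2) \<noteq> 0"
      using False unfolding on_axes_iff by (rule tendsto_imp_eventually_ne)
    then show ?thesis by eventually_elim (simp add: on_axes_iff del: Im_power2)
  qed (use ax in auto)
  with ev show ?thesis
  proof eventually_elim
    case (elim k)
    define H where "H = interp_poly (u k) (t k)"
    have H: "real_even H" "poly H (u k) = t k" using elim by (auto simp: H_def poly_interp_poly)
    have "C \<ge> 0" using C(1)[of k] seminorm_nonneg[OF q, of "Q * G k"] Q G by (force intro: real_even_mult)
    have "q (poly (Q * (G k * H))) \<le> a k * q (poly (Q * G k)) + b k * q (poly (Q * G k * [:0, 0, 1:]))"
      using seminorm_quad[OF q real_even_mult[OF Q G]]
      unfolding H_def interp_poly_def a_def b_def mult.assoc[symmetric] by blast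
    also have "\<dots> \<le> a k * C + b k * C"
      using C by (intro add_mono mult_left_mono) (auto simp: a_def b_def)
    finally have 1: "q (poly (Q * (G k * H))) < \<epsilon>" using elim by (simp add: algebra_simps)
    have 2: "cmod (poly (G k * H) z) < \<epsilon>" if z: "z \<in> cball 0 R" for z
    proof -
      have "(cmod z)\<^sup>2 \<le> R\<^sup>2" using z by (intro power_mono) auto
      have "poly H z = of_real (interp_const (u k) (t k)) + of_real (interp_slope (u k) (t k)) * z\<^sup>2"
        by (simp add: H_def interp_poly_def power2_eq_square algebra_simps)
      then have "cmod (poly H z) \<le> a k + b k * (cmod z)\<^sup>2"
        using norm_triangle_ineq[of "of_real (interp_const (u k) (t k))" "of_real (interp_slope (u k) (t k)) * z\<^sup>2"]
        by (simp add: a_def b_def norm_mult norm_power)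
      also have "\<dots> \<le> a k + b k * R\<^sup>2"
        using \<open>(cmod z)\<^sup>2 \<le> R\<^sup>2\<close> by (intro add_mono mult_left_mono) (auto simp: b_def)
      finally have "cmod (poly (G k) z) * cmod (poly H z) \<le> C * (a k + b k * R\<^sup>2)"
        using C(3)[OF z] \<open>C \<ge> 0\<close> by (intro mult_mono) auto
      then show ?thesis using elim by (simp add: norm_mult)
    qed
    show ?case
      using H 1 2 G unfolding near_def by (intro exI[of _ H] conjI exI[of _ "G k * H"]) (auto intro: real_even_mult)
  qed
qed

text \<open>This is \<open>interp_seq\<close> with a constant node: if no \<tau> worked, data of
  size below \<open>1 / (k + 1)\<close> that cannot be interpolated would form a sequence
  contradicting it.\<close>

lemma interp_fixed:
  assumes q: "seminorm_on F q" and Q: "real_even Q" and K: "real_even K" and "\<epsilon> > 0"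
  shows "\<exists>\<tau>>0. \<forall>t. cmod t < \<tau> \<and> (on_axes u \<longrightarrow> Im t = 0) \<longrightarrow>
    (\<exists>H. real_even H \<and> poly H u = t \<and> near q R \<epsilon> f Q (\<lambda>z. f z + poly (Q * (K * H)) z))"
    (is "\<exists>\<tau>>0. \<forall>t. _ \<and> _ \<longrightarrow> ?P t")
proof (rule ccontr)
  assume "\<not> ?thesis"
  then have "\<exists>t. cmod t < inverse (real (Suc k)) \<and> (on_axes u \<longrightarrow> Im t = 0) \<and> \<not> ?P t" for k
    by (metis inverse_positive_iff_positive of_nat_0_less_iff zero_less_Suc)
  then obtain t where t: "\<And>k. cmod (t k) < inverse (real (Suc k))" "\<And>k. on_axes u \<longrightarrow> Im (t k) = 0"
    "\<And>k. \<not> ?P (t k)" by metis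
  obtain B where B: "\<forall>z\<in>cball 0 R. cmod (poly K z) \<le> B"
    using entire_bounded_on_cball[OF poly_entire] by blast
  define C where "C = Max {q (poly (Q * K)), q (poly (Q * K * [:0, 0, 1:])), B}"
  have "\<forall>\<^sub>F k in sequentially. ?P (t k)"
  proof (rule interp_seq[OF q Q, where G = "\<lambda>k. K" and u = "\<lambda>k. u" and C = C and f = "\<lambda>k. f"])
    show "t \<longlonglongrightarrow> 0"
      using t(1) by (intro Lim_null_comparison[OF _ LIMSEQ_inverse_real_of_nat]) (auto intro: less_imp_le always_eventually)
    show "cmod (poly K z) \<le> C" if "z \<in> cball 0 R" for z
      using B that unfolding C_def by (force intro: order_trans[OF _ Max_ge])
  qed (use K t(2) \<open>\<epsilon> > 0\<close> in \<open>auto simp: C_def\<close>)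
  then have "\<exists>k. ?P (t k)" by (rule eventually_happens'[OF sequentially_bot])
  then show False using t(3) by blast
qed

text \<open>The value is corrected first. If the derivative at \<open>u\<close> then vanishes, a
  second correction with the factor \<open>sym_poly u\<close> keeps the value and adds a nonzero
  term to the derivative, the zero at \<open>u\<close> being simple. The nonzero derivative later
  lets the multiplier of a cycle be tuned at its last point alone.\<close>

lemma add_point:
  assumes f: "f \<in> F" and q: "seminorm_on F q" and Q: "real_even Q" and u: "poly Q u \<noteq> 0" "u \<noteq> 0"
    and "finite X" "\<epsilon> > 0" "\<eta> > 0"
  shows "\<exists>f' v. near q R \<epsilon> f Q f' \<and> v \<in> E \<and> v \<notin> X \<and> f' u = v \<and> deriv f' u \<noteq> 0 \<and> cmod (v - f u) < \<eta>"
proof -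
  obtain \<tau> where "\<tau> > 0" and \<tau>: "\<And>t. cmod t < \<tau> \<Longrightarrow> (on_axes u \<longrightarrow> Im t = 0) \<Longrightarrow>
      \<exists>H. real_even H \<and> poly H u = t \<and> near q R \<epsilon> f Q (\<lambda>z. f z + poly (Q * (1 * H)) z)"
    using interp_fixed[OF q Q real_even_1 \<open>\<epsilon> > 0\<close>, of u R f] by blast
  have "min \<eta> (\<tau> * cmod (poly Q u)) > 0" using \<open>\<tau> > 0\<close> \<open>\<eta> > 0\<close> u by simp
  then obtain v where v: "v \<in> E" "v \<notin> X" "cmod (v - f u) < min \<eta> (\<tau> * cmod (poly Q u))" "Im (f u) = 0 \<longrightarrow> Im v = 0"
    using E_near[OF \<open>finite X\<close>] by blast
  define t where "t = (v - f u) / poly Q u"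
  have "cmod t < \<tau>" using v u by (simp add: t_def norm_divide divide_less_eq)
  moreover have "Im t = 0" if "on_axes u"
    using real_even_value_real[OF _ _ that, of f] real_even_value_real[OF _ _ that, of "poly Q"] f real even Q v
    by (auto simp: t_def real_even_def Im_divide)
  ultimately obtain H where H: "poly H u = t" "near q R \<epsilon> f Q (\<lambda>z. f z + poly (Q * (1 * H)) z)"
    using \<tau> by blast
  define f1 where "f1 = (\<lambda>z. f z + poly (Q * (1 * H)) z)"
  have f1u: "f1 u = v" using u H by (simp add: f1_def t_def)
  have f1n: "near q R \<epsilon> f Q f1" using H by (simp add: f1_def)
  show ?thesis
  proof (cases "deriv f1 u = 0")
    case False
    then show ?thesis using f1u f1n v by auto
  next
    case True
    obtain d where "d > 0" and d: "\<And>f2. near q R d f1 (Q * 1) f2 \<Longrightarrow> near q R \<epsilon> f Q f2"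
      using near_trans[OF q Q real_even_1 f1n] by blast
    obtain \<tau>' where "\<tau>' > 0" and \<tau>': "\<And>t. cmod t < \<tau>' \<Longrightarrow> (on_axes u \<longrightarrow> Im t = 0) \<Longrightarrow>
      \<exists>H. real_even H \<and> poly H u = t \<and> near q R d f1 Q (\<lambda>z. f1 z + poly (Q * (sym_poly u * H)) z)"
      using interp_fixed[OF q Q real_even_sym_poly \<open>d > 0\<close>, of u R f1] by blast
    obtain J where J: "poly J u = of_real (\<tau>' / 2)"
      "near q R d f1 Q (\<lambda>z. f1 z + poly (Q * (sym_poly u * J)) z)"
      using \<tau>'[of "of_real (\<tau>' / 2)"] \<open>\<tau>' > 0\<close> by auto
    define f2 where "f2 = (\<lambda>z. f1 z + poly (Q * (sym_poly u * J)) z)"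
    have 0: "poly (sym_poly u) u = 0" by (simp add: sym_poly_zero_iff)
    have "f1 \<in> F" using near_mem[OF f1n f Q] .
    then have "deriv f2 u = poly Q u * (poly (pderiv (sym_poly u)) u * of_real (\<tau>' / 2))"
      unfolding f2_def deriv_add_poly[OF holo[OF \<open>f1 \<in> F\<close>]] pderiv_mult_at_zero[OF 0] True J(1) by simp
    then have "deriv f2 u \<noteq> 0"
      using u pderiv_sym_poly[OF u(2)] \<open>\<tau>' > 0\<close> by (simp only: mult_eq_0_iff) simp
    moreover have "f2 u = v" using f1u 0 by (simp add: f2_def)
    moreover have "near q R \<epsilon> f Q f2" using d J by (simp add: f2_def)
    ultimately show ?thesis using v by (intro exI[of _ f2] exI[of _ v]) auto
  qed
qed

text \<open>The zeros of \<open>Q\<close> are the points that are settled. Zero is among them from the start, since an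
  even map cannot be perturbed freely there.\<close>

definition admissible :: "(complex \<Rightarrow> complex) \<Rightarrow> complex poly \<Rightarrow> bool" where
  "admissible f Q \<longleftrightarrow> f \<in> F \<and> real_even Q \<and> Q \<noteq> 0 \<and> poly Q 0 = 0 \<and>
     (\<forall>a. poly Q a = 0 \<longrightarrow> poly (pderiv Q) a = 0 \<and> (a \<in> E \<longleftrightarrow> f a \<in> E)) \<and>
     (\<forall>z n. exact_period f n z \<and> (\<forall>i. poly Q ((f ^^ i) z) = 0) \<longrightarrow> z \<in> E \<and> multiplier f n z \<in> \<Lambda>)"

text \<open>Cycles inside the zero set of \<open>Q\<close> keep their points and multipliers, since
  values and derivatives there are frozen; only cycles through a new zero remain to be checked.
  Squaring \<open>K\<close> makes the new zeros multiple.\<close>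

lemma admissible_extend:
  assumes adm: "admissible f Q" and near: "near q R \<epsilon> f Q f'" and K: "real_even K" "K \<noteq> 0"
    and new: "\<And>x. poly K x = 0 \<Longrightarrow> poly Q x \<noteq> 0 \<Longrightarrow> x \<in> E \<longleftrightarrow> f' x \<in> E"
    and cyc: "\<And>z n i. exact_period f' n z \<Longrightarrow> \<forall>i. poly (Q * K\<^sup>2) ((f' ^^ i) z) = 0 \<Longrightarrow>
      poly Q ((f' ^^ i) z) \<noteq> 0 \<Longrightarrow> z \<in> E \<and> multiplier f' n z \<in> \<Lambda>"
  shows "admissible f' (Q * K\<^sup>2)"
proof -
  have f: "f \<in> F" and Q: "real_even Q" "Q \<noteq> 0" "poly Q 0 = 0"
    and A: "\<And>a. poly Q a = 0 \<Longrightarrow> poly (pderiv Q) a = 0 \<and> (a \<in> E \<longleftrightarrow> f a \<in> E)"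
    and J: "\<And>z n. exact_period f n z \<Longrightarrow> \<forall>i. poly Q ((f ^^ i) z) = 0 \<Longrightarrow> z \<in> E \<and> multiplier f n z \<in> \<Lambda>"
    using adm unfolding admissible_def by blast+
  have f': "f' \<in> F" using near_mem[OF near f Q(1)] .
  have val: "f' a = f a" "deriv f' a = deriv f a" if "poly Q a = 0" for a
    using near_value[OF near that] near_deriv[OF near holo[OF f] that] A[OF that] by auto
  have "poly (pderiv (Q * K\<^sup>2)) a = 0 \<and> (a \<in> E \<longleftrightarrow> f' a \<in> E)" if "poly (Q * K\<^sup>2) a = 0" for a
  proof (cases "poly Q a = 0")
    case True
    then show ?thesis using A[OF True] val[OF True] by (simp add: pderiv_mult)
  next
    case False
    then have "poly K a = 0" using that by simp
    then show ?thesis using new False by (simp add: pderiv_mult power2_eq_square)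
  qed
  moreover have "z \<in> E \<and> multiplier f' n z \<in> \<Lambda>"
    if z: "exact_period f' n z" "\<forall>i. poly (Q * K\<^sup>2) ((f' ^^ i) z) = 0" for z n
  proof (cases "\<forall>i. poly Q ((f' ^^ i) z) = 0")
    case True
    have eq: "(f' ^^ i) z = (f ^^ i) z" for i
    proof (induction i)
      case (Suc i)
      then show ?case using val(1) True by (metis comp_apply funpow.simps(2))
    qed simp
    have "exact_period f n z" using z(1) by (simp add: exact_period_def eq)
    moreover have "multiplier f' n z = multiplier f n z"
      unfolding multiplier_def deriv_funpow[OF holo[OF f']] deriv_funpow[OF holo[OF f]]
      using True val(2) by (intro prod.cong refl) (metis eq)
    ultimately show ?thesis using J[of n z] True by (simp add: eq)
  next
    case False
    then show ?thesis using cyc z by blast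
  qed
  ultimately show ?thesis
    unfolding admissible_def using f' Q K by (auto intro: real_even_intros)
qed

text \<open>The value \<open>v\<close> at \<open>e\<close> is chosen off the zeros of
  \<open>Q\<close> and off the class of \<open>e\<close>, so an orbit through that class leaves the
  new zero set at the next step and no cycle arises.\<close>

lemma admissible_add_point:
  assumes adm: "admissible f Q" and e: "e \<in> E" and q: "seminorm_on F q" and "\<epsilon> > 0"
  shows "\<exists>f' K. real_even K \<and> admissible f' (Q * K) \<and> near q R \<epsilon> f Q f' \<and> poly (Q * K) e = 0"
proof (cases "poly Q e = 0")
  case True
  then show ?thesis
    using adm near_refl[OF q \<open>\<epsilon> > 0\<close>] by (intro exI[of _ f] exI[of _ 1]) simp
next
  case False
  have f: "f \<in> F" and Q: "real_even Q" "Q \<noteq> 0" "poly Q 0 = 0"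
    using adm unfolding admissible_def by auto
  define X where "X = {z. poly Q z = 0} \<union> sym_class e"
  have "finite X" using Q by (simp add: X_def poly_roots_finite)
  moreover have "e \<noteq> 0" using False Q by auto
  ultimately obtain f' v where near: "near q R \<epsilon> f Q f'" and v: "v \<in> E" "v \<notin> X" "f' e = v"
    using add_point[OF f q Q(1) False _ _ \<open>\<epsilon> > 0\<close> zero_less_one] by metis
  have f': "f' \<in> F" using near_mem[OF near f Q(1)] .
  have im: "f' x \<in> sym_class v" if "x \<in> sym_class e" for x
    using real_even_sym_class[OF real[OF f'] even[OF f'] that] v by (auto simp: sym_class_def)
  have "admissible f' (Q * (sym_poly e)\<^sup>2)"
  proof (rule admissible_extend[OF adm near real_even_sym_poly sym_poly_nonzero])
    show "x \<in> E \<longleftrightarrow> f' x \<in> E" if "poly (sym_poly e) x = 0" for x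
      using that im E_sym_class v e by (metis sym_poly_zero_iff)
    fix z n i
    assume z: "\<forall>i. poly (Q * (sym_poly e)\<^sup>2) ((f' ^^ i) z) = 0" "poly Q ((f' ^^ i) z) \<noteq> 0"
    define x where "x = (f' ^^ i) z"
    have "x \<in> sym_class e" using z unfolding x_def by (simp flip: sym_poly_zero_iff) (metis mult_eq_0_iff power_eq_0_iff)
    then have fx: "f' x \<in> sym_class v" by (rule im)
    have "poly (Q * (sym_poly e)\<^sup>2) (f' x) = 0" using z(1)[rule_format, of "Suc i"] by (simp add: x_def)
    then have "poly Q (f' x) = 0 \<or> f' x \<in> sym_class e" by (simp add: sym_poly_zero_iff)
    then have "v \<in> X"
      using fx real_even_zero_sym_class[OF Q(1) fx] sym_class_symmetric sym_class_trans
      unfolding X_def by blast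
    then show "z \<in> E \<and> multiplier f' n z \<in> \<Lambda>" using v by simp
  qed
  moreover have "poly (sym_poly e) e = 0" by (simp add: sym_poly_zero_iff)
  ultimately show ?thesis
    using near by (intro exI[of _ f'] exI[of _ "(sym_poly e)\<^sup>2"]) (auto intro: real_even_intros)
qed

text \<open>The root need not lie in \<open>E\<close>, so the value \<open>e\<close> is imposed at a
  node \<open>w k\<close> of \<open>E\<close> near \<open>z\<close>, where the discrepancy is small
  by continuity. Displacement below 1 keeps the settled root in a slightly larger disc, and
  \<open>poly Q w \<noteq> 0\<close> says that it was not counted before.\<close>

lemma admissible_move_root:
  assumes adm: "admissible f Q" and e: "e \<in> E" and z: "f z = e" "poly Q z \<noteq> 0"
    and q: "seminorm_on F q" and "\<epsilon> > 0"
  shows "\<exists>f' K w. real_even K \<and> admissible f' (Q * K) \<and> near q R \<epsilon> f Q f' \<and>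
           cmod (w - z) < 1 \<and> f' w = e \<and> poly (Q * K) w = 0 \<and> poly Q w \<noteq> 0"
proof -
  have f: "f \<in> F" and Q: "real_even Q" "Q \<noteq> 0" "poly Q 0 = 0"
    using adm unfolding admissible_def by auto
  \<comment> \<open>Avoiding the images of zeros of \<open>Q\<close> and the class of
    \<open>e\<close> means that no zero of the enlarged polynomial is mapped into the class of
    \<open>u\<close>, so no cycle among these zeros can pass through it.\<close>
  define X where "X = {z. poly Q z = 0} \<union> sym_class e \<union> (\<Union>a\<in>{z. poly Q z = 0}. sym_class (f a))"
  have X: "finite X" using Q by (simp add: X_def poly_roots_finite)
  have "\<exists>w\<in>E. w \<notin> X \<and> cmod (w - z) < inverse (real (Suc k)) \<and> (on_axes z \<longrightarrow> on_axes w)" for k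
    by (rule E_near_axes[OF X]) simp
  then obtain w where w: "\<And>k. w k \<in> E" "\<And>k. w k \<notin> X" "\<And>k. cmod (w k - z) < inverse (real (Suc k))"
    "\<And>k. on_axes z \<Longrightarrow> on_axes (w k)" by metis
  have wz: "w \<longlonglongrightarrow> z"
    using w(3) by (intro LIM_zero_cancel[OF Lim_null_comparison[OF _ LIMSEQ_inverse_real_of_nat]])
      (auto intro: less_imp_le always_eventually)
  define t where "t k = (e - f (w k)) / poly Q (w k)" for k
  have "(\<lambda>k. f (w k)) \<longlonglongrightarrow> f z"
    using isCont_tendsto_compose[OF entire_isCont[OF holo[OF f]] wz] .
  moreover have "(\<lambda>k. poly Q (w k)) \<longlonglongrightarrow> poly Q z"
    using isCont_tendsto_compose[OF entire_isCont[OF poly_entire] wz] .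
  ultimately have "t \<longlonglongrightarrow> (e - f z) / poly Q z"
    unfolding t_def using z(2) by (intro tendsto_divide tendsto_diff tendsto_const)
  then have t: "t \<longlonglongrightarrow> 0" using z by simp
  define C where "C = Max {q (poly Q), q (poly (Q * [:0, 0, 1:])), 1}"
  have "\<forall>\<^sub>F k in sequentially. \<exists>H. real_even H \<and> poly H (w k) = t k \<and>
           near q R \<epsilon> f Q (\<lambda>z. f z + poly (Q * (1 * H)) z)"
  proof (rule interp_seq[OF q Q(1) _ _ _ _ wz t, where G = "\<lambda>k. 1" and C = C and f = "\<lambda>k. f"])
    show "\<forall>k. on_axes (w k) \<and> Im (t k) = 0" if "on_axes z"
    proof
      fix k
      have "on_axes (w k)" using w that by auto
      moreover have "Im e = 0" using z real_even_value_real[OF real[OF f] even[OF f] that] by simp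
      ultimately show "on_axes (w k) \<and> Im (t k) = 0"
        using real_even_value_real[of f "w k"] real_even_value_real[of "poly Q" "w k"] f real even Q
        by (auto simp: t_def real_even_def Im_divide)
    qed
  qed (use \<open>\<epsilon> > 0\<close> in \<open>auto simp: C_def\<close>)
  then obtain k H where H: "poly H (w k) = t k" "near q R \<epsilon> f Q (\<lambda>z. f z + poly (Q * (1 * H)) z)"
    by (auto dest: eventually_happens)
  define f' u where "f' = (\<lambda>z. f z + poly (Q * (1 * H)) z)" and "u = w k"
  have u: "u \<in> E" "u \<notin> X" using w by (auto simp: u_def)
  then have Qu: "poly Q u \<noteq> 0" by (auto simp: X_def)
  have near: "near q R \<epsilon> f Q f'" using H by (simp add: f'_def)
  have f'u: "f' u = e" using H Qu by (simp add: f'_def u_def t_def)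
  have f': "f' \<in> F" using near_mem[OF near f Q(1)] .
  have im: "f' x \<in> sym_class e" if "x \<in> sym_class u" for x
    using real_even_sym_class[OF real[OF f'] even[OF f'] that] f'u by (auto simp: sym_class_def)
  have "admissible f' (Q * (sym_poly u)\<^sup>2)"
  proof (rule admissible_extend[OF adm near real_even_sym_poly sym_poly_nonzero])
    show "x \<in> E \<longleftrightarrow> f' x \<in> E" if "poly (sym_poly u) x = 0" for x
      using that im E_sym_class u e by (metis sym_poly_zero_iff)
    fix z n i
    assume z: "exact_period f' n z" "\<forall>i. poly (Q * (sym_poly u)\<^sup>2) ((f' ^^ i) z) = 0" "poly Q ((f' ^^ i) z) \<noteq> 0"
    \<comment> \<open>\<open>p\<close> is the predecessor of \<open>x\<close> on the cycle, reached
      by going forward \<open>n - 1\<close> steps.\<close>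
    define x p where "x = (f' ^^ i) z" and "p = (f' ^^ (i + (n - 1))) z"
    have n: "n > 0" "(f' ^^ n) z = z" using z by (auto simp: exact_period_def)
    then have "Suc (i + (n - 1)) = i + n" by simp
    then have "f' p = (f' ^^ (i + n)) z" unfolding p_def by (metis comp_apply funpow.simps(2))
    then have px: "f' p = x" by (simp add: x_def funpow_add n)
    have x: "x \<in> sym_class u"
      using z(2)[rule_format, of i] z(3) by (simp add: x_def flip: sym_poly_zero_iff)
    have "poly (Q * (sym_poly u)\<^sup>2) p = 0" using z by (simp add: p_def)
    then consider "poly Q p = 0" | "p \<in> sym_class u" by (auto simp: sym_poly_zero_iff)
    then have "u \<in> X"
    proof cases
      case 1
      then have "x = f p" using near_value[OF near] px by simp
      then show ?thesis using x sym_class_symmetric 1 unfolding X_def by blast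
    next
      case 2
      then have "x \<in> sym_class e" using im px by blast
      then show ?thesis using x sym_class_symmetric sym_class_trans unfolding X_def by blast
    qed
    then show "z \<in> E \<and> multiplier f' n z \<in> \<Lambda>" using u by simp
  qed
  moreover have "poly (sym_poly u) u = 0" by (simp add: sym_poly_zero_iff)
  moreover have "cmod (u - z) < 1"
    using w(3)[of k] by (simp add: u_def) (smt (verit) inverse_le_1_iff of_nat_0_le_iff)
  ultimately show ?thesis
    using near f'u Qu
    by (intro exI[of _ f'] exI[of _ "(sym_poly u)\<^sup>2"] exI[of _ u]) (auto intro: real_even_intros)
qed

end

section \<open>Moving a cycle\<close>

lemma exact_period_unique:
  assumes "exact_period f n z" "exact_period f m z"
  shows "n = m"
  using assms unfolding exact_period_def by (metis linorder_neqE_nat)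

lemma exact_period_dvd:
  assumes "exact_period f N z" "(f ^^ n) z = z"
  shows "N dvd n"
proof -
  have N: "N > 0" "(f ^^ N) z = z" using assms by (auto simp: exact_period_def)
  then have "(f ^^ (n mod N)) z = z" using assms funpow_mod_eq by metis
  then have "n mod N = 0" using assms N unfolding exact_period_def by (metis mod_less_divisor neq0_conv)
  then show ?thesis by auto
qed

text \<open>A cycle that is its own complex conjugate is traversed up to conjugation in half a period.
  The map \<open>twist s\<close> lets both kinds of cycles be treated together.\<close>

definition twist :: "bool \<Rightarrow> complex \<Rightarrow> complex" where
  "twist s z = (if s then z else cnj z)"

lemma twist_twist [simp]: "twist s (twist s z) = z"
  by (simp add: twist_def)

lemma twist_cases: "twist s z = z \<or> twist s z = cnj z"
  by (simp add: twist_def)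

lemma twist_commutes:
  assumes "real_map f"
  shows "f (twist s z) = twist s (f z)"
  using assms by (simp add: twist_def real_map_def)

text \<open>If \<open>s\<close> is false, the second half of the orbit is the conjugate of the
  first, so a return after time \<open>m\<close> would have been a visit to \<open>cnj a\<close>
  before time \<open>m\<close>; a return at time \<open>m\<close> itself is excluded by
  \<open>cnj a \<noteq> a\<close>.\<close>

lemma twisted_period:
  assumes f: "real_map f" and m: "m > 0" "(f ^^ m) a = twist s a"
    and min: "\<And>j. 0 < j \<Longrightarrow> j < m \<Longrightarrow> (f ^^ j) a \<noteq> a \<and> (f ^^ j) a \<noteq> cnj a"
    and s: "\<not> s \<Longrightarrow> cnj a \<noteq> a"
  shows "exact_period f (if s then m else m + m) a"
proof (cases s)
  case True
  then show ?thesis using m min by (auto simp: exact_period_def twist_def)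
next
  case False
  then have fm: "(f ^^ m) a = cnj a" using m by (simp add: twist_def)
  have fmj: "(f ^^ (m + j)) a = cnj ((f ^^ j) a)" for j
    using fm by (metis add.commute comp_apply funpow_add real_map_funpow[OF f])
  have "(f ^^ j) a \<noteq> a" if "0 < j" "j < m + m" for j
  proof -
    consider "j < m" | "j = m" | "m < j" by linarith
    then show ?thesis
    proof cases
      case 3
      then have "(f ^^ j) a = cnj ((f ^^ (j - m)) a)" using fmj[of "j - m"] by simp
      moreover have "(f ^^ (j - m)) a \<noteq> cnj a" using min[of "j - m"] 3 that by linarith
      ultimately show ?thesis by (metis complex_cnj_cnj)
    qed (use min that fm s False in auto)
  qed
  moreover have "(f ^^ (m + m)) a = a" using fmj[of m] fm by simp
  ultimately show ?thesis using False m by (simp add: exact_period_def)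
qed

text \<open>\<open>sym_poly\<close> jumps at the axes, hence the condition on nodes with a limit
  there. Off the axes all late nodes use the form with two quadratic factors.\<close>

lemma poly_sym_poly_tendsto:
  assumes v: "v \<longlonglongrightarrow> w" and u: "u \<longlonglongrightarrow> y" and ax: "on_axes w \<Longrightarrow> \<forall>k. on_axes (v k)"
  shows "(\<lambda>k. poly (sym_poly (v k)) (u k)) \<longlonglongrightarrow> poly (sym_poly w) y"
proof (cases "on_axes w")
  case True
  have "(\<lambda>k. (u k)\<^sup>2 - (v k)\<^sup>2) \<longlonglongrightarrow> y\<^sup>2 - w\<^sup>2" by (intro tendsto_intros u v)
  then show ?thesis using True ax by (simp add: poly_sym_poly)
next
  case False
  have "(\<lambda>k. Im ((v k)\<^sup>2)) \<longlonglongrightarrow> Im (w\<^sup>2)" by (intro tendsto_intros v)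
  then have "\<forall>\<^sub>F k in sequentially. Im ((v k)\<^sup>2) \<noteq> 0"
    using False unfolding on_axes_iff by (rule tendsto_imp_eventually_ne)
  then have "\<forall>\<^sub>F k in sequentially. ((u k)\<^sup>2 - (v k)\<^sup>2) * ((u k)\<^sup>2 - (cnj (v k))\<^sup>2) = poly (sym_poly (v k)) (u k)"
    by eventually_elim (simp add: poly_sym_poly on_axes_iff del: Im_power2)
  moreover have "(\<lambda>k. ((u k)\<^sup>2 - (v k)\<^sup>2) * ((u k)\<^sup>2 - (cnj (v k))\<^sup>2)) \<longlonglongrightarrow> (y\<^sup>2 - w\<^sup>2) * (y\<^sup>2 - (cnj w)\<^sup>2)"
    by (intro tendsto_intros u v)
  ultimately show ?thesis using False by (simp add: poly_sym_poly filterlim_cong)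
qed

lemma pderiv_mult_square:
  assumes "poly P a = 0"
  shows "poly (pderiv (Q * P\<^sup>2)) a = 0"
  using assms by (simp add: pderiv_mult power2_eq_square)

lemma real_even_iterate_real:
  assumes "real_map f" "even_map f" "Im a = 0"
  shows "Im ((f ^^ j) a) = 0"
  by (induction j) (use assms real_even_value_real on_axes_def in auto)

lemma real_map_deriv_real:
  assumes "f holomorphic_on UNIV" "real_map f" "Im u = 0"
  shows "Im (deriv f u) = 0"
proof -
  have "cnj u = u" using assms by (simp add: complex_eq_iff)
  then have "cnj (deriv f u) = deriv f u" using real_map_deriv[OF assms(1,2), of u] by simp
  then show ?thesis by (simp add: complex_eq_iff)
qed

lemma Im_mult_real: "Im a = 0 \<Longrightarrow> Im b = 0 \<Longrightarrow> Im (a * b) = 0"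
  by simp

lemma Im_prod_real: "(\<And>i. i \<in> I \<Longrightarrow> Im (g i) = 0) \<Longrightarrow> Im (prod g I) = 0"
  by (induction I rule: infinite_finite_induct) auto

context target_sets
begin

lemma near_add:
  assumes q: "seminorm_on F q" and Q: "real_even Q" and "near q R \<epsilon>1 f Q f1" "near q R \<epsilon>2 f1 Q f2"
  shows "near q R (\<epsilon>1 + \<epsilon>2) f Q f2"
proof -
  obtain H where H: "real_even H" "f1 = (\<lambda>z. f z + poly (Q * H) z)" "q (poly (Q * H)) < \<epsilon>1"
    "\<forall>z\<in>cball 0 R. cmod (poly H z) < \<epsilon>1"
    using assms(3) unfolding near_def by blast
  obtain J where J: "real_even J" "f2 = (\<lambda>z. f1 z + poly (Q * J) z)" "q (poly (Q * J)) < \<epsilon>2"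
    "\<forall>z\<in>cball 0 R. cmod (poly J z) < \<epsilon>2"
    using assms(4) unfolding near_def by blast
  show ?thesis
    unfolding near_def
  proof (intro exI[of _ "H + J"] conjI ballI)
    show "q (poly (Q * (H + J))) < \<epsilon>1 + \<epsilon>2"
      using seminorm_add[OF q real_even_mult[OF Q H(1)] real_even_mult[OF Q J(1)]] H J
      by (simp add: distrib_left)
    show "cmod (poly (H + J) z) < \<epsilon>1 + \<epsilon>2" if "z \<in> cball 0 R" for z
      using H(4) J(4) that norm_triangle_ineq[of "poly H z" "poly J z"] by fastforce
    show "f2 = (\<lambda>z. f z + poly (Q * (H + J)) z)"
      by (simp add: H J algebra_simps)
  qed (use H J in \<open>auto intro: real_even_add\<close>)
qed

text \<open>The next target is free, so it can be taken as close to the current value as the polynomial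
  accumulated so far requires; only the starting point has a displacement given in advance.\<close>

lemma chain:
  assumes f: "f \<in> F" and q: "seminorm_on F q" and Q: "real_even Q" "poly Q 0 = 0"
    and X: "finite X" "\<And>x. poly Q x = 0 \<Longrightarrow> x \<in> X"
    and R: "\<And>j. j < m \<Longrightarrow> cmod (w j) + 1 \<le> R"
    and w: "\<And>j. Suc j < m \<Longrightarrow> f (w j) = w (Suc j)"
  shows "i < m \<Longrightarrow> \<eta> > 0 \<Longrightarrow> \<exists>f' v. near q R \<eta> f Q f' \<and>
    (\<forall>j\<le>i. v j \<in> E \<and> v j \<notin> X \<and> cmod (v j - w j) < \<eta>) \<and>
    (\<forall>j<i. f' (v j) = v (Suc j) \<and> deriv f' (v j) \<noteq> 0) \<and>
    (\<forall>j l. j \<le> i \<and> l \<le> i \<and> j \<noteq> l \<longrightarrow> v j \<notin> sym_class (v l)) \<and>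
    (Im (w 0) = 0 \<longrightarrow> Im (v 0) = 0)"
proof (induction i arbitrary: \<eta>)
  case 0
  obtain v0 where "v0 \<in> E" "v0 \<notin> X" "cmod (v0 - w 0) < \<eta>" "Im (w 0) = 0 \<longrightarrow> Im v0 = 0"
    using E_near[OF X(1) 0(2)] by blast
  then show ?case
    using near_refl[OF q 0(2)] by (intro exI[of _ f] exI[of _ "\<lambda>_. v0"]) auto
next
  case (Suc i)
  have im: "i < m" "Suc i < m" using Suc by auto
  obtain B where "B > 0" and B: "\<forall>z\<in>cball 0 R. cmod (poly Q z) \<le> B"
    using entire_bounded_on_cball[OF poly_entire] by blast
  have "isCont f (w i)" using entire_isCont[OF holo[OF f]] .
  then obtain d where "d > 0" and d: "\<And>x. cmod (x - w i) < d \<Longrightarrow> cmod (f x - f (w i)) < \<eta> / 3"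
    using \<open>\<eta> > 0\<close> unfolding continuous_at_eps_delta dist_norm by (meson divide_pos_pos zero_less_numeral)
  \<comment> \<open>\<open>d\<close> controls \<open>f\<close> near \<open>w i\<close>, 1 keeps
    \<open>u\<close> in the disc, \<eta> preserves the earlier displacements, and
    \<open>\<eta> / (3 * B)\<close> makes \<open>f1 u\<close> differ from \<open>f u\<close> by at
    most a third of \<eta>. The new target \<open>x\<close> then adds up three thirds.\<close>
  define \<eta>1 where "\<eta>1 = min (min d 1) (min \<eta> (\<eta> / (3 * B)))"
  have \<eta>1: "\<eta>1 > 0" "\<eta>1 \<le> d" "\<eta>1 \<le> 1" "\<eta>1 \<le> \<eta>" "\<eta>1 \<le> \<eta> / (3 * B)"
    using \<open>d > 0\<close> \<open>B > 0\<close> \<open>\<eta> > 0\<close> by (auto simp: \<eta>1_def)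
  obtain f1 v where f1: "near q R \<eta>1 f Q f1"
    and v: "\<And>j. j \<le> i \<Longrightarrow> v j \<in> E \<and> v j \<notin> X \<and> cmod (v j - w j) < \<eta>1"
    and fv: "\<And>j. j < i \<Longrightarrow> f1 (v j) = v (Suc j) \<and> deriv f1 (v j) \<noteq> 0"
    and sep: "\<And>j l. j \<le> i \<Longrightarrow> l \<le> i \<Longrightarrow> j \<noteq> l \<Longrightarrow> v j \<notin> sym_class (v l)"
    and v0: "Im (w 0) = 0 \<longrightarrow> Im (v 0) = 0"
    using Suc.IH[OF im(1) \<eta>1(1)] by blast
  \<comment> \<open>The product stops before \<open>v i\<close>: the earlier points are frozen, with
    their derivatives once \<open>P\<close> is squared, while the value at \<open>u = v i\<close> is
    the one to be prescribed.\<close>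
  define P where "P = (\<Prod>j<i. sym_poly (v j))"
  have P: "real_even P" unfolding P_def by (intro real_even_intros real_even_sym_poly)
  have Pz: "poly P x = 0 \<longleftrightarrow> (\<exists>j<i. x \<in> sym_class (v j))" for x
    by (auto simp: P_def poly_prod sym_poly_zero_iff)
  define u where "u = v i"
  have Qu: "poly Q u \<noteq> 0" using v[of i] X by (auto simp: u_def)
  then have u0: "u \<noteq> 0" using Q by auto
  have "poly P u \<noteq> 0" using sep by (auto simp: Pz u_def)
  with Qu have QPu: "poly (Q * P\<^sup>2) u \<noteq> 0" by simp
  have f1F: "f1 \<in> F" using near_mem[OF f1 f Q(1)] .
  obtain d2 where "d2 > 0" and d2: "\<And>f2. near q R d2 f1 (Q * P\<^sup>2) f2 \<Longrightarrow> near q R \<eta> f Q f2"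
    using near_trans[OF q Q(1) real_even_power[OF P] near_mono[OF f1 \<eta>1(4) order_refl]] by blast
  define X' where "X' = X \<union> (\<Union>j\<le>i. sym_class (v j))"
  have "finite X'" using X by (simp add: X'_def)
  then obtain f2 x where f2: "near q R d2 f1 (Q * P\<^sup>2) f2" and x: "x \<in> E" "x \<notin> X'" "f2 u = x" "deriv f2 u \<noteq> 0"
    "cmod (x - f1 u) < \<eta> / 3"
    using add_point[OF f1F q real_even_mult[OF Q(1) real_even_power[OF P]] QPu u0 _ \<open>d2 > 0\<close>, of X' "\<eta> / 3" R] \<open>\<eta> > 0\<close>
    by auto
  have old: "f2 (v j) = v (Suc j) \<and> deriv f2 (v j) \<noteq> 0" if "j < i" for j
  proof -
    have "poly P (v j) = 0" using that by (auto simp: Pz)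
    then show ?thesis
      using near_value[OF f2, of "v j"] near_deriv[OF f2 holo[OF f1F], of "v j"]
        pderiv_mult_square[of P "v j" Q] fv[OF that] by simp
  qed
  have uR: "u \<in> cball 0 R"
  proof -
    have "cmod u \<le> cmod (w i) + cmod (u - w i)" using norm_triangle_ineq[of "w i" "u - w i"] by simp
    also have "\<dots> \<le> R" using v[of i] \<eta>1 R[OF im(1)] by (simp add: u_def)
    finally show "u \<in> cball 0 R" by simp
  qed
  then have "cmod (f1 u - f u) \<le> \<eta>1 * cmod (poly Q u)" by (rule near_close[OF f1])
  also have "\<dots> \<le> \<eta> / (3 * B) * B" using B uR \<eta>1 \<open>B > 0\<close> by (intro mult_mono) auto
  also have "\<dots> = \<eta> / 3" using \<open>B > 0\<close> by simp
  finally have "cmod (f1 u - f u) \<le> \<eta> / 3" .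
  moreover have "cmod (f u - w (Suc i)) < \<eta> / 3"
    using d[of u] v[of i] \<eta>1 w[OF im(2)] by (simp add: u_def)
  ultimately have close: "cmod (x - w (Suc i)) < \<eta>"
    using x norm_triangle_ineq[of "x - f1 u" "f1 u - f u"] norm_triangle_ineq[of "x - f u" "f u - w (Suc i)"]
    by simp
  define v' where "v' = v(Suc i := x)"
  have v'_old: "v' j = v j" if "j \<le> i" for j using that by (simp add: v'_def)
  have v'_new: "v' (Suc i) = x" by (simp add: v'_def)
  have sepx: "x \<notin> sym_class (v j)" "v j \<notin> sym_class x" if "j \<le> i" for j
    using x that sym_class_symmetric unfolding X'_def by blast+
  show ?case
  proof (intro exI[of _ f2] exI[of _ v'] conjI allI impI)
    show "near q R \<eta> f Q f2" using d2 f2 .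
    show "v' j \<in> E" "v' j \<notin> X" "cmod (v' j - w j) < \<eta>" if "j \<le> Suc i" for j
      using that v[of j] x close \<eta>1 by (cases "j = Suc i"; force simp: v'_def X'_def)+
    show "f2 (v' j) = v' (Suc j)" "deriv f2 (v' j) \<noteq> 0" if "j < Suc i" for j
      using that old[of j] x by (cases "j = i"; simp add: v'_def u_def)+
    show "v' j \<notin> sym_class (v' l)" if jl: "j \<le> Suc i \<and> l \<le> Suc i \<and> j \<noteq> l" for j l
    proof -
      consider "j \<le> i" "l \<le> i" | "j = Suc i" "l \<le> i" | "j \<le> i" "l = Suc i" using jl by linarith
      then show ?thesis
        by cases (use sep sepx jl v'_old v'_new in auto)
    qed
    show "Im (v' 0) = 0" if "Im (w 0) = 0" using that v0 by (simp add: v'_def)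
  qed
qed

text \<open>Running \<open>chain\<close> with displacements tending to 0 gives orbits shadowing
  \<open>w\<close> ever more closely. The closing error at the last node tends to 0, whereas
  \<open>Q * (P k)^2\<close> there has a nonzero limit by \<open>Qw\<close> and \<open>sep\<close>;
  so the data \<open>t k\<close> tend to 0 and a large \<open>k\<close> closes the orbit. For that
  \<open>k\<close>, a correction vanishing at \<open>u k\<close> tunes the derivative. Only the last
  point of \<open>w\<close> must avoid the zeros of \<open>Q\<close>.\<close>

lemma close_cycle:
  assumes f: "f \<in> F" and q: "seminorm_on F q" and Q: "real_even Q" "poly Q 0 = 0"
    and X: "finite X" "\<And>x. poly Q x = 0 \<Longrightarrow> x \<in> X"
    and w: "\<And>j. j < m \<Longrightarrow> f (w j) = w (Suc j)" "f (w m) = twist s (w 0)"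
    and Qw: "poly Q (w m) \<noteq> 0" and sep: "\<And>j. j < m \<Longrightarrow> w m \<notin> sym_class (w j)"
    and ax: "(s \<and> (\<forall>j\<le>m. Im (w j) = 0)) \<or> (\<forall>j\<le>m. \<not> on_axes (w j))" and "\<epsilon> > 0"
  shows "\<exists>f' v. near q R \<epsilon> f Q f' \<and>
    (\<forall>j\<le>m. v j \<in> E \<and> v j \<notin> X \<and> cmod (v j - w j) < 1) \<and>
    (\<forall>j l. j \<le> m \<and> l \<le> m \<and> j \<noteq> l \<longrightarrow> v j \<notin> sym_class (v l)) \<and>
    (\<forall>j<m. f' (v j) = v (Suc j)) \<and> f' (v m) = twist s (v 0) \<and>
    (s \<longrightarrow> (\<Prod>j\<le>m. deriv f' (v j)) \<in> \<Lambda>) \<and>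
    (\<not> s \<longrightarrow> cnj (v 0) \<noteq> v 0 \<and> (\<Prod>j\<le>m. deriv f' (v j)) * cnj (\<Prod>j\<le>m. deriv f' (v j)) \<in> \<Lambda>)"
proof -
  define R' where "R' = max R (\<Sum>j\<le>m. cmod (w j) + 1)"
  have R'w: "cmod (w j) + 1 \<le> R'" if "j \<le> m" for j
    using that member_le_sum[of j "{..m}" "\<lambda>j. cmod (w j) + 1"] by (auto simp: R'_def max_def)
  have R'0: "R' \<ge> 0" using R'w[of 0] by (smt (verit) norm_ge_zero zero_le)
  \<comment> \<open>Half of \<epsilon> is reserved for the closing correction.\<close>
  define \<eta> where "\<eta> k = min (inverse (real (Suc k))) (\<epsilon> / 2)" for k
  have \<eta>: "\<eta> k > 0" "\<eta> k \<le> inverse (real (Suc k))" "\<eta> k \<le> \<epsilon> / 2" "\<eta> k \<le> 1" for k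
    using \<open>\<epsilon> > 0\<close> by (auto simp: \<eta>_def min_le_iff_disj inverse_le_1_iff)
  have "\<exists>f' v. near q R' (\<eta> k) f Q f' \<and>
    (\<forall>j\<le>m. v j \<in> E \<and> v j \<notin> X \<and> cmod (v j - w j) < \<eta> k) \<and>
    (\<forall>j<m. f' (v j) = v (Suc j) \<and> deriv f' (v j) \<noteq> 0) \<and>
    (\<forall>j l. j \<le> m \<and> l \<le> m \<and> j \<noteq> l \<longrightarrow> v j \<notin> sym_class (v l)) \<and>
    (Im (w 0) = 0 \<longrightarrow> Im (v 0) = 0)" for k
    by (rule chain[OF f q Q X, where m = "Suc m"]) (use R'w w \<eta> in auto)
  then obtain g v where g: "\<And>k. near q R' (\<eta> k) f Q (g k)"
    and v: "\<And>k j. j \<le> m \<Longrightarrow> v k j \<in> E \<and> v k j \<notin> X \<and> cmod (v k j - w j) < \<eta> k"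
    and gv: "\<And>k j. j < m \<Longrightarrow> g k (v k j) = v k (Suc j) \<and> deriv (g k) (v k j) \<noteq> 0"
    and vsep: "\<And>k j l. j \<le> m \<Longrightarrow> l \<le> m \<Longrightarrow> j \<noteq> l \<Longrightarrow> v k j \<notin> sym_class (v k l)"
    and v0: "\<And>k. Im (w 0) = 0 \<Longrightarrow> Im (v k 0) = 0" by metis
  have gF: "g k \<in> F" for k using near_mem[OF g f Q(1)] .
  have vreal: "Im (v k j) = 0" if "j \<le> m" "Im (v k 0) = 0" for k j
    using that(1)
  proof (induction j)
    case (Suc j)
    then show ?case using gv[of j k] real_even_value_real[OF real[OF gF] even[OF gF], of "v k j" k]
      by (simp add: on_axes_def)
  qed (use that in simp)
  have vlim: "(\<lambda>k. v k j) \<longlonglongrightarrow> w j" if "j \<le> m" for j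
    using v[OF that] \<eta>(2)
    by (intro LIM_zero_cancel[OF Lim_null_comparison[OF _ LIMSEQ_inverse_real_of_nat]])
       (auto intro!: always_eventually less_imp_le intro: less_le_trans)
  have vax: "\<forall>k. on_axes (v k j)" if "on_axes (w j)" "j \<le> m" for j
    using ax v0 vreal that by (auto simp: on_axes_def)
  define P where "P k = (\<Prod>j<m. sym_poly (v k j))" for k
  have P: "real_even (P k)" for k unfolding P_def by (intro real_even_intros real_even_sym_poly)
  have Pz: "poly (P k) x = 0 \<longleftrightarrow> (\<exists>j<m. x \<in> sym_class (v k j))" for x k
    by (auto simp: P_def poly_prod sym_poly_zero_iff)
  have P2: "(P k)\<^sup>2 = (\<Prod>j<m. (sym_poly (v k j))\<^sup>2)" for k
    by (simp add: P_def prod_power_distrib)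
  define u where "u = (\<lambda>k. v k m)"
  have ulim: "u \<longlonglongrightarrow> w m" using vlim[of m] unfolding u_def by simp
  have QP: "poly (Q * (P k)\<^sup>2) (u k) \<noteq> 0" for k
    using v[of m k] X vsep[of m _ k] by (auto simp: Pz u_def)
  have PL: "(\<lambda>k. poly (P k) (u k)) \<longlonglongrightarrow> (\<Prod>j<m. poly (sym_poly (w j)) (w m))"
    unfolding P_def poly_prod
    by (intro tendsto_prod poly_sym_poly_tendsto vlim ulim vax) auto
  have Pnz: "(\<Prod>j<m. poly (sym_poly (w j)) (w m)) \<noteq> 0"
    using sep by (simp add: sym_poly_zero_iff)
  obtain B where "B > 0" and B: "\<forall>z\<in>cball 0 R'. cmod (poly Q z) \<le> B"
    using entire_bounded_on_cball[OF poly_entire] by blast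
  have uR: "u k \<in> cball 0 R'" for k
  proof -
    have "cmod (u k) \<le> cmod (w m) + cmod (u k - w m)" using norm_triangle_ineq[of "w m" "u k - w m"] by simp
    also have "\<dots> \<le> R'" using v[of m k] \<eta>(4)[of k] R'w[of m] by (simp add: u_def)
    finally show ?thesis by simp
  qed
  have "(\<lambda>k. g k (u k) - f (u k)) \<longlonglongrightarrow> 0"
  proof (rule Lim_null_comparison)
    show "\<forall>\<^sub>F k in sequentially. cmod (g k (u k) - f (u k)) \<le> inverse (real (Suc k)) * B"
    proof (intro always_eventually allI)
      fix k
      have "cmod (g k (u k) - f (u k)) \<le> \<eta> k * cmod (poly Q (u k))" by (rule near_close[OF g uR])
      also have "\<dots> \<le> inverse (real (Suc k)) * B" using \<eta>[of k] B uR by (intro mult_mono) auto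
      finally show "cmod (g k (u k) - f (u k)) \<le> inverse (real (Suc k)) * B" .
    qed
    show "(\<lambda>k. inverse (real (Suc k)) * B) \<longlonglongrightarrow> 0"
      using tendsto_mult_left_zero[OF LIMSEQ_inverse_real_of_nat] .
  qed
  moreover have "(\<lambda>k. f (u k)) \<longlonglongrightarrow> f (w m)"
    using isCont_tendsto_compose[OF entire_isCont[OF holo[OF f]] ulim] .
  ultimately have "(\<lambda>k. (g k (u k) - f (u k)) + f (u k)) \<longlonglongrightarrow> 0 + f (w m)" by (rule tendsto_add)
  then have glim: "(\<lambda>k. g k (u k)) \<longlonglongrightarrow> twist s (w 0)" using w by simp
  have tlim: "(\<lambda>k. twist s (v k 0)) \<longlonglongrightarrow> twist s (w 0)"
    using vlim[of 0] by (auto simp: twist_def intro!: tendsto_intros)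
  have Qlim: "(\<lambda>k. poly Q (u k)) \<longlonglongrightarrow> poly Q (w m)"
    using isCont_tendsto_compose[OF entire_isCont[OF poly_entire] ulim] .
  define t where "t k = (twist s (v k 0) - g k (u k)) / (poly Q (u k) * (poly (P k) (u k))\<^sup>2)" for k
  have "t \<longlonglongrightarrow> (twist s (w 0) - twist s (w 0)) / (poly Q (w m) * (\<Prod>j<m. poly (sym_poly (w j)) (w m))\<^sup>2)"
    unfolding t_def
    by (intro tendsto_divide tendsto_diff tendsto_mult tendsto_power tlim glim Qlim PL) (use Qw Pnz in auto)
  then have t: "t \<longlonglongrightarrow> 0" by simp
  have vr: "\<forall>j<m. cmod (v k j) \<le> R'" for k
  proof (intro allI impI)
    fix j assume "j < m"
    then show "cmod (v k j) \<le> R'"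
      using norm_triangle_ineq[of "w j" "v k j - w j"] v[of j k] \<eta>(4)[of k] R'w[of j] by simp
  qed
  \<comment> \<open>The bounds hold for all node configurations in the disc, hence for all
    \<open>P k\<close> at once; \<open>C2\<close> handles the extra \<open>z^2\<close> that
    multiplies the slope.\<close>
  obtain C1 where C1: "\<And>v. (\<forall>j<m. cmod (v j) \<le> R') \<Longrightarrow> q (poly (Q * (\<Prod>j<m. (sym_poly (v j))\<^sup>2))) \<le> C1"
    using seminorm_sym_prod_bound[OF q Q(1)] by blast
  obtain C2 where C2: "\<And>v. (\<forall>j<m. cmod (v j) \<le> R') \<Longrightarrow> q (poly ((Q * [:0, 0, 1:]) * (\<Prod>j<m. (sym_poly (v j))\<^sup>2))) \<le> C2"
    using seminorm_sym_prod_bound[OF q real_even_mult[OF Q(1) real_even_square_var]] by blast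
  define C where "C = Max {C1, C2, (1 + R'\<^sup>2 + R'\<^sup>2) ^ (4 * m)}"
  have Cge: "C1 \<le> C" "C2 \<le> C" "(1 + R'\<^sup>2 + R'\<^sup>2) ^ (4 * m) \<le> C" by (auto simp: C_def)
  have ev1: "\<forall>\<^sub>F k in sequentially. \<exists>H. real_even H \<and> poly H (u k) = t k \<and>
      near q R' (\<epsilon> / 2) (g k) Q (\<lambda>z. g k z + poly (Q * ((P k)\<^sup>2 * H)) z)"
  proof (rule interp_seq[OF q Q(1) _ _ _ _ ulim t, where G = "\<lambda>k. (P k)\<^sup>2" and C = C])
    show "q (poly (Q * (P k)\<^sup>2)) \<le> C" for k
      using order_trans[OF C1[OF vr] Cge(1)] by (simp add: P2)
    have "Q * (P k)\<^sup>2 * [:0, 0, 1:] = Q * [:0, 0, 1:] * (P k)\<^sup>2" for k by (simp only: mult_ac)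
    then show "q (poly (Q * (P k)\<^sup>2 * [:0, 0, 1:])) \<le> C" for k
      using order_trans[OF C2[OF vr] Cge(2)] unfolding P2 by metis
    show "cmod (poly ((P k)\<^sup>2) z) \<le> C" if "z \<in> cball 0 R'" for k z
      using order_trans[OF poly_sym_prod_bound[OF vr _ R'0, of z] Cge(3)] that by (simp add: P2)
    show "\<forall>k. on_axes (u k) \<and> Im (t k) = 0" if axm: "on_axes (w m)"
    proof
      fix k
      have s: "s" "Im (w 0) = 0" using ax axm by auto
      have "on_axes (u k)" using vax[OF axm] by (simp add: u_def)
      moreover have "Im (g k (u k)) = 0" "Im (poly (P k) (u k)) = 0" "Im (poly Q (u k)) = 0"
        using real_even_value_real[OF _ _ \<open>on_axes (u k)\<close>] real even gF P Q unfolding real_even_def by blast+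
      ultimately show "on_axes (u k) \<and> Im (t k) = 0"
        using s v0[of k] by (simp add: t_def twist_def Im_divide)
    qed
  qed (use P \<open>\<epsilon> > 0\<close> in \<open>auto intro: real_even_power\<close>)
  \<comment> \<open>This ensures that the reality condition at \<open>u k\<close> arises only for a
    real cycle.\<close>
  have ev2: "\<forall>\<^sub>F k in sequentially. \<not> on_axes (w m) \<longrightarrow> \<not> on_axes (u k)"
  proof (cases "on_axes (w m)")
    case False
    have "(\<lambda>k. Im ((u k)\<^sup>2)) \<longlonglongrightarrow> Im ((w m)\<^sup>2)" by (intro tendsto_intros ulim)
    then have "\<forall>\<^sub>F k in sequentially. Im ((u k)\<^sup>2) \<noteq> 0"
      using False unfolding on_axes_iff by (rule tendsto_imp_eventually_ne)
    then show ?thesis unfolding on_axes_iff by eventually_elim simp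
  qed simp
  obtain k where k: "\<exists>H. real_even H \<and> poly H (u k) = t k \<and>
      near q R' (\<epsilon> / 2) (g k) Q (\<lambda>z. g k z + poly (Q * ((P k)\<^sup>2 * H)) z)"
    and k2: "\<not> on_axes (w m) \<longrightarrow> \<not> on_axes (u k)"
    using eventually_happens'[OF sequentially_bot eventually_conj[OF ev1 ev2]] by blast
  then obtain H where H: "real_even H" "poly H (u k) = t k"
    "near q R' (\<epsilon> / 2) (g k) Q (\<lambda>z. g k z + poly (Q * ((P k)\<^sup>2 * H)) z)" by blast
  define f1 where "f1 = (\<lambda>z. g k z + poly (Q * ((P k)\<^sup>2 * H)) z)"
  have f1n: "near q R' \<epsilon> f Q f1"
    using near_add[OF q Q(1) near_mono[OF g[of k] \<eta>(3) order_refl] H(3)] by (simp add: f1_def)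
  have f1F: "f1 \<in> F" using near_mem[OF f1n f Q(1)] .
  have f1v: "f1 (v k j) = v k (Suc j)" "deriv f1 (v k j) \<noteq> 0" if "j < m" for j
  proof -
    have z: "poly (P k) (v k j) = 0" using that by (auto simp: Pz)
    then show "f1 (v k j) = v k (Suc j)" using gv that by (simp add: f1_def)
    have "deriv f1 (v k j) = deriv (g k) (v k j) + poly (pderiv (Q * ((P k)\<^sup>2 * H))) (v k j)"
      unfolding f1_def by (rule deriv_add_poly[OF holo[OF gF]])
    also have "poly (pderiv (Q * ((P k)\<^sup>2 * H))) (v k j) = 0"
      using pderiv_mult_square[OF z, of "Q * H"] by (simp only: mult_ac)
    finally show "deriv f1 (v k j) \<noteq> 0" using gv that by simp
  qed
  have f1u: "f1 (u k) = twist s (v k 0)"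
    using QP[of k] H by (simp add: f1_def t_def)
  define S where "S = Q * (P k)\<^sup>2"
  have S: "real_even S" using Q P by (auto simp: S_def intro: real_even_intros)
  obtain d where "d > 0" and d: "\<And>f2. near q R' d f1 S f2 \<Longrightarrow> near q R' \<epsilon> f Q f2"
    using near_trans[OF q Q(1) real_even_power[OF P[of k]] f1n] unfolding S_def by blast
  obtain \<tau> where "\<tau> > 0" and \<tau>: "\<And>t. cmod t < \<tau> \<Longrightarrow> (on_axes (u k) \<longrightarrow> Im t = 0) \<Longrightarrow>
      \<exists>H. real_even H \<and> poly H (u k) = t \<and> near q R' d f1 S (\<lambda>z. f1 z + poly (S * (sym_poly (u k) * H)) z)"
    using interp_fixed[OF q S real_even_sym_poly \<open>d > 0\<close>, of "u k" R' f1] by blast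
  define D where "D = (\<Prod>j<m. deriv f1 (v k j))"
  have D: "D \<noteq> 0" using f1v by (simp add: D_def)
  define c where "c = poly S (u k) * poly (pderiv (sym_poly (u k))) (u k)"
  have "u k \<noteq> 0" using Q v[of m k] X by (auto simp: u_def)
  then have c: "c \<noteq> 0" using QP[of k] pderiv_sym_poly unfolding c_def S_def by auto
  define \<mu>0 where "\<mu>0 = D * deriv f1 (u k)"
  have "\<tau> * cmod (D * c) > 0" using \<open>\<tau> > 0\<close> D c by simp
  then have "\<exists>\<mu>. cmod (\<mu> - \<mu>0) < \<tau> * cmod (D * c) \<and> (s \<longrightarrow> \<mu> \<in> \<Lambda> \<and> (Im \<mu>0 = 0 \<longrightarrow> Im \<mu> = 0)) \<and> (\<not> s \<longrightarrow> \<mu> * cnj \<mu> \<in> \<Lambda>)"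
    using L_near[of "\<tau> * cmod (D * c)" \<mu>0] L_near_norm_square[of "\<tau> * cmod (D * c)" \<mu>0] by (cases s) auto
  then obtain \<mu> where \<mu>: "cmod (\<mu> - \<mu>0) < \<tau> * cmod (D * c)" "s \<longrightarrow> \<mu> \<in> \<Lambda> \<and> (Im \<mu>0 = 0 \<longrightarrow> Im \<mu> = 0)" "\<not> s \<longrightarrow> \<mu> * cnj \<mu> \<in> \<Lambda>"
    by blast
  \<comment> \<open>The correction \<open>S * (sym_poly (u k) * J)\<close> changes the derivative at
    \<open>u k\<close> by \<open>c\<close> times the value of \<open>J\<close> there, and hence the
    whole product by \<open>D * c\<close> times it. \<open>D \<noteq> 0\<close> because
    \<open>chain\<close> supplied nonzero derivatives.\<close>
  define x where "x = (\<mu> - \<mu>0) / (D * c)"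
  have "cmod x < \<tau>" using \<mu>(1) D c by (simp add: x_def norm_divide divide_less_eq)
  \<comment> \<open>By the choice of \<open>k\<close> the cycle is then real, and so are all
    derivatives involved and the chosen \<mu>.\<close>
  moreover have "Im x = 0" if "on_axes (u k)"
  proof -
    have axm: "on_axes (w m)" using k2 that by blast
    then have s: "s" "Im (w 0) = 0" using ax by auto
    have vre: "Im (v k j) = 0" if "j \<le> m" for j using vreal[OF that v0[OF s(2)]] .
    have dre: "Im (deriv f1 (v k j)) = 0" if "j \<le> m" for j
      using real_map_deriv_real[OF holo[OF f1F] real[OF f1F] vre[OF that]] .
    have "Im D = 0" unfolding D_def using dre by (intro Im_prod_real) auto
    then have "Im \<mu>0 = 0" unfolding \<mu>0_def using dre[of m] by (intro Im_mult_real) (auto simp: u_def)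
    then have "Im \<mu> = 0" using \<mu> s by simp
    have "Im (deriv (poly (sym_poly (u k))) (u k)) = 0"
      using real_map_deriv_real[OF poly_entire, of "sym_poly (u k)" "u k"] vre[of m] real_even_sym_poly
      unfolding real_even_def u_def by auto
    then have "Im (poly (pderiv (sym_poly (u k))) (u k)) = 0"
      using DERIV_imp_deriv[OF poly_DERIV] by metis
    moreover have "Im (poly S (u k)) = 0"
      using real_even_value_real[OF _ _ that] S unfolding real_even_def by blast
    ultimately have "Im c = 0" unfolding c_def by (intro Im_mult_real)
    then show ?thesis using \<open>Im D = 0\<close> \<open>Im \<mu>0 = 0\<close> \<open>Im \<mu> = 0\<close> by (simp add: x_def Im_divide)
  qed
  ultimately obtain J where J: "real_even J" "poly J (u k) = x"
    "near q R' d f1 S (\<lambda>z. f1 z + poly (S * (sym_poly (u k) * J)) z)" using \<tau> by blast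
  define f2 where "f2 = (\<lambda>z. f1 z + poly (S * (sym_poly (u k) * J)) z)"
  have f2n: "near q R' \<epsilon> f Q f2" using d J by (simp add: f2_def)
  have su: "poly (sym_poly (u k)) (u k) = 0" by (simp add: sym_poly_zero_iff)
  have f2v: "f2 (v k j) = v k (Suc j)" "deriv f2 (v k j) = deriv f1 (v k j)" if "j < m" for j
  proof -
    have z: "poly (P k) (v k j) = 0" using that by (auto simp: Pz)
    then show "f2 (v k j) = v k (Suc j)" using f1v that by (simp add: f2_def S_def)
    have "deriv f2 (v k j) = deriv f1 (v k j) + poly (pderiv (S * (sym_poly (u k) * J))) (v k j)"
      unfolding f2_def by (rule deriv_add_poly[OF holo[OF f1F]])
    also have "poly (pderiv (S * (sym_poly (u k) * J))) (v k j) = 0"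
      using pderiv_mult_square[OF z, of "Q * (sym_poly (u k) * J)"] unfolding S_def by (simp only: mult_ac)
    finally show "deriv f2 (v k j) = deriv f1 (v k j)" by simp
  qed
  have f2u: "f2 (u k) = twist s (v k 0)" using f1u su by (simp add: f2_def)
  have "deriv f2 (u k) = deriv f1 (u k) + c * x"
    unfolding f2_def deriv_add_poly[OF holo[OF f1F]] pderiv_mult_at_zero[OF su] c_def J(2) by (simp only: mult.assoc)
  also have "c * x = (\<mu> - \<mu>0) / D" using c D by (simp add: x_def)
  finally have "D * deriv f2 (u k) = \<mu>" using D by (simp add: \<mu>0_def distrib_left)
  moreover have "(\<Prod>j\<le>m. deriv f2 (v k j)) = D * deriv f2 (u k)"
    using f2v by (simp add: D_def u_def lessThan_Suc_atMost[symmetric])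
  ultimately have prod: "(\<Prod>j\<le>m. deriv f2 (v k j)) = \<mu>" by simp
  have "cnj (v k 0) \<noteq> v k 0" if "\<not> s"
  proof
    assume "cnj (v k 0) = v k 0"
    then have "Im (v k 0) = 0" by (simp add: complex_eq_iff)
    then have "on_axes (u k)" using vreal[of m k] by (simp add: u_def on_axes_def)
    then show False using k2 ax that by auto
  qed
  moreover have "near q R \<epsilon> f Q f2" using near_mono[OF f2n order_refl] by (simp add: R'_def)
  moreover have "cmod (v k j - w j) < 1" if "j \<le> m" for j
    using v[OF that, of k] \<eta>(4)[of k] by linarith
  ultimately show ?thesis
    using v[of _ k] vsep[of _ _ k] f2v f2u prod \<mu> u_def
    by (intro exI[of _ f2] exI[of _ "v k"]) auto
qed

end

lemma funpow_dvd_fix: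
  assumes "(f ^^ n) z = z" "n dvd k"
  shows "(f ^^ k) z = z"
  using funpow_mod_eq[OF assms(1), of k] assms(2) by simp

lemma funpow_return:
  assumes "(f ^^ n) z = z" "n > 0"
  shows "(f ^^ (n * i - i)) ((f ^^ i) z) = z"
proof -
  have "n * i - i + i = n * i" using assms by simp
  then have "(f ^^ (n * i - i)) ((f ^^ i) z) = (f ^^ (n * i)) z" by (metis comp_apply funpow_add)
  then show ?thesis using funpow_dvd_fix[OF assms(1)] by simp
qed

lemma on_axes_funpow:
  assumes "real_map f" "even_map f" "on_axes y"
  shows "on_axes ((f ^^ k) y)"
  by (induction k) (use assms real_even_value_real on_axes_def in auto)

text \<open>The first application of the even map absorbs the sign, and only conjugation can
  remain.\<close>

lemma real_even_funpow_sym_class: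
  assumes f: "real_map f" "even_map f" and x: "x \<in> sym_class u"
  shows "(f ^^ Suc k) x = (f ^^ Suc k) u \<or> (f ^^ Suc k) x = cnj ((f ^^ Suc k) u)"
proof -
  have "(f ^^ Suc k) x = (f ^^ k) (f x)" "(f ^^ Suc k) u = (f ^^ k) (f u)"
    by (simp_all add: funpow_swap1)
  then show ?thesis
    using real_even_sym_class[OF f x] real_map_funpow[OF f(1)] by metis
qed

lemma multiplier_add:
  assumes "f holomorphic_on UNIV"
  shows "multiplier f (k + l) a = multiplier f k ((f ^^ l) a) * multiplier f l a"
proof -
  have "((f ^^ k) \<circ> (f ^^ l) has_field_derivative deriv (f ^^ k) ((f ^^ l) a) * deriv (f ^^ l) a) (at a)"
    by (intro DERIV_chain entire_has_deriv holomorphic_on_funpow assms)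
  then show ?thesis unfolding multiplier_def funpow_add by (rule DERIV_imp_deriv)
qed

context target_sets
begin

text \<open>Half-cycles up to conjugation are moved by \<open>close_cycle\<close>. What remains is
  bookkeeping: the new cycle has the same exact period, its multiplier is in \<Lambda>, it and its
  conjugate are the only cycles created, and one of their points shadows the given \<open>z\<close>
  rather than just \<open>y\<close>.\<close>

lemma admissible_move_cycle:
  assumes adm: "admissible f Q" and z: "(f ^^ n) z = z" "n > 0" "poly Q ((f ^^ i0) z) \<noteq> 0"
    and q: "seminorm_on F q" and "\<epsilon> > 0"
  shows "\<exists>f' K v. real_even K \<and> admissible f' (Q * K) \<and> near q R \<epsilon> f Q f' \<and>
     cmod (v - z) < 1 \<and> (f' ^^ n) v = v \<and> (\<forall>i. poly (Q * K) ((f' ^^ i) v) = 0) \<and> poly Q v \<noteq> 0"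
proof -
  have f: "f \<in> F" and Q: "real_even Q" "Q \<noteq> 0" "poly Q 0 = 0"
    using adm unfolding admissible_def by auto
  note re = real[OF f] even[OF f]
  define y where "y = (f ^^ i0) z"
  have yn: "(f ^^ n) y = y"
    using z by (simp add: y_def) (metis add.commute comp_apply funpow_add)
  \<comment> \<open>Stopping at the first return to \<open>y\<close> or its conjugate keeps the
    points in distinct symmetry classes; a longer segment would prescribe conjugate values
    twice.\<close>
  define M where "M = (LEAST m. 0 < m \<and> ((f ^^ m) y = y \<or> (f ^^ m) y = cnj y))"
  have "\<exists>m. 0 < m \<and> ((f ^^ m) y = y \<or> (f ^^ m) y = cnj y)" using z yn by blast
  then have "0 < M \<and> ((f ^^ M) y = y \<or> (f ^^ M) y = cnj y)"
    unfolding M_def by (rule LeastI_ex)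
  then have M: "M > 0" "(f ^^ M) y = y \<or> (f ^^ M) y = cnj y" by blast+
  have min: "(f ^^ j) y \<noteq> y \<and> (f ^^ j) y \<noteq> cnj y" if "0 < j" "j < M" for j
    using that not_less_Least[of j "\<lambda>m. 0 < m \<and> ((f ^^ m) y = y \<or> (f ^^ m) y = cnj y)"] by (auto simp: M_def)
  define s where "s \<longleftrightarrow> (f ^^ M) y = y"
  have fM: "(f ^^ M) y = twist s y" using M by (auto simp: s_def twist_def)
  obtain m where m: "M = Suc m" using M by (cases M) auto
  \<comment> \<open>The shift by one and the twist make the segment end at \<open>w m = y\<close>,
    where \<open>Q\<close> does not vanish and the orbit will be closed.\<close>
  define w where "w = (\<lambda>j. twist s ((f ^^ Suc j) y))"
  have wm: "w m = y" using fM m by (simp add: w_def)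
  have wstep: "f (w j) = w (Suc j)" for j
    by (simp add: w_def twist_commutes[OF re(1)])
  have wlast: "f (w m) = twist s (w 0)" by (simp add: wm) (simp add: w_def)
  \<comment> \<open>Were \<open>y\<close> in the class of a previous point, iterating onward to time
    \<open>M\<close> would show that \<open>y\<close> returns to itself or its conjugate before
    \<open>M\<close>, the sign being lost on the way.\<close>
  have sep: "w m \<notin> sym_class (w j)" if "j < m" for j
  proof
    assume "w m \<in> sym_class (w j)"
    then have "y \<in> sym_class ((f ^^ Suc j) y)"
      unfolding wm by (cases s) (auto simp: w_def twist_def sym_class_def)
    then have "(f ^^ Suc (m - Suc j)) y = (f ^^ Suc (m - Suc j)) ((f ^^ Suc j) y) \<or>
        (f ^^ Suc (m - Suc j)) y = cnj ((f ^^ Suc (m - Suc j)) ((f ^^ Suc j) y))"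
      by (rule real_even_funpow_sym_class[OF re])
    moreover have "(f ^^ Suc (m - Suc j)) ((f ^^ Suc j) y) = (f ^^ M) y"
    proof -
      have "M = Suc (m - Suc j) + Suc j" using that m by simp
      then show ?thesis by (metis comp_apply funpow_add)
    qed
    ultimately have "(f ^^ Suc (m - Suc j)) y = y \<or> (f ^^ Suc (m - Suc j)) y = cnj y" using M(2) by auto
    then show False using min[of "Suc (m - Suc j)"] that m by auto
  qed
  have ax: "(s \<and> (\<forall>j\<le>m. Im (w j) = 0)) \<or> (\<forall>j\<le>m. \<not> on_axes (w j))"
  proof (cases "on_axes y")
    case True
    obtain n' where n': "n = Suc n'" using z by (cases n) auto
    \<comment> \<open>A periodic point on an axis is the image of another point on the axes, hence
      real: a cycle cannot contain a nonzero imaginary point.\<close>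
    have "Im (f ((f ^^ n') y)) = 0"
      using real_even_value_real[OF re on_axes_funpow[OF re True]] .
    then have "Im y = 0" using yn n' by simp
    then have "cnj y = y" by (simp add: complex_eq_iff)
    then have s using M by (auto simp: s_def)
    moreover have "Im ((f ^^ k) y) = 0" for k using real_even_iterate_real[OF re \<open>Im y = 0\<close>] .
    ultimately show ?thesis by (simp add: w_def twist_def del: funpow.simps)
  next
    case False
    have "\<not> on_axes (w j)" for j
    proof
      assume "on_axes (w j)"
      then have "on_axes ((f ^^ Suc j) y)" by (cases s) (auto simp: w_def twist_def on_axes_def)
      then have "on_axes ((f ^^ (n * Suc j - Suc j)) ((f ^^ Suc j) y))" by (rule on_axes_funpow[OF re])
      then show False using False funpow_return[OF yn z(2)] by metis
    qed
    then show ?thesis by blast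
  qed
  define X where "X = {x. poly Q x = 0}"
  have X: "finite X" "\<And>x. poly Q x = 0 \<Longrightarrow> x \<in> X"
    using Q poly_roots_finite by (auto simp: X_def)
  have Qw: "poly Q (w m) \<noteq> 0" using z by (simp add: wm y_def)
  obtain f2 v where near: "near q R \<epsilon> f Q f2"
    and v: "\<And>j. j \<le> m \<Longrightarrow> v j \<in> E \<and> v j \<notin> X \<and> cmod (v j - w j) < 1"
    and vsep: "\<And>j l. j \<le> m \<Longrightarrow> l \<le> m \<Longrightarrow> j \<noteq> l \<Longrightarrow> v j \<notin> sym_class (v l)"
    and fv: "\<And>j. j < m \<Longrightarrow> f2 (v j) = v (Suc j)" and fvm: "f2 (v m) = twist s (v 0)"
    and mult_s: "s \<Longrightarrow> (\<Prod>j\<le>m. deriv f2 (v j)) \<in> \<Lambda>"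
    and mult_ns: "\<not> s \<Longrightarrow> cnj (v 0) \<noteq> v 0 \<and> (\<Prod>j\<le>m. deriv f2 (v j)) * cnj (\<Prod>j\<le>m. deriv f2 (v j)) \<in> \<Lambda>"
    using close_cycle[OF f q Q(1,3) X wstep wlast Qw sep ax \<open>\<epsilon> > 0\<close>, of R] by blast
  have f2: "f2 \<in> F" using near_mem[OF near f Q(1)] .
  note re2 = real[OF f2] even[OF f2]
  \<comment> \<open>The new cycle with its conjugate. \<open>K\<close> vanishes at the negatives as
    well, but \<open>f2\<close> sends all zeros of \<open>K\<close> into \<open>C\<close>, so every
    cycle through such a zero lies in \<open>C\<close>.\<close>
  define C where "C = {x. \<exists>j\<le>m. x = v j \<or> x = cnj (v j)}"
  have C_cnj: "cnj x \<in> C" if "x \<in> C" for x using that unfolding C_def by fastforce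
  have C_E: "x \<in> E" if "x \<in> C" for x using that v by (auto simp: C_def)
  have fvC: "f2 (v j) \<in> C" if "j \<le> m" for j
  proof (cases "j = m")
    case True
    then show ?thesis using fvm twist_cases[of s "v 0"] by (auto simp: C_def)
  next
    case False
    then show ?thesis using fv[of j] that by (auto simp: C_def intro!: exI[of _ "Suc j"])
  qed
  define K where "K = (\<Prod>j\<le>m. sym_poly (v j))"
  have K: "real_even K" "K \<noteq> 0"
    by (auto simp: K_def sym_poly_nonzero intro!: real_even_intros real_even_sym_poly)
  have Kz: "poly K x = 0 \<longleftrightarrow> (\<exists>j\<le>m. x \<in> sym_class (v j))" for x
    by (auto simp: K_def poly_prod sym_poly_zero_iff)
  have KC: "poly K x = 0" if "x \<in> C" for x
    using that unfolding Kz C_def sym_class_def by auto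
  have im: "f2 x \<in> C" if "poly K x = 0" for x
    using that real_even_sym_class[OF re2] fvC C_cnj unfolding Kz by metis
  have C_iter: "(f2 ^^ i) x \<in> C" if "x \<in> C" for i x
    by (induction i) (use that im KC in auto)
  have iter: "j \<le> m \<Longrightarrow> (f2 ^^ j) (v 0) = v j" for j
    by (induction j) (use fv in auto)
  have iterM: "(f2 ^^ M) (v 0) = twist s (v 0)" using iter[of m] fvm m by simp
  define N where "N = (if s then M else M + M)"
  have perv: "exact_period f2 N (v 0)"
    unfolding N_def
  proof (rule twisted_period[OF re2(1) M(1) iterM])
    show "(f2 ^^ j) (v 0) \<noteq> v 0 \<and> (f2 ^^ j) (v 0) \<noteq> cnj (v 0)" if "0 < j" "j < M" for j
      using vsep[of j 0] iter[of j] that m by (auto simp: sym_class_def)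
  qed (use mult_ns in auto)
  \<comment> \<open>Old and new cycle have the same exact period \<open>N\<close>, so the new one is
    also fixed by the \<open>n\<close>-th iterate.\<close>
  have pery: "exact_period f N y"
    unfolding N_def
    by (rule twisted_period[OF re(1) M(1) fM min]) (use M s_def in auto)
  have "N dvd n" using exact_period_dvd[OF pery yn] .
  then have v0n: "(f2 ^^ n) (v 0) = v 0"
    using funpow_dvd_fix perv unfolding exact_period_def by metis
  have multM: "multiplier f2 M (v 0) = (\<Prod>j\<le>m. deriv f2 (v j))"
    unfolding multiplier_def deriv_funpow[OF holo[OF f2]] m lessThan_Suc_atMost
    using iter by (intro prod.cong) auto
  have mult: "multiplier f2 N (v 0) \<in> \<Lambda>"
  proof (cases s)
    case True
    then show ?thesis using mult_s multM by (simp add: N_def)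
  next
    case False
    have "multiplier f2 (M + M) (v 0) = multiplier f2 M (cnj (v 0)) * multiplier f2 M (v 0)"
      using multiplier_add[OF holo[OF f2], of M M "v 0"] iterM False by (simp add: twist_def)
    also have "\<dots> = (\<Prod>j\<le>m. deriv f2 (v j)) * cnj (\<Prod>j\<le>m. deriv f2 (v j))"
      unfolding exact_period_cnj(2)[OF holo[OF f2] re2(1)] multM by (rule mult.commute)
    finally show ?thesis using mult_ns False by (simp add: N_def)
  qed
  have reach: "\<exists>l. (f2 ^^ l) x = v 0 \<or> (f2 ^^ l) x = cnj (v 0)" if xC: "x \<in> C" for x
  proof -
    obtain j where j: "j \<le> m" "x = v j \<or> x = cnj (v j)" using xC by (auto simp: C_def)
    have "(f2 ^^ (M - j)) (v j) = (f2 ^^ (M - j)) ((f2 ^^ j) (v 0))" using iter j by simp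
    also have "\<dots> = (f2 ^^ M) (v 0)"
    proof -
      have "M - j + j = M" using j m by simp
      then show ?thesis by (metis comp_apply funpow_add)
    qed
    finally have "(f2 ^^ (M - j)) (v j) = v 0 \<or> (f2 ^^ (M - j)) (v j) = cnj (v 0)"
      using iterM twist_cases by metis
    then show ?thesis using j(2) real_map_funpow[OF re2(1)] by (metis complex_cnj_cnj)
  qed
  have adm2: "admissible f2 (Q * K\<^sup>2)"
  proof (rule admissible_extend[OF adm near K])
    show "x \<in> E \<longleftrightarrow> f2 x \<in> E" if "poly K x = 0" for x
      using that C_E im E_sym_class v unfolding Kz by metis
    fix z' n' i
    assume z': "exact_period f2 n' z'" "\<forall>i. poly (Q * K\<^sup>2) ((f2 ^^ i) z') = 0" "poly Q ((f2 ^^ i) z') \<noteq> 0"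
    have "poly K ((f2 ^^ i) z') = 0" using z'(2)[rule_format, of i] z'(3) by simp
    then have inC: "(f2 ^^ Suc i) z' \<in> C" using im by simp
    have n': "n' > 0" "(f2 ^^ n') z' = z'" using z' by (auto simp: exact_period_def)
    have "z' \<in> C" using C_iter[OF inC] funpow_return[OF n'(2,1)] by metis
    then obtain l where l: "(f2 ^^ l) z' = v 0 \<or> (f2 ^^ l) z' = cnj (v 0)" using reach by blast
    note el = exact_period_funpow[OF holo[OF f2] z'(1), of l]
    have "exact_period f2 n' (v 0)"
      using el l exact_period_cnj(1)[OF holo[OF f2] re2(1)] by metis
    then have "n' = N" using perv exact_period_unique by blast
    then have "multiplier f2 n' z' \<in> \<Lambda>"
      using el l mult L_sym[OF mult] exact_period_cnj(2)[OF holo[OF f2] re2(1)] by metis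
    then show "z' \<in> E \<and> multiplier f2 n' z' \<in> \<Lambda>" using C_E[OF \<open>z' \<in> C\<close>] by blast
  qed
  \<comment> \<open>The number of steps that lead from \<open>y\<close> on to \<open>z\<close>,
    completing \<open>Suc i0\<close> periods from \<open>z\<close>; with \<open>i0\<close> periods
    it could be 0.\<close>
  have "n * Suc i0 - i0 > 0" using z(2) by (cases n) auto
  then obtain k where k: "n * Suc i0 - i0 = Suc k" using gr0_implies_Suc by blast
  have zk: "(f ^^ Suc k) y = z"
  proof -
    have "n * Suc i0 - i0 + i0 = n * Suc i0" using z(2) by (cases n) auto
    then have "(f ^^ Suc k) y = (f ^^ (n * Suc i0)) z"
      unfolding y_def k[symmetric] by (metis comp_apply funpow_add)
    then show ?thesis using funpow_dvd_fix[OF z(1)] by simp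
  qed
  \<comment> \<open>After a multiple of \<open>M\<close> steps the orbit of \<open>y\<close> is at
    \<open>y\<close> or its conjugate, so only the remainder matters and \<open>z\<close> is
    \<open>w b\<close> up to conjugation.\<close>
  define b where "b = k mod M"
  have b: "b \<le> m" using m by (simp add: b_def less_Suc_eq_le[symmetric])
  have aM: "(f ^^ (M * a)) y = y \<or> (f ^^ (M * a)) y = cnj y" for a
  proof (induction a)
    case (Suc a)
    have "(f ^^ (M * Suc a)) y = (f ^^ M) ((f ^^ (M * a)) y)" by (simp add: funpow_add)
    then show ?case using Suc M(2) real_map_funpow[OF re(1)] by (metis complex_cnj_cnj)
  qed simp
  have "Suc k = Suc b + M * (k div M)" by (simp add: b_def)
  then have "z = (f ^^ Suc b) ((f ^^ (M * (k div M))) y)" using zk by (metis comp_apply funpow_add)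
  then have "z = (f ^^ Suc b) y \<or> z = cnj ((f ^^ Suc b) y)"
    using aM[of "k div M"] real_map_funpow[OF re(1)] by metis
  then have zw: "z = w b \<or> z = cnj (w b)"
    by (cases s) (auto simp: w_def twist_def simp del: funpow.simps)
  define x where "x = (if z = w b then v b else cnj (v b))"
  have xC: "x \<in> C" using b by (auto simp: x_def C_def)
  have "cmod (x - z) < 1"
  proof (cases "z = w b")
    case True
    then show ?thesis using v[OF b] by (simp add: x_def)
  next
    case False
    then have "x - z = cnj (v b - w b)" using zw by (simp add: x_def)
    then show ?thesis using v[OF b] complex_mod_cnj by metis
  qed
  moreover have "(f2 ^^ n) x = x"
  proof -
    have "(f2 ^^ n) (v b) = (f2 ^^ n) ((f2 ^^ b) (v 0))" using iter[OF b] by simp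
    also have "\<dots> = (f2 ^^ b) ((f2 ^^ n) (v 0))" by (metis add.commute comp_apply funpow_add)
    finally have "(f2 ^^ n) (v b) = v b" using v0n iter[OF b] by simp
    then show ?thesis using real_map_funpow[OF re2(1)] by (simp add: x_def)
  qed
  moreover have "poly (Q * K\<^sup>2) ((f2 ^^ i) x) = 0" for i
    using KC[OF C_iter[OF xC]] by simp
  moreover have "poly Q x \<noteq> 0"
    using v[OF b] real_even_zero_sym_class[OF Q(1), of x "v b"] by (auto simp: x_def X_def sym_class_def)
  ultimately show ?thesis
    using adm2 near K by (intro exI[of _ f2] exI[of _ "K\<^sup>2"] exI[of _ x]) (auto intro: real_even_power)
qed

end

section \<open>Settling all roots and cycles in a disc\<close>

lemma roots_stable:
  assumes f: "f holomorphic_on UNIV" and nz: "f z0 \<noteq> e"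
    and roots: "\<forall>z\<in>cball 0 \<rho>. f z = e \<longrightarrow> poly Q z = 0"
  shows "\<exists>M0\<ge>1. \<forall>M\<ge>M0. \<exists>\<delta>>0. \<forall>g. (\<forall>z\<in>cball 0 \<rho>. cmod (g z - f z) \<le> \<delta> * cmod (poly Q z) ^ M) \<longrightarrow>
      (\<forall>z\<in>cball 0 \<rho>. g z = e \<longrightarrow> poly Q z = 0)"
proof -
  have "(\<lambda>z. f z - e) holomorphic_on UNIV" using f by (intro holomorphic_intros)
  then obtain M0 where M0: "M0 \<ge> 1"
    and c: "\<And>M. M \<ge> M0 \<Longrightarrow> \<exists>c>0. \<forall>z\<in>cball 0 \<rho>. c * (\<Sum>j<Suc 0. cmod (poly Q z)) ^ M \<le> cmod (f z - e)"
    using compact_power_lower_bound[of "\<lambda>z. f z - e" z0 "\<lambda>j. poly Q" \<rho> "Suc 0"] nz roots poly_entire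
    by auto
  have "\<exists>\<delta>>0. \<forall>g. (\<forall>z\<in>cball 0 \<rho>. cmod (g z - f z) \<le> \<delta> * cmod (poly Q z) ^ M) \<longrightarrow>
      (\<forall>z\<in>cball 0 \<rho>. g z = e \<longrightarrow> poly Q z = 0)" if MM0: "M \<ge> M0" for M
  proof -
    obtain c where "c > 0" and c: "\<And>z. z \<in> cball 0 \<rho> \<Longrightarrow> c * cmod (poly Q z) ^ M \<le> cmod (f z - e)"
      using c[OF MM0] by auto
    have "poly Q z = 0"
      if g: "\<forall>z\<in>cball 0 \<rho>. cmod (g z - f z) \<le> c / 2 * cmod (poly Q z) ^ M" and z: "z \<in> cball 0 \<rho>" "g z = e" for g z
    proof (rule ccontr)
      assume "poly Q z \<noteq> 0"
      then have "c * cmod (poly Q z) ^ M > 0" using \<open>c > 0\<close> by simp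
      moreover have "cmod (f z - e) \<le> c / 2 * cmod (poly Q z) ^ M" using g z by (metis norm_minus_commute)
      ultimately show False using c[OF z(1)] by simp
    qed
    then show ?thesis using \<open>c > 0\<close> by (intro exI[of _ "c / 2"]) auto
  qed
  then show ?thesis using M0 by blast
qed

text \<open>At a fixed point of the \<open>n\<close>-th iterate of \<open>g\<close>, the lower bound
  \<open>c * \<Phi> z ^ M\<close> for the displacement under \<open>f\<close> meets the upper bound
  \<open>c / 2 * \<Phi> z ^ M\<close> from \<open>iterate_perturbation_bound\<close>, so both vanish
  and \<open>z\<close> is fixed by the \<open>n\<close>-th iterate of \<open>f\<close> too.\<close>

lemma cycles_stable:
  assumes f: "f holomorphic_on UNIV" and nz: "(f ^^ n) z0 \<noteq> z0" and "n > 0"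
    and cyc: "\<forall>z\<in>cball 0 \<rho>. (f ^^ n) z = z \<longrightarrow> (\<forall>i. poly Q ((f ^^ i) z) = 0)"
  shows "\<exists>M0\<ge>1. \<forall>M\<ge>M0. \<exists>\<delta>>0. \<exists>R. \<forall>g. (\<forall>z\<in>cball 0 R. cmod (g z - f z) \<le> \<delta> * cmod (poly Q z) ^ M) \<longrightarrow>
      (\<forall>z\<in>cball 0 \<rho>. (g ^^ n) z = z \<longrightarrow> (f ^^ n) z = z \<and> (\<forall>i. poly Q ((f ^^ i) z) = 0))"
proof -
  define h where "h j = (\<lambda>z. poly Q ((f ^^ j) z))" for j
  have h: "h j holomorphic_on UNIV" for j
    using holomorphic_on_compose_gen[OF holomorphic_on_funpow[OF f] poly_entire, of j Q]
    by (simp add: h_def o_def)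
  have "(\<lambda>z. (f ^^ n) z - z) holomorphic_on UNIV"
    by (intro holomorphic_intros holomorphic_on_funpow f)
  then obtain M0 where M0: "M0 \<ge> 1"
    and c: "\<And>M. M \<ge> M0 \<Longrightarrow> \<exists>c>0. \<forall>z\<in>cball 0 \<rho>. c * (\<Sum>j<n. cmod (h j z)) ^ M \<le> cmod ((f ^^ n) z - z)"
    using compact_power_lower_bound[of "\<lambda>z. (f ^^ n) z - z" z0 h \<rho> n] nz cyc h
    by (auto simp: h_def)
  have "\<exists>\<delta>>0. \<exists>R. \<forall>g. (\<forall>z\<in>cball 0 R. cmod (g z - f z) \<le> \<delta> * cmod (poly Q z) ^ M) \<longrightarrow>
      (\<forall>z\<in>cball 0 \<rho>. (g ^^ n) z = z \<longrightarrow> (f ^^ n) z = z \<and> (\<forall>i. poly Q ((f ^^ i) z) = 0))" if MM0: "M \<ge> M0" for M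
  proof -
    define \<Phi> where "\<Phi> z = (\<Sum>j<n. cmod (h j z))" for z
    obtain c where "c > 0" and c: "\<And>z. z \<in> cball 0 \<rho> \<Longrightarrow> c * \<Phi> z ^ M \<le> cmod ((f ^^ n) z - z)"
      using c[OF MM0] by (auto simp: \<Phi>_def)
    have M: "M \<ge> 1" using MM0 M0 by simp
    obtain C R where "C > 0" and CR: "\<And>\<delta> g z. 0 \<le> \<delta> \<Longrightarrow> \<delta> \<le> 1 \<Longrightarrow>
        (\<forall>z\<in>cball 0 R. cmod (g z - f z) \<le> \<delta> * cmod (poly Q z) ^ M) \<Longrightarrow> z \<in> cball 0 \<rho> \<Longrightarrow>
        cmod ((g ^^ n) z - (f ^^ n) z) \<le> C * \<delta> * \<Phi> z ^ M"
      using iterate_perturbation_bound[OF f M, of Q \<rho> n] unfolding \<Phi>_def h_def by blast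
    define \<delta> where "\<delta> = min 1 (c / (2 * C))"
    have \<delta>: "\<delta> > 0" "\<delta> \<le> 1" "C * \<delta> \<le> c / 2"
      using \<open>c > 0\<close> \<open>C > 0\<close> by (auto simp: \<delta>_def min_def field_simps)
    have "(f ^^ n) z = z \<and> (\<forall>i. poly Q ((f ^^ i) z) = 0)"
      if g: "\<forall>z\<in>cball 0 R. cmod (g z - f z) \<le> \<delta> * cmod (poly Q z) ^ M" and z: "z \<in> cball 0 \<rho>" "(g ^^ n) z = z" for g z
    proof -
      have \<Phi>0: "\<Phi> z \<ge> 0" by (simp add: \<Phi>_def sum_nonneg)
      have "cmod (z - (f ^^ n) z) \<le> C * \<delta> * \<Phi> z ^ M" using CR[OF _ \<delta>(2) g z(1)] z \<delta> by simp
      also have "\<dots> \<le> c / 2 * \<Phi> z ^ M" using \<delta> \<Phi>0 by (intro mult_right_mono) auto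
      finally have le: "cmod ((f ^^ n) z - z) \<le> c / 2 * \<Phi> z ^ M" by (simp add: norm_minus_commute)
      then have "c * \<Phi> z ^ M \<le> c / 2 * \<Phi> z ^ M" using c[OF z(1)] by linarith
      then have "\<Phi> z ^ M \<le> 0" using \<open>c > 0\<close> by (simp add: field_simps)
      then have "\<Phi> z ^ M = 0" using zero_le_power[OF \<Phi>0, of M] by linarith
      then have "cmod ((f ^^ n) z - z) \<le> 0" using le by (simp only: mult_zero_right)
      then have "(f ^^ n) z = z" by simp
      then show ?thesis using cyc z by blast
    qed
    then show ?thesis using \<delta> by blast
  qed
  then show ?thesis using M0 by blast
qed

text \<open>An even map takes the same value at 1 and -1, so no positive iterate is injective. This
  provides the point \<open>z0\<close> needed for counting periodic points.\<close>

lemma even_iterate_not_id: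
  assumes "even_map f" "n > 0"
  shows "\<exists>z. (f ^^ n) z \<noteq> z"
proof (rule ccontr)
  assume "\<not> ?thesis"
  then have id: "(f ^^ n) z = z" for z by blast
  obtain k where "n = Suc k" using assms by (cases n) auto
  then have "(f ^^ n) 1 = (f ^^ k) (f 1)" "(f ^^ n) (- 1) = (f ^^ k) (f (- 1))"
    by (simp_all add: funpow_swap1)
  moreover have "f (- 1) = f 1" using assms by (simp add: even_map_def)
  ultimately have "(- 1 :: complex) = 1" using id by metis
  then show False by simp
qed

lemma near_uniform:
  assumes "\<delta> > 0"
  shows "\<exists>d>0. \<forall>\<epsilon>\<le>d. \<forall>f f'. near q R \<epsilon> f Q f' \<longrightarrow> (\<forall>z\<in>cball 0 R. cmod (f' z - f z) < \<delta>)"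
proof -
  obtain b where "b > 0" and b: "\<forall>z\<in>cball 0 R. cmod (poly Q z) \<le> b"
    using entire_bounded_on_cball[OF poly_entire] by blast
  have "cmod (f' z - f z) < \<delta>" if n: "near q R \<epsilon> f Q f'" and \<epsilon>: "\<epsilon> \<le> \<delta> / (2 * b)" and z: "z \<in> cball 0 R" for \<epsilon> f f' z
  proof -
    have "cmod (f' z - f z) \<le> \<epsilon> * cmod (poly Q z)" by (rule near_close[OF n z])
    also have "\<dots> \<le> \<delta> / (2 * b) * b" using b z \<epsilon> \<open>\<delta> > 0\<close> \<open>b > 0\<close> by (intro mult_mono) auto
    also have "\<dots> < \<delta>" using \<open>\<delta> > 0\<close> \<open>b > 0\<close> by simp
    finally show ?thesis .
  qed
  then show ?thesis using \<open>\<delta> > 0\<close> \<open>b > 0\<close> by (intro exI[of _ "\<delta> / (2 * b)"]) auto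
qed

context target_sets
begin

text \<open>Among the states near \<open>f\<close>, one with \<open>card (G f' Q')\<close> maximal cannot be bad.\<close>

lemma exhaust_bad:
  fixes G :: "(complex \<Rightarrow> complex) \<Rightarrow> complex poly \<Rightarrow> complex set" and bad :: "(complex \<Rightarrow> complex) \<Rightarrow> complex poly \<Rightarrow> bool"
  assumes q: "seminorm_on F q" and adm: "admissible f Q" and "\<epsilon> > 0"
    and bound: "\<And>f' K. real_even K \<Longrightarrow> admissible f' (Q * K) \<Longrightarrow> near q R \<epsilon> f Q f' \<Longrightarrow>
      finite (G f' (Q * K)) \<and> card (G f' (Q * K)) \<le> B"
    and ext: "\<And>f' K d. real_even K \<Longrightarrow> admissible f' (Q * K) \<Longrightarrow> near q R \<epsilon> f Q f' \<Longrightarrow> bad f' (Q * K) \<Longrightarrow> d > 0 \<Longrightarrow>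
      \<exists>f'' K'. real_even K' \<and> admissible f'' (Q * K * K') \<and> near q R d f' (Q * K) f'' \<and>
        G f' (Q * K) \<subset> G f'' (Q * K * K')"
  shows "\<exists>f' K. real_even K \<and> admissible f' (Q * K) \<and> near q R \<epsilon> f Q f' \<and> \<not> bad f' (Q * K)"
proof (rule ccontr)
  assume *: "\<not> ?thesis"
  have Q: "real_even Q" using adm by (simp add: admissible_def)
  have "\<exists>f' K. real_even K \<and> admissible f' (Q * K) \<and> near q R \<epsilon> f Q f' \<and> k \<le> card (G f' (Q * K))" for k
  proof (induction k)
    case 0
    show ?case using adm near_refl[OF q \<open>\<epsilon> > 0\<close>] by (intro exI[of _ f] exI[of _ 1]) simp
  next
    case (Suc k)
    then obtain f' K where f': "real_even K" "admissible f' (Q * K)" "near q R \<epsilon> f Q f'" "k \<le> card (G f' (Q * K))"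
      by blast
    then have "bad f' (Q * K)" using * by blast
    obtain d where "d > 0" and d: "\<And>f2. near q R d f' (Q * K) f2 \<Longrightarrow> near q R \<epsilon> f Q f2"
      using near_trans[OF q Q f'(1,3)] by blast
    obtain f'' K' where f'': "real_even K'" "admissible f'' (Q * K * K')" "near q R d f' (Q * K) f''"
      "G f' (Q * K) \<subset> G f'' (Q * K * K')"
      using ext[OF f'(1-3) \<open>bad f' (Q * K)\<close> \<open>d > 0\<close>] by blast
    have K: "real_even (K * K')" "admissible f'' (Q * (K * K'))" "near q R \<epsilon> f Q f''"
      using f' f'' d by (auto intro: real_even_mult simp: mult.assoc)
    have "finite (G f'' (Q * (K * K')))" using bound[OF K] by simp
    then have "card (G f' (Q * K)) < card (G f'' (Q * (K * K')))"
      using f''(4) by (intro psubset_card_mono) (auto simp: mult.assoc)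
    then show ?case using K f'(4) by (intro exI[of _ f''] exI[of _ "K * K'"]) auto
  qed
  from this[of "Suc B"] bound show False by (meson not_less_eq_eq)
qed

text \<open>If \<open>f\<close> is constantly \<open>e\<close>, the roots of \<open>f = e\<close>
  cannot be counted. Adding a nonzero multiple of \<open>Q\<close> repairs this without affecting
  settled points.\<close>

lemma admissible_nonconstant:
  assumes q: "seminorm_on F q" and adm: "admissible f Q" and "\<epsilon> > 0"
  shows "\<exists>f'. admissible f' Q \<and> near q R \<epsilon> f Q f' \<and> (\<exists>z. f' z \<noteq> e)"
proof (cases "\<exists>z. f z \<noteq> e")
  case True
  then show ?thesis using adm near_refl[OF q \<open>\<epsilon> > 0\<close>] by blast
next
  case False
  have Q: "real_even Q" "Q \<noteq> 0" using adm by (auto simp: admissible_def)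
  obtain \<tau> where "\<tau> > 0" and \<tau>: "\<And>t. cmod t < \<tau> \<Longrightarrow> (on_axes 0 \<longrightarrow> Im t = 0) \<Longrightarrow>
      \<exists>H. real_even H \<and> poly H 0 = t \<and> near q R \<epsilon> f Q (\<lambda>z. f z + poly (Q * (1 * H)) z)"
    using interp_fixed[OF q Q(1) real_even_1 \<open>\<epsilon> > 0\<close>, of 0 R f] by blast
  obtain H where H: "poly H 0 = of_real (\<tau> / 2)" "near q R \<epsilon> f Q (\<lambda>z. f z + poly (Q * (1 * H)) z)"
    using \<tau>[of "of_real (\<tau> / 2)"] \<open>\<tau> > 0\<close> by auto
  have "Q * (1 * H) \<noteq> 0" using H(1) \<open>\<tau> > 0\<close> Q by auto
  then obtain z where "poly (Q * (1 * H)) z \<noteq> 0" using poly_all_0_iff_0 by blast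
  then have "f z + poly (Q * (1 * H)) z \<noteq> e" using False by simp
  moreover have "admissible (\<lambda>z. f z + poly (Q * (1 * H)) z) (Q * 1\<^sup>2)"
    by (rule admissible_extend[OF adm H(2)]) (auto simp del: poly_mult)
  ultimately show ?thesis using H(2) by auto
qed

lemma admissible_roots:
  assumes q: "seminorm_on F q" and adm: "admissible f Q" and e: "e \<in> E" and "\<epsilon> > 0"
  shows "\<exists>f' K. real_even K \<and> admissible f' (Q * K) \<and> near q R \<epsilon> f Q f' \<and>
    (\<forall>z\<in>cball 0 \<rho>. f' z = e \<longrightarrow> poly (Q * K) z = 0)"
proof -
  have Q: "real_even Q" using adm by (simp add: admissible_def)
  obtain f0 z0 where f0: "admissible f0 Q" "near q R \<epsilon> f Q f0" "f0 z0 \<noteq> e"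
    using admissible_nonconstant[OF q adm \<open>\<epsilon> > 0\<close>] by blast
  obtain d where "d > 0" and d: "\<And>f2. near q R d f0 (Q * 1) f2 \<Longrightarrow> near q R \<epsilon> f Q f2"
    using near_trans[OF q Q real_even_1 f0(2)] by blast
  have f0F: "f0 \<in> F" using f0 by (simp add: admissible_def)
  have "(\<lambda>z. f0 z - e) holomorphic_on UNIV" by (intro holomorphic_intros holo[OF f0F])
  moreover have "f0 z0 - e \<noteq> 0" using f0 by simp
  ultimately obtain B R0 \<delta> where "\<delta> > 0"
    and B: "\<And>G. G holomorphic_on UNIV \<Longrightarrow> (\<forall>z\<in>cball 0 R0. cmod (G z - (f0 z - e)) < \<delta>) \<Longrightarrow>
           finite {z \<in> cball 0 (\<rho> + 1). G z = 0} \<and> card {z \<in> cball 0 (\<rho> + 1). G z = 0} \<le> B"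
    using card_zeros_locally_bounded[of "\<lambda>z. f0 z - e" z0 "\<rho> + 1"] by blast
  define R1 where "R1 = max R R0"
  obtain d1 where "d1 > 0" and d1: "\<And>f'. near q R1 (min d d1) f0 Q f' \<Longrightarrow> (\<forall>z\<in>cball 0 R1. cmod (f' z - f0 z) < \<delta>)"
    using near_uniform[OF \<open>\<delta> > 0\<close>, of q R1 Q] by (metis min.cobounded2)
  \<comment> \<open>Unsettled roots are sought in radius \<rho> but settled ones counted in radius
    \<open>\<rho> + 1\<close>, since a root moves by less than 1 when it is settled.\<close>
  define G where "G = (\<lambda>(f' :: complex \<Rightarrow> complex) Q'. {z \<in> cball 0 (\<rho> + 1). f' z = e \<and> poly Q' z = 0})"
  define bad where "bad = (\<lambda>(f' :: complex \<Rightarrow> complex) Q'. \<exists>z\<in>cball 0 \<rho>. f' z = e \<and> poly Q' z \<noteq> 0)"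
  have "\<exists>f' K. real_even K \<and> admissible f' (Q * K) \<and> near q R1 (min d d1) f0 Q f' \<and> \<not> bad f' (Q * K)"
  proof (rule exhaust_bad[OF q f0(1), where G = G and B = B])
    show "min d d1 > 0" using \<open>d > 0\<close> \<open>d1 > 0\<close> by simp
    fix f' K
    assume f': "real_even K" "admissible f' (Q * K)" "near q R1 (min d d1) f0 Q f'"
    have f'F: "f' \<in> F" using f' by (simp add: admissible_def)
    have "(\<lambda>z. f' z - e) holomorphic_on UNIV" by (intro holomorphic_intros holo[OF f'F])
    then have *: "finite {z \<in> cball 0 (\<rho> + 1). f' z - e = 0} \<and> card {z \<in> cball 0 (\<rho> + 1). f' z - e = 0} \<le> B"
      using d1[OF f'(3)] by (intro B) (auto simp: R1_def)
    moreover have "G f' (Q * K) \<subseteq> {z \<in> cball 0 (\<rho> + 1). f' z - e = 0}" by (auto simp: G_def)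
    ultimately show "finite (G f' (Q * K)) \<and> card (G f' (Q * K)) \<le> B"
      by (meson card_mono finite_subset order_trans)
    fix d' :: real
    assume "bad f' (Q * K)" "d' > 0"
    then obtain z where z: "z \<in> cball 0 \<rho>" "f' z = e" "poly (Q * K) z \<noteq> 0" unfolding bad_def by blast
    obtain f'' K' w where f'': "real_even K'" "admissible f'' (Q * K * K')" "near q R1 d' f' (Q * K) f''"
      and w: "cmod (w - z) < 1" "f'' w = e" "poly (Q * K * K') w = 0" "poly (Q * K) w \<noteq> 0"
      using admissible_move_root[OF f'(2) e z(2,3) q \<open>d' > 0\<close>] by blast
    have "cmod w \<le> \<rho> + 1" using z(1) w(1) norm_triangle_ineq[of z "w - z"] by simp
    then have "w \<in> G f'' (Q * K * K')" "w \<notin> G f' (Q * K)" using w by (auto simp: G_def)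
    moreover have "G f' (Q * K) \<subseteq> G f'' (Q * K * K')"
      using near_value[OF f''(3)] by (force simp: G_def)
    ultimately show "\<exists>f'' K'. real_even K' \<and> admissible f'' (Q * K * K') \<and> near q R1 d' f' (Q * K) f'' \<and>
        G f' (Q * K) \<subset> G f'' (Q * K * K')"
      using f'' by blast
  qed
  then obtain f' K where f': "real_even K" "admissible f' (Q * K)" "near q R1 (min d d1) f0 Q f'" "\<not> bad f' (Q * K)"
    by blast
  have "near q R d f0 (Q * 1) f'" using near_mono[OF f'(3)] by (simp add: R1_def)
  then show ?thesis using f' d unfolding bad_def by blast
qed

lemma admissible_cycles:
  assumes q: "seminorm_on F q" and adm: "admissible f Q" and "n > 0" and "\<epsilon> > 0"
  shows "\<exists>f' K. real_even K \<and> admissible f' (Q * K) \<and> near q R \<epsilon> f Q f' \<and>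
    (\<forall>z\<in>cball 0 \<rho>. (f' ^^ n) z = z \<longrightarrow> (\<forall>i. poly (Q * K) ((f' ^^ i) z) = 0))"
proof -
  have Q: "real_even Q" and f: "f \<in> F" using adm by (auto simp: admissible_def)
  obtain z0 where z0: "(f ^^ n) z0 \<noteq> z0" using even_iterate_not_id[OF even[OF f] \<open>n > 0\<close>] by blast
  have "(\<lambda>z. (f ^^ n) z - z) holomorphic_on UNIV"
    by (intro holomorphic_intros holomorphic_on_funpow holo[OF f])
  moreover have "(f ^^ n) z0 - z0 \<noteq> 0" using z0 by simp
  ultimately obtain B R0 \<delta> where "\<delta> > 0"
    and B: "\<And>G. G holomorphic_on UNIV \<Longrightarrow> (\<forall>z\<in>cball 0 R0. cmod (G z - ((f ^^ n) z - z)) < \<delta>) \<Longrightarrow>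
           finite {z \<in> cball 0 (\<rho> + 1). G z = 0} \<and> card {z \<in> cball 0 (\<rho> + 1). G z = 0} \<le> B"
    using card_zeros_locally_bounded[of "\<lambda>z. (f ^^ n) z - z" z0 "\<rho> + 1"] by blast
  \<comment> \<open>With the constant polynomial 1 and exponent 1 the bound is plain continuity of
    iteration: the sum becomes \<open>n\<close>.\<close>
  obtain C R2 where "C > 0" and C0: "\<forall>\<delta> g. 0 \<le> \<delta> \<and> \<delta> \<le> 1 \<and>
      (\<forall>z\<in>cball 0 R2. cmod (g z - f z) \<le> \<delta> * cmod (poly 1 z) ^ 1) \<longrightarrow>
      (\<forall>z\<in>cball 0 R0. cmod ((g ^^ n) z - (f ^^ n) z) \<le> C * \<delta> * (\<Sum>j<n. cmod (poly 1 ((f ^^ j) z))) ^ 1)"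
    using iterate_perturbation_bound[OF holo[OF f] le_refl[of "1::nat"], of 1 R0 n] by blast
  have C: "cmod ((g ^^ n) z - (f ^^ n) z) \<le> C * \<delta> * real n"
    if "0 \<le> \<delta>" "\<delta> \<le> 1" "\<forall>z\<in>cball 0 R2. cmod (g z - f z) \<le> \<delta>" "z \<in> cball 0 R0" for \<delta> g z
    using C0[rule_format, of \<delta> g z] that by simp
  define \<delta>' where "\<delta>' = min 1 (\<delta> / (2 * C * real n))"
  have \<delta>': "\<delta>' > 0" "\<delta>' \<le> 1" "C * \<delta>' * real n < \<delta>"
  proof -
    show "\<delta>' > 0" "\<delta>' \<le> 1" using \<open>\<delta> > 0\<close> \<open>C > 0\<close> \<open>n > 0\<close> by (auto simp: \<delta>'_def)
    have "C * \<delta>' * real n \<le> C * (\<delta> / (2 * C * real n)) * real n"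
      using \<open>C > 0\<close> by (intro mult_right_mono mult_left_mono) (auto simp: \<delta>'_def)
    also have "\<dots> < \<delta>" using \<open>\<delta> > 0\<close> \<open>C > 0\<close> \<open>n > 0\<close> by simp
    finally show "C * \<delta>' * real n < \<delta>" .
  qed
  define R1 where "R1 = max R R2"
  obtain d1 where "d1 > 0" and d1: "\<And>f'. near q R1 (min \<epsilon> d1) f Q f' \<Longrightarrow> (\<forall>z\<in>cball 0 R1. cmod (f' z - f z) < \<delta>')"
    using near_uniform[OF \<open>\<delta>' > 0\<close>, of q R1 Q] by (metis min.cobounded2)
  define G where "G = (\<lambda>(f' :: complex \<Rightarrow> complex) Q'. {z \<in> cball 0 (\<rho> + 1). (f' ^^ n) z = z \<and> (\<forall>i. poly Q' ((f' ^^ i) z) = 0)})"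
  define bad where "bad = (\<lambda>(f' :: complex \<Rightarrow> complex) Q'. \<exists>z\<in>cball 0 \<rho>. (f' ^^ n) z = z \<and> (\<exists>i. poly Q' ((f' ^^ i) z) \<noteq> 0))"
  have "\<exists>f' K. real_even K \<and> admissible f' (Q * K) \<and> near q R1 (min \<epsilon> d1) f Q f' \<and> \<not> bad f' (Q * K)"
  proof (rule exhaust_bad[OF q adm, where G = G and B = B])
    show "min \<epsilon> d1 > 0" using \<open>\<epsilon> > 0\<close> \<open>d1 > 0\<close> by simp
    fix f' K
    assume f': "real_even K" "admissible f' (Q * K)" "near q R1 (min \<epsilon> d1) f Q f'"
    have f'F: "f' \<in> F" using f' by (simp add: admissible_def)
    have "(\<lambda>z. (f' ^^ n) z - z) holomorphic_on UNIV"
      by (intro holomorphic_intros holomorphic_on_funpow holo[OF f'F])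
    moreover have "cmod ((f' ^^ n) z - (f ^^ n) z) < \<delta>" if "z \<in> cball 0 R0" for z
    proof -
      have "\<forall>z\<in>cball 0 R2. cmod (f' z - f z) \<le> \<delta>'"
        using d1[OF f'(3)] by (auto simp: R1_def intro: less_imp_le)
      from C[OF _ \<delta>'(2) this that] show ?thesis using \<delta>' by simp
    qed
    ultimately have *: "finite {z \<in> cball 0 (\<rho> + 1). (f' ^^ n) z - z = 0} \<and> card {z \<in> cball 0 (\<rho> + 1). (f' ^^ n) z - z = 0} \<le> B"
      by (intro B) auto
    moreover have "G f' (Q * K) \<subseteq> {z \<in> cball 0 (\<rho> + 1). (f' ^^ n) z - z = 0}" by (auto simp: G_def)
    ultimately show "finite (G f' (Q * K)) \<and> card (G f' (Q * K)) \<le> B"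
      by (meson card_mono finite_subset order_trans)
    fix d' :: real
    assume "bad f' (Q * K)" "d' > 0"
    then obtain z i where z: "z \<in> cball 0 \<rho>" "(f' ^^ n) z = z" "poly (Q * K) ((f' ^^ i) z) \<noteq> 0" unfolding bad_def by blast
    obtain f'' K' w where f'': "real_even K'" "admissible f'' (Q * K * K')" "near q R1 d' f' (Q * K) f''"
      and w: "cmod (w - z) < 1" "(f'' ^^ n) w = w" "\<forall>i. poly (Q * K * K') ((f'' ^^ i) w) = 0" "poly (Q * K) w \<noteq> 0"
      using admissible_move_cycle[OF f'(2) z(2) \<open>n > 0\<close> z(3) q \<open>d' > 0\<close>] by blast
    have "cmod w \<le> \<rho> + 1" using z(1) w(1) norm_triangle_ineq[of z "w - z"] by simp
    then have "w \<in> G f'' (Q * K * K')" using w by (auto simp: G_def)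
    moreover have "w \<notin> G f' (Q * K)"
    proof
      assume "w \<in> G f' (Q * K)"
      then have "poly (Q * K) ((f' ^^ 0) w) = 0" unfolding G_def by blast
      then show False using w(4) by simp
    qed
    moreover have "G f' (Q * K) \<subseteq> G f'' (Q * K * K')"
    proof
      fix x assume x: "x \<in> G f' (Q * K)"
      then have zero: "poly (Q * K) ((f' ^^ i) x) = 0" for i unfolding G_def by blast
      have eq: "(f'' ^^ i) x = (f' ^^ i) x" for i
      proof (induction i)
        case (Suc i)
        then show ?case using near_value[OF f''(3) zero[of i]] by simp
      qed simp
      then show "x \<in> G f'' (Q * K * K')" using x zero unfolding G_def by auto
    qed
    ultimately show "\<exists>f'' K'. real_even K' \<and> admissible f'' (Q * K * K') \<and> near q R1 d' f' (Q * K) f'' \<and>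
        G f' (Q * K) \<subset> G f'' (Q * K * K')"
      using f'' by blast
  qed
  then obtain f' K where f': "real_even K" "admissible f' (Q * K)" "near q R1 (min \<epsilon> d1) f Q f'" "\<not> bad f' (Q * K)"
    by blast
  have "near q R \<epsilon> f Q f'" using near_mono[OF f'(3)] by (simp add: R1_def)
  then show ?thesis using f' unfolding bad_def by blast
qed


section \<open>Tubes and the fulfilment of one requirement\<close>

lemma admissible_power:
  assumes adm: "admissible f Q" and "M \<ge> 1"
  shows "admissible f (Q ^ M)"
proof -
  obtain k where k: "M = Suc k" using assms by (cases M) auto
  have zero: "poly (Q ^ M) a = 0 \<longleftrightarrow> poly Q a = 0" for a using k by auto
  have "poly (pderiv (Q ^ M)) a = 0" if "poly Q a = 0" for a
    using adm that by (simp add: k pderiv_mult admissible_def)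
  then show ?thesis using adm unfolding admissible_def zero by (auto intro: real_even_power)
qed

text \<open>A bounded fragment of the goal. Countably many triples \<open>(e, \<rho>, n)\<close>
  exhaust all requirements.\<close>

definition fulfils :: "complex \<Rightarrow> real \<Rightarrow> nat \<Rightarrow> (complex \<Rightarrow> complex) \<Rightarrow> bool" where
  "fulfils e \<rho> n g \<longleftrightarrow> g e \<in> E \<and> (\<forall>z\<in>cball 0 \<rho>. g z = e \<longrightarrow> z \<in> E) \<and>
     (\<forall>z\<in>cball 0 \<rho>. exact_period g n z \<longrightarrow> z \<in> E \<and> multiplier g n z \<in> \<Lambda>)"

text \<open>A non-strict pointwise condition, unlike \<open>near\<close>, so that it passes to the
  limit.\<close>

definition in_tube :: "(complex \<Rightarrow> complex) \<Rightarrow> complex poly \<Rightarrow> real \<Rightarrow> real \<Rightarrow> (complex \<Rightarrow> complex) \<Rightarrow> bool" where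
  "in_tube f Q R \<delta> g \<longleftrightarrow> (\<forall>z\<in>cball 0 R. cmod (g z - f z) \<le> \<delta> * cmod (poly Q z))"

lemma roots_stable_admissible:
  assumes adm: "admissible f Q" and "\<rho> > 0" and roots: "\<forall>z\<in>cball 0 \<rho>. f z = e \<longrightarrow> poly Q z = 0"
  shows "\<exists>M0\<ge>1. \<forall>M\<ge>M0. \<exists>\<delta>>0. \<forall>g. in_tube f (Q ^ M) \<rho> \<delta> g \<longrightarrow> (\<forall>z\<in>cball 0 \<rho>. g z = e \<longrightarrow> poly Q z = 0)"
proof -
  have f: "f \<in> F" and "Q \<noteq> 0" using adm by (auto simp: admissible_def)
  have "infinite (cball (0::complex) \<rho>)"
    using uncountable_infinite[OF uncountable_cball[OF \<open>\<rho> > 0\<close>]] .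
  then have "\<not> cball 0 \<rho> \<subseteq> {z. poly Q z = 0}"
    using poly_roots_finite[OF \<open>Q \<noteq> 0\<close>] finite_subset by blast
  then obtain z0 where "f z0 \<noteq> e" using roots by blast
  then show ?thesis
    using roots_stable[OF holo[OF f] _ roots] unfolding in_tube_def poly_power norm_power by blast
qed

text \<open>The order is: the value at \<open>e\<close>, the roots of \<open>f = e\<close>, the
  cycles. Before the cycles are moved, \<open>Q2\<close> is raised to a power \<open>M\<close>, so
  that the move stays in a tube which preserves the settled roots. A last power makes roots and
  cycles stable together.\<close>

lemma admissible_step:
  assumes q: "seminorm_on F q" and adm: "admissible f Q" and e: "e \<in> E" and "\<epsilon> > 0" "\<rho> > 0" "n > 0"
  shows "\<exists>f' K R' \<delta>. real_even K \<and> admissible f' (Q * K) \<and> near q R \<epsilon> f Q f' \<and> \<delta> > 0 \<and>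
    (\<forall>g. g holomorphic_on UNIV \<and> in_tube f' (Q * K) R' \<delta> g \<longrightarrow> fulfils e \<rho> n g)"
proof -
  have Q: "real_even Q" using adm by (simp add: admissible_def)
  obtain f1 K1 where 1: "real_even K1" "admissible f1 (Q * K1)" "near q R \<epsilon> f Q f1" "poly (Q * K1) e = 0"
    using admissible_add_point[OF adm e q \<open>\<epsilon> > 0\<close>] by blast
  obtain d1 where "d1 > 0" and d1: "\<And>f2. near q R d1 f1 (Q * K1) f2 \<Longrightarrow> near q R \<epsilon> f Q f2"
    using near_trans[OF q Q 1(1,3)] by blast
  obtain f2 K2 where 2: "real_even K2" "admissible f2 (Q * K1 * K2)" "near q R d1 f1 (Q * K1) f2"
    and roots2: "\<forall>z\<in>cball 0 \<rho>. f2 z = e \<longrightarrow> poly (Q * K1 * K2) z = 0"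
    using admissible_roots[OF q 1(2) e \<open>d1 > 0\<close>] by blast
  define Q2 where "Q2 = Q * K1 * K2"
  have adm2: "admissible f2 Q2" and Q2: "real_even Q2" using 2 by (auto simp: Q2_def admissible_def)
  obtain M \<delta>2 where "M \<ge> 1" "\<delta>2 > 0"
    and \<delta>2: "\<And>g. in_tube f2 (Q2 ^ M) \<rho> \<delta>2 g \<Longrightarrow> (\<forall>z\<in>cball 0 \<rho>. g z = e \<longrightarrow> poly Q2 z = 0)"
    using roots_stable_admissible[OF adm2 \<open>\<rho> > 0\<close>, of e] roots2 unfolding Q2_def by blast
  \<comment> \<open>Chosen so that \<open>Q * (K1 * L)\<close> is exactly \<open>Q2 ^ M\<close>, as
    the distance to the original \<open>f\<close> is measured relative to \<open>Q\<close>.\<close>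
  define L where "L = K2 * Q2 ^ (M - 1)"
  have L: "real_even L" using 2 Q2 by (auto simp: L_def intro: real_even_intros)
  have QL: "Q * (K1 * L) = Q2 ^ M"
    using \<open>M \<ge> 1\<close> by (cases M) (simp_all add: L_def Q2_def mult_ac)
  have n2: "near q R \<epsilon> f Q f2" using d1 2 by blast
  obtain d2 where "d2 > 0" and d2: "\<And>f3. near q R d2 f2 (Q * (K1 * L)) f3 \<Longrightarrow> near q R \<epsilon> f Q f3"
    using near_trans[OF q Q real_even_mult[OF 1(1) L] n2] by blast
  have "min d2 \<delta>2 > 0" using \<open>d2 > 0\<close> \<open>\<delta>2 > 0\<close> by simp
  then obtain f3 K3 where 3: "real_even K3" "admissible f3 (Q2 ^ M * K3)" "near q (max R \<rho>) (min d2 \<delta>2) f2 (Q2 ^ M) f3"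
    and cyc3: "\<forall>z\<in>cball 0 \<rho>. (f3 ^^ n) z = z \<longrightarrow> (\<forall>i. poly (Q2 ^ M * K3) ((f3 ^^ i) z) = 0)"
    using admissible_cycles[OF q admissible_power[OF adm2 \<open>M \<ge> 1\<close>] \<open>n > 0\<close>] by blast
  define Q3 where "Q3 = Q2 ^ M * K3"
  have adm3: "admissible f3 Q3" and Q3: "real_even Q3" "Q3 \<noteq> 0" and f3: "f3 \<in> F"
    using 3 by (auto simp: Q3_def admissible_def)
  have n3: "near q R \<epsilon> f Q f3"
    using near_mono[OF 3(3), of d2 R] by (intro d2) (simp add: QL)
  have "in_tube f2 (Q2 ^ M) \<rho> \<delta>2 f3"
    unfolding in_tube_def using near_close[OF near_mono[OF 3(3), of \<delta>2 \<rho>]] by auto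
  then have roots3: "\<forall>z\<in>cball 0 \<rho>. f3 z = e \<longrightarrow> poly Q3 z = 0"
    using \<delta>2[of f3] \<open>M \<ge> 1\<close> by (auto simp: Q3_def)
  obtain Ma where "Ma \<ge> 1" and Ma: "\<And>M. M \<ge> Ma \<Longrightarrow> \<exists>\<delta>>0. \<forall>g. in_tube f3 (Q3 ^ M) \<rho> \<delta> g \<longrightarrow> (\<forall>z\<in>cball 0 \<rho>. g z = e \<longrightarrow> poly Q3 z = 0)"
    using roots_stable_admissible[OF adm3 \<open>\<rho> > 0\<close> roots3] by blast
  obtain z0 where z0: "(f3 ^^ n) z0 \<noteq> z0" using even_iterate_not_id[OF even[OF f3] \<open>n > 0\<close>] by blast
  obtain Mb where "Mb \<ge> 1" and Mb: "\<And>M. M \<ge> Mb \<Longrightarrow> \<exists>\<delta>>0. \<exists>R. \<forall>g. in_tube f3 (Q3 ^ M) R \<delta> g \<longrightarrow>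
      (\<forall>z\<in>cball 0 \<rho>. (g ^^ n) z = z \<longrightarrow> (f3 ^^ n) z = z \<and> (\<forall>i. poly Q3 ((f3 ^^ i) z) = 0))"
    using cycles_stable[OF holo[OF f3] z0 \<open>n > 0\<close>, of \<rho> Q3] cyc3
    unfolding in_tube_def poly_power norm_power Q3_def by blast
  \<comment> \<open>One exponent above both thresholds; this is why the stability lemmas allow every
    \<open>M \<ge> M0\<close>.\<close>
  define N where "N = max Ma Mb"
  have "N \<ge> 1" using \<open>Ma \<ge> 1\<close> by (simp add: N_def)
  obtain \<delta>a where "\<delta>a > 0" and \<delta>a: "\<And>g. in_tube f3 (Q3 ^ N) \<rho> \<delta>a g \<Longrightarrow> (\<forall>z\<in>cball 0 \<rho>. g z = e \<longrightarrow> poly Q3 z = 0)"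
    using Ma[of N] by (auto simp: N_def)
  obtain \<delta>b Rb where "\<delta>b > 0" and \<delta>b: "\<And>g. in_tube f3 (Q3 ^ N) Rb \<delta>b g \<Longrightarrow>
      (\<forall>z\<in>cball 0 \<rho>. (g ^^ n) z = z \<longrightarrow> (f3 ^^ n) z = z \<and> (\<forall>i. poly Q3 ((f3 ^^ i) z) = 0))"
    using Mb[of N] by (auto simp: N_def)
  define K where "K = K1 * L * K3 * Q3 ^ (N - 1)"
  have K: "real_even K" using 1 L 3 Q3 by (auto simp: K_def intro!: real_even_intros)
  have "Q * K = Q3 * Q3 ^ (N - 1)"
    unfolding K_def Q3_def QL[symmetric] by (simp only: mult.assoc)
  also have "\<dots> = Q3 ^ N" using \<open>N \<ge> 1\<close> by (cases N) simp_all
  finally have QK: "Q * K = Q3 ^ N" .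
  have admN: "admissible f3 (Q3 ^ N)" by (rule admissible_power[OF adm3 \<open>N \<ge> 1\<close>])
  have zN: "poly (Q3 ^ N) a = 0 \<longleftrightarrow> poly Q3 a = 0" for a using \<open>N \<ge> 1\<close> by auto
  define Z where "Z = {a. poly Q3 a = 0}"
  have "finite Z" using poly_roots_finite[OF Q3(2)] by (simp add: Z_def)
  \<comment> \<open>All zeros of \<open>Q3\<close> must lie strictly inside, so that values and
    derivatives are also fixed at \<open>e\<close> and at cycle points outside
    \<open>cball 0 \<rho>\<close>.\<close>
  define R' where "R' = Max {\<rho>, Rb, (\<Sum>a\<in>Z. cmod a) + 1}"
  define \<delta> where "\<delta> = min \<delta>a \<delta>b"
  have R': "\<rho> \<le> R'" "Rb \<le> R'" "(\<Sum>a\<in>Z. cmod a) + 1 \<le> R'" by (auto simp: R'_def)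
  have "fulfils e \<rho> n g" if g: "g holomorphic_on UNIV" "in_tube f3 (Q3 ^ N) R' \<delta> g" for g
  proof -
    have val: "g a = f3 a" "deriv g a = deriv f3 a" if a: "poly Q3 a = 0" for a
    proof -
      have "cmod a < R'" using member_le_sum[of a Z cmod] \<open>finite Z\<close> a R' by (simp add: Z_def)
      moreover have "poly (pderiv (Q3 ^ N)) a = 0" using admN a zN by (auto simp: admissible_def)
      ultimately show "g a = f3 a" "deriv g a = deriv f3 a"
        using deriv_eq_of_tangent[OF holo[OF f3] g(1), of "Q3 ^ N" a R' \<delta>] a zN g(2)
        by (auto simp: in_tube_def)
    qed
    have mono: "in_tube f3 (Q3 ^ N) r d g" if "r \<le> R'" "\<delta> \<le> d" for r d
      using g(2) that unfolding in_tube_def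
      by (meson cball_subset_cball_iff mult_right_mono norm_ge_zero order_trans subset_cball subsetD)
    have inE: "a \<in> E \<longleftrightarrow> f3 a \<in> E" if "poly Q3 a = 0" for a
      using adm3 that by (auto simp: admissible_def)
    have "poly Q3 e = 0" using 1(4) \<open>M \<ge> 1\<close> by (auto simp: Q3_def Q2_def)
    then have "g e \<in> E" using val(1) inE e by simp
    moreover have "z \<in> E" if z: "z \<in> cball 0 \<rho>" "g z = e" for z
    proof -
      have "poly Q3 z = 0" using \<delta>a[OF mono[OF R'(1)]] z by (auto simp: \<delta>_def)
      then show ?thesis using val(1) inE z e by metis
    qed
    moreover have "z \<in> E \<and> multiplier g n z \<in> \<Lambda>" if z: "z \<in> cball 0 \<rho>" "exact_period g n z" for z
    proof -
      have "(g ^^ n) z = z" using z by (simp add: exact_period_def)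
      then have zero: "poly Q3 ((f3 ^^ i) z) = 0" for i
        using \<delta>b[OF mono[OF R'(2)]] z(1) by (auto simp: \<delta>_def)
      have eq: "(g ^^ i) z = (f3 ^^ i) z" for i
      proof (induction i)
        case (Suc i)
        then show ?case using val(1)[OF zero[of i]] by simp
      qed simp
      have "exact_period f3 n z" using z(2) by (simp add: exact_period_def eq)
      moreover have "multiplier g n z = multiplier f3 n z"
        unfolding multiplier_def deriv_funpow[OF g(1)] deriv_funpow[OF holo[OF f3]]
        using val(2)[OF zero] by (intro prod.cong) (auto simp: eq)
      ultimately show ?thesis using adm3 zero unfolding admissible_def by metis
    qed
    ultimately show ?thesis by (simp add: fulfils_def)
  qed
  moreover have "\<delta> > 0" using \<open>\<delta>a > 0\<close> \<open>\<delta>b > 0\<close> by (simp add: \<delta>_def)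
  moreover have "admissible f3 (Q * K)" using admN QK by simp
  ultimately show ?thesis
    using K n3 by (intro exI[of _ f3] exI[of _ K] exI[of _ R'] exI[of _ \<delta>]) (auto simp: QK)
qed

text \<open>The tubes are nested: half of \<delta> pays for the shift of the centre, half for the
  width of the new tube, where \<open>K\<close> is bounded on the old disc.\<close>

lemma next_state:
  assumes q: "seminorm_on F q" and adm: "admissible f Q" and e: "e \<in> E" and pos: "\<epsilon> > 0" "\<rho> > 0" "n > 0" "\<delta> > 0"
  shows "\<exists>f' Q' R' \<delta>'. admissible f' Q' \<and> \<delta>' > 0 \<and> q (\<lambda>z. f' z - f z) < \<epsilon> \<and>
    (\<forall>g. in_tube f' Q' R' \<delta>' g \<longrightarrow> in_tube f Q R \<delta> g) \<and>
    (\<forall>g. g holomorphic_on UNIV \<and> in_tube f' Q' R' \<delta>' g \<longrightarrow> fulfils e \<rho> n g)"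
proof -
  have "min \<epsilon> (\<delta> / 2) > 0" using pos by simp
  then obtain f' K R0 \<delta>0 where f': "real_even K" "admissible f' (Q * K)" "near q R (min \<epsilon> (\<delta> / 2)) f Q f'"
    and "\<delta>0 > 0" and ful: "\<And>g. g holomorphic_on UNIV \<Longrightarrow> in_tube f' (Q * K) R0 \<delta>0 g \<Longrightarrow> fulfils e \<rho> n g"
    using admissible_step[OF q adm e _ pos(2,3)] by blast
  obtain b where "b > 0" and b: "\<forall>z\<in>cball 0 R. cmod (poly K z) \<le> b"
    using entire_bounded_on_cball[OF poly_entire] by blast
  define \<delta>' R' where "\<delta>' = min \<delta>0 (\<delta> / (2 * b))" and "R' = max R R0"
  have "in_tube f Q R \<delta> g" if g: "in_tube f' (Q * K) R' \<delta>' g" for g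
    unfolding in_tube_def
  proof
    fix z :: complex assume z: "z \<in> cball 0 R"
    have "cmod (g z - f' z) \<le> \<delta>' * (cmod (poly Q z) * cmod (poly K z))"
      using g z unfolding in_tube_def by (auto simp: R'_def norm_mult)
    also have "\<dots> \<le> \<delta> / (2 * b) * (cmod (poly Q z) * b)"
      using b z pos \<open>b > 0\<close> \<open>\<delta>0 > 0\<close> by (intro mult_mono mult_left_mono) (auto simp: \<delta>'_def)
    also have "\<dots> = \<delta> / 2 * cmod (poly Q z)" using \<open>b > 0\<close> by simp
    finally have 1: "cmod (g z - f' z) \<le> \<delta> / 2 * cmod (poly Q z)" .
    have "cmod (f' z - f z) \<le> \<delta> / 2 * cmod (poly Q z)"
      using near_close[OF near_mono[OF f'(3), of "\<delta> / 2" R] z] by simp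
    then show "cmod (g z - f z) \<le> \<delta> * cmod (poly Q z)"
      using 1 norm_triangle_ineq[of "g z - f' z" "f' z - f z"] by simp
  qed
  moreover have "fulfils e \<rho> n g" if "g holomorphic_on UNIV" "in_tube f' (Q * K) R' \<delta>' g" for g
  proof (rule ful[OF that(1)])
    have "\<delta>' * cmod (poly (Q * K) z) \<le> \<delta>0 * cmod (poly (Q * K) z)" for z
      by (intro mult_right_mono) (auto simp: \<delta>'_def)
    moreover have "cmod (g z - f' z) \<le> \<delta>' * cmod (poly (Q * K) z)" if "z \<in> cball 0 R0" for z
      using that \<open>in_tube f' (Q * K) R' \<delta>' g\<close> by (auto simp: in_tube_def R'_def)
    ultimately show "in_tube f' (Q * K) R0 \<delta>0 g"
      unfolding in_tube_def using order_trans by blast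
  qed
  moreover have "q (\<lambda>z. f' z - f z) < \<epsilon>"
  proof -
    obtain H where "f' = (\<lambda>z. f z + poly (Q * H) z)" "q (poly (Q * H)) < \<epsilon>"
      using near_mono[OF f'(3), of \<epsilon> R] unfolding near_def by auto
    then show ?thesis by (simp del: poly_mult)
  qed
  moreover have "\<delta>' > 0" using \<open>\<delta>0 > 0\<close> \<open>b > 0\<close> pos by (simp add: \<delta>'_def)
  ultimately show ?thesis using f'(2) by blast
qed

lemma add_mem: "f \<in> F \<Longrightarrow> g \<in> F \<Longrightarrow> (\<lambda>z. f z + g z) \<in> F"
  using space unfolding real_function_space_def by blast

lemma scale_mem: "f \<in> F \<Longrightarrow> (\<lambda>z. complex_of_real c * f z) \<in> F"
  using space unfolding real_function_space_def by blast

text \<open>Adding a small real constant moves the value at 0 to a nonzero \<open>v\<close> that is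
  in \<open>E\<close> exactly when 0 is. As \<open>z^2\<close> vanishes only at 0, no cycle lies in
  its zero set.\<close>

lemma initial_state:
  assumes q: "seminorm_on F q" and f: "f \<in> F" and "\<epsilon> > 0"
  shows "\<exists>f'. admissible f' [:0, 0, 1:] \<and> q (\<lambda>z. f' z - f z) < \<epsilon>"
proof -
  define \<tau> where "\<tau> = \<epsilon> / (q (poly 1) + 1)"
  have q1: "q (poly 1) \<ge> 0" using seminorm_nonneg[OF q real_even_1] .
  then have "\<tau> > 0" using \<open>\<epsilon> > 0\<close> by (simp add: \<tau>_def)
  have f0: "Im (f 0) = 0" using real_even_value_real[OF real[OF f] even[OF f]] by (simp add: on_axes_def)
  have "\<exists>v. (v \<in> E \<longleftrightarrow> 0 \<in> E) \<and> v \<noteq> 0 \<and> cmod (v - f 0) < \<tau> \<and> Im v = 0"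
  proof (cases "0 \<in> E")
    case True
    then show ?thesis using E_near_real[of "{0}" \<tau> "f 0"] \<open>\<tau> > 0\<close> f0 by auto
  next
    case False
    \<comment> \<open>If 0 is not in \<open>E\<close>, \<open>v\<close> must avoid \<open>E\<close>;
      a real segment is uncountable and \<open>E\<close> is not.\<close>
    define A where "A = (\<lambda>t. f 0 + complex_of_real t) ` {0<..<\<tau>}"
    have inj: "inj_on (\<lambda>t. f 0 + complex_of_real t) {0<..<\<tau>}" by (auto simp: inj_on_def)
    have "uncountable A"
    proof
      assume "countable A"
      then have "countable {0<..<\<tau>}" unfolding A_def by (rule countable_image_inj_on[OF _ inj])
      then show False using \<open>\<tau> > 0\<close> uncountable_open_interval[of 0 \<tau>] by simp
    qed
    then have "\<not> A \<subseteq> insert 0 E" using E_countable countable_subset[of A "insert 0 E"] by auto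
    then obtain t where "t \<in> {0<..<\<tau>}" "f 0 + of_real t \<notin> insert 0 E" unfolding A_def by blast
    then show ?thesis using False f0 by (intro exI[of _ "f 0 + of_real t"]) auto
  qed
  then obtain v where v: "v \<in> E \<longleftrightarrow> 0 \<in> E" "v \<noteq> 0" "cmod (v - f 0) < \<tau>" "Im v = 0" by blast
  define c where "c = Re (v - f 0)"
  have c: "v - f 0 = of_real c" "\<bar>c\<bar> < \<tau>"
    using v f0 by (auto simp: c_def complex_eq_iff cmod_def)
  define f' where "f' = (\<lambda>z. f z + poly (smult (of_real c) 1) z)"
  have "poly (smult (of_real c) 1) \<in> F" by (intro poly_mem real_even_smult real_even_1)
  then have f'F: "f' \<in> F" unfolding f'_def by (rule add_mem[OF f])
  have f'0: "f' 0 = v" using c by (simp add: f'_def algebra_simps)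
  have zero: "poly [:0, 0, 1:] a = 0 \<longleftrightarrow> a = 0" for a :: complex by simp
  have "(\<lambda>z. f' z - f z) = poly (smult (of_real c) 1)" by (auto simp: f'_def)
  then have "q (\<lambda>z. f' z - f z) = \<bar>c\<bar> * q (poly 1)" using seminorm_smult[OF q real_even_1] by metis
  also have "\<dots> \<le> \<tau> * q (poly 1)" using c q1 by (intro mult_right_mono) auto
  also have "\<dots> < \<epsilon>" using \<open>\<epsilon> > 0\<close> q1 by (simp add: \<tau>_def field_simps)
  finally have "q (\<lambda>z. f' z - f z) < \<epsilon>" .
  moreover have "False" if z: "\<forall>i. poly [:0, 0, 1:] ((f' ^^ i) z) = 0" for z
  proof -
    have "(f' ^^ 0) z = 0" "(f' ^^ 1) z = 0" using z zero by blast+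
    then show False using f'0 v by simp
  qed
  then have "admissible f' [:0, 0, 1:]"
    unfolding admissible_def using f'F f'0 v(1) zero by (auto simp: pderiv_pCons)
  ultimately show ?thesis by blast
qed

end

section \<open>Passage to the limit in the Frechet space\<close>

theorem theorem1p5:
  fixes T :: "(complex \<Rightarrow> complex) topology"
    and E \<Lambda> :: "complex set"
  assumes F_frechet: "frechet_space T"
    and F_maps: "\<forall>f\<in>topspace T. f holomorphic_on UNIV \<and> real_map f \<and> even_map f"
    and F_polys: "\<forall>p :: complex poly. real_map (poly p) \<and> even_map (poly p) \<longrightarrow> poly p \<in> topspace T"
    and F_finer: "finer_than_local_uniform T"
    and E_countable: "countable E"
    and E_dense: "closure E = UNIV"
    and E_sym: "\<forall>z\<in>E. cnj z \<in> E \<and> - cnj z \<in> E"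
    and E_axes: "{z. Im z = 0 \<or> Re z = 0} \<subseteq> closure (E \<inter> {z. Im z = 0 \<or> Re z = 0})"
    and L_dense: "closure \<Lambda> = UNIV"
    and L_sym: "\<forall>z\<in>\<Lambda>. cnj z \<in> \<Lambda>"
    and L_real: "{z. Im z = 0} \<subseteq> closure (\<Lambda> \<inter> {z. Im z = 0})"
  shows "T closure_of {f \<in> topspace T. f -` E = E
            \<and> (\<forall>z. periodic_point f z \<longrightarrow> z \<in> E)
            \<and> (\<forall>z n. exact_period f n z \<longrightarrow> multiplier f n z \<in> \<Lambda>)} = topspace T"
proof -
  define F where "F = topspace T"
  define good where "good = {f \<in> topspace T. f -` E = E
            \<and> (\<forall>z. periodic_point f z \<longrightarrow> z \<in> E)
            \<and> (\<forall>z n. exact_period f n z \<longrightarrow> multiplier f n z \<in> \<Lambda>)}"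
  have space: "real_function_space F" using F_frechet by (simp add: frechet_space_def F_def)
  obtain p :: "nat \<Rightarrow> (complex \<Rightarrow> complex) \<Rightarrow> real" where
    p: "\<And>n. seminorm_on F (p n)"
    and opn: "\<And>U. openin T U \<longleftrightarrow> U \<subseteq> F \<and>
            (\<forall>f\<in>U. \<exists>N. \<exists>\<epsilon>>0. {g\<in>F. \<forall>n\<le>N. p n (\<lambda>z. g z - f z) < \<epsilon>} \<subseteq> U)"
    and complete: "\<And>x :: nat \<Rightarrow> complex \<Rightarrow> complex. (\<forall>k. x k \<in> F) \<Longrightarrow>
          (\<forall>n. \<forall>\<epsilon>>0. \<exists>M. \<forall>k\<ge>M. \<forall>l\<ge>M. p n (\<lambda>z. x k z - x l z) < \<epsilon>) \<Longrightarrow>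
          \<exists>y\<in>F. \<forall>n. (\<lambda>k. p n (\<lambda>z. x k z - y z)) \<longlonglongrightarrow> 0"
    using F_frechet unfolding frechet_space_def F_def by blast
  interpret target_sets F E \<Lambda>
  proof
    show "f holomorphic_on UNIV" "real_map f" "even_map f" if "f \<in> F" for f
      using F_maps that by (simp_all add: F_def)
    show "poly p \<in> F" if "real_even p" for p
      using F_polys that by (simp add: F_def real_even_def)
    show "cnj z \<in> E \<and> - cnj z \<in> E" if "z \<in> E" for z using E_sym that by blast
    show "cnj z \<in> \<Lambda>" if "z \<in> \<Lambda>" for z using L_sym that by blast
  qed fact+
  have sub: "(\<lambda>z. f z - g z) \<in> F" if "f \<in> F" "g \<in> F" for f g
  proof -
    have "(\<lambda>z. f z + complex_of_real (- 1) * g z) \<in> F"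
      using add_mem[OF that(1) scale_mem[OF that(2)]] .
    then show ?thesis by simp
  qed
  have p_add: "p n (\<lambda>z. f z + g z) \<le> p n f + p n g" if "f \<in> F" "g \<in> F" for n f g
    using p[of n] that unfolding seminorm_on_def by blast
  have p_scale: "p n (\<lambda>z. complex_of_real c * f z) = \<bar>c\<bar> * p n f" if "f \<in> F" for n f c
    using p[of n] that unfolding seminorm_on_def by blast
  have p_triangle: "p n (\<lambda>z. f z - h z) \<le> p n (\<lambda>z. f z - g z) + p n (\<lambda>z. g z - h z)"
    if "f \<in> F" "g \<in> F" "h \<in> F" for n f g h
  proof -
    have "p n (\<lambda>z. (f z - g z) + (g z - h z)) \<le> p n (\<lambda>z. f z - g z) + p n (\<lambda>z. g z - h z)"
      by (rule p_add[OF sub[OF that(1,2)] sub[OF that(2,3)]])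
    then show ?thesis by simp
  qed
  have p_sym: "p n (\<lambda>z. f z - g z) = p n (\<lambda>z. g z - f z)" if "f \<in> F" "g \<in> F" for n f g
  proof -
    have "p n (\<lambda>z. complex_of_real (- 1) * (f z - g z)) = \<bar>- 1\<bar> * p n (\<lambda>z. f z - g z)"
      by (rule p_scale[OF sub[OF that]])
    then show ?thesis by simp
  qed
  have p_nonneg: "p n f \<ge> 0" if "f \<in> F" for n f
    using p[of n] that unfolding seminorm_on_def by blast
  \<comment> \<open>A single seminorm dominating the first ones; basic neighbourhoods involve only
    finitely many.\<close>
  define q where "q = (\<lambda>N f. \<Sum>n\<le>N. p n f)"
  have q: "seminorm_on F (q N)" for N
    unfolding seminorm_on_def q_def
  proof (intro conjI ballI allI)
    fix f g and c :: real assume "f \<in> F"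
    then show "(\<Sum>n\<le>N. p n f) \<ge> 0" by (intro sum_nonneg p_nonneg)
    show "(\<Sum>n\<le>N. p n (\<lambda>z. complex_of_real c * f z)) = \<bar>c\<bar> * (\<Sum>n\<le>N. p n f)"
      by (simp add: sum_distrib_left p_scale[OF \<open>f \<in> F\<close>])
    assume "g \<in> F"
    then show "(\<Sum>n\<le>N. p n (\<lambda>z. f z + g z)) \<le> (\<Sum>n\<le>N. p n f) + (\<Sum>n\<le>N. p n g)"
      unfolding sum.distrib[symmetric] by (intro sum_mono p_add \<open>f \<in> F\<close>)
  qed
  have p_le_q: "p n f \<le> q N f" if "n \<le> N" "f \<in> F" for n N f
    unfolding q_def using that p_nonneg by (intro member_le_sum) auto
  have "E \<noteq> {}" using E_dense by auto
  \<comment> \<open>Each number is the first component of \<open>prod_decode k\<close> for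
    infinitely many \<open>k\<close>, so every point of \<open>E\<close> and every period recurs
    with arbitrarily large radius \<open>k + 1\<close>. Both may use the same component, as their
    requirements are independent.\<close>
  define e where "e k = from_nat_into E (fst (prod_decode k))" for k
  define per where "per k = Suc (fst (prod_decode k))" for k
  have eE: "e k \<in> E" for k using from_nat_into[OF \<open>E \<noteq> {}\<close>] by (simp add: e_def)
  have "U \<inter> good \<noteq> {}" if f0: "f0 \<in> F" and U: "openin T U" "f0 \<in> U" for f0 U
  proof -
    obtain N \<epsilon> where "\<epsilon> > 0" and N: "{g\<in>F. \<forall>n\<le>N. p n (\<lambda>z. g z - f0 z) < \<epsilon>} \<subseteq> U"
      using U opn by blast
    have "\<epsilon> / 4 > 0" using \<open>\<epsilon> > 0\<close> by simp
    then obtain f1 where f1: "admissible f1 [:0, 0, 1:]" "q N (\<lambda>z. f1 z - f0 z) < \<epsilon> / 4"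
      using initial_state[OF q f0] by blast
    define adm where "adm = (\<lambda>(f, Q, R :: real, \<delta> :: real). admissible f Q \<and> \<delta> > 0)"
    define S where "S = (\<lambda>(f, Q, R, \<delta>). in_tube f Q R \<delta>)"
    \<comment> \<open>The index \<open>N + k\<close> eventually covers every seminorm. The
      increments sum to \<open>\<epsilon> / 2\<close>; the initial move and the distance to the
      limit cost less than \<open>\<epsilon> / 4\<close> each.\<close>
    define refines where "refines = (\<lambda>k s s'. q (N + k) (\<lambda>z. fst s' z - fst s z) < \<epsilon> / 2 ^ (k + 2) \<and>
        (\<forall>g. S s' g \<longrightarrow> S s g) \<and>
        (\<forall>g. g holomorphic_on UNIV \<and> S s' g \<longrightarrow> fulfils (e k) (real k + 1) (per k) g))"
    have "\<exists>s. \<forall>k. (adm (s k) \<and> (k = 0 \<longrightarrow> fst (s k) = f1)) \<and> refines k (s k) (s (Suc k))"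
    proof (rule dependent_nat_choice)
      show "\<exists>s. adm s \<and> (0 = (0::nat) \<longrightarrow> fst s = f1)"
        using f1(1) by (intro exI[of _ "(f1, [:0, 0, 1:], 0, 1)"]) (simp add: adm_def)
      fix s :: "(complex \<Rightarrow> complex) \<times> complex poly \<times> real \<times> real" and k :: nat
      assume "adm s \<and> (k = 0 \<longrightarrow> fst s = f1)"
      moreover obtain f Q R \<delta> where s: "s = (f, Q, R, \<delta>)" by (cases s)
      ultimately have fQ: "admissible f Q" "\<delta> > 0" by (auto simp: adm_def)
      have pos: "\<epsilon> / 2 ^ (k + 2) > 0" "real k + 1 > 0" "per k > 0" using \<open>\<epsilon> > 0\<close> by (auto simp: per_def)
      obtain f' Q' R' \<delta>' where "admissible f' Q'" "\<delta>' > 0" "q (N + k) (\<lambda>z. f' z - f z) < \<epsilon> / 2 ^ (k + 2)"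
        "\<forall>g. in_tube f' Q' R' \<delta>' g \<longrightarrow> in_tube f Q R \<delta> g"
        "\<forall>g. g holomorphic_on UNIV \<and> in_tube f' Q' R' \<delta>' g \<longrightarrow> fulfils (e k) (real k + 1) (per k) g"
        using next_state[OF q[of "N + k"] fQ(1) eE[of k] pos fQ(2), of R] by blast
      then show "\<exists>s'. (adm s' \<and> (Suc k = 0 \<longrightarrow> fst s' = f1)) \<and> refines k s s'"
        by (intro exI[of _ "(f', Q', R', \<delta>')"]) (simp add: adm_def S_def s refines_def)
    qed
    then obtain s where s: "\<forall>k. (adm (s k) \<and> (k = 0 \<longrightarrow> fst (s k) = f1)) \<and> refines k (s k) (s (Suc k))"
      by blast
    then have adm: "\<And>k. adm (s k)" and s0: "fst (s 0) = f1"
      and qs: "\<And>k. q (N + k) (\<lambda>z. fst (s (Suc k)) z - fst (s k) z) < \<epsilon> / 2 ^ (k + 2)"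
      and nest: "\<And>k g. S (s (Suc k)) g \<Longrightarrow> S (s k) g"
      and ful: "\<And>k g. g holomorphic_on UNIV \<Longrightarrow> S (s (Suc k)) g \<Longrightarrow> fulfils (e k) (real k + 1) (per k) g"
      unfolding refines_def by blast+
    define x where "x k = fst (s k)" for k
    have xF: "x k \<in> F" for k
      using adm[of k] by (cases "s k") (simp add: x_def adm_def admissible_def)
    \<comment> \<open>The right side is the geometric sum of the increments from \<open>k\<close> to
      \<open>k + j\<close> in closed form.\<close>
    have xx: "p n (\<lambda>z. x (k + j) z - x k z) \<le> \<epsilon> / 2 ^ (k + 1) - \<epsilon> / 2 ^ (k + j + 1)" if "n \<le> N + k" for n k j
    proof (induction j)
      case 0
      have "(\<lambda>z. x k z - x k z) = (\<lambda>z. complex_of_real 0 * x k z)" by simp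
      moreover have "p n (\<lambda>z. complex_of_real 0 * x k z) = \<bar>0\<bar> * p n (x k)"
        by (rule p_scale[OF xF])
      ultimately show ?case by simp
    next
      case (Suc j)
      have "p n (\<lambda>z. x (Suc (k + j)) z - x (k + j) z) \<le> q (N + (k + j)) (\<lambda>z. x (Suc (k + j)) z - x (k + j) z)"
        using that by (intro p_le_q sub xF) simp
      also have "\<dots> < \<epsilon> / 2 ^ (k + j + 2)" unfolding x_def by (rule qs)
      finally have "p n (\<lambda>z. x (Suc (k + j)) z - x (k + j) z) < \<epsilon> / 2 ^ (k + j + 2)" .
      moreover have "\<epsilon> / 2 ^ (k + j + 1) = \<epsilon> / 2 ^ (k + j + 2) + \<epsilon> / 2 ^ (k + Suc j + 1)"
        by (simp add: field_simps)
      ultimately show ?case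
        using Suc p_triangle[OF xF xF xF, of n "Suc (k + j)" k "k + j"] by simp
    qed
    have xx': "p n (\<lambda>z. x l z - x k z) \<le> \<epsilon> / 2 ^ (k + 1)" if "n \<le> N + k" "k \<le> l" for n k l
    proof -
      have kl: "k + (l - k) = l" using that(2) by simp
      have "\<epsilon> / 2 ^ (l + 1) \<ge> 0" using \<open>\<epsilon> > 0\<close> by simp
      then show ?thesis using xx[OF that(1), of "l - k"] unfolding kl by linarith
    qed
    have "\<exists>M. \<forall>k\<ge>M. \<forall>l\<ge>M. p n (\<lambda>z. x k z - x l z) < d" if "d > 0" for n d
    proof -
      obtain M0 where M0: "\<epsilon> / d < 2 ^ M0" using real_arch_pow[of 2 "\<epsilon> / d"] by auto
      define M where "M = max n M0"
      have "(2::real) ^ M0 \<le> 2 ^ M" by (intro power_increasing) (auto simp: M_def)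
      then have "\<epsilon> / d < 2 ^ M" using M0 by linarith
      then have "\<epsilon> / 2 ^ M < d" using \<open>d > 0\<close> by (simp add: field_simps)
      have "p n (\<lambda>z. x k z - x l z) < d" if "k \<ge> M" "l \<ge> M" for k l
      proof -
        have "p n (\<lambda>z. x k z - x M z) \<le> \<epsilon> / 2 ^ (M + 1)" "p n (\<lambda>z. x l z - x M z) \<le> \<epsilon> / 2 ^ (M + 1)"
          using xx'[of n M k] xx'[of n M l] that by (auto simp: M_def)
        then have "p n (\<lambda>z. x k z - x l z) \<le> \<epsilon> / 2 ^ (M + 1) + \<epsilon> / 2 ^ (M + 1)"
          using p_triangle[OF xF xF xF, of n k l M] p_sym[OF xF xF, of n M l] by simp
        also have "\<dots> = \<epsilon> / 2 ^ M" by simp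
        finally show ?thesis using \<open>\<epsilon> / 2 ^ M < d\<close> by simp
      qed
      then show ?thesis by blast
    qed
    then obtain y where y: "y \<in> F" and lim: "\<And>n. (\<lambda>k. p n (\<lambda>z. x k z - y z)) \<longlonglongrightarrow> 0"
      using complete[of x] xF by blast
    have "p n (\<lambda>z. y z - f0 z) < \<epsilon>" if "n \<le> N" for n
    proof -
      have "\<forall>\<^sub>F k in sequentially. p n (\<lambda>z. x k z - y z) < \<epsilon> / 4"
        using order_tendstoD(2)[OF lim] \<open>\<epsilon> / 4 > 0\<close> by blast
      then obtain k where k: "p n (\<lambda>z. x k z - y z) < \<epsilon> / 4" using eventually_happens'[OF sequentially_bot] by blast
      have "p n (\<lambda>z. x k z - x 0 z) \<le> \<epsilon> / 2" using xx'[of n 0 k] that by simp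
      moreover have "p n (\<lambda>z. x 0 z - f0 z) < \<epsilon> / 4"
        using p_le_q[OF that sub[OF xF f0], of 0] f1(2) s0 by (simp add: x_def)
      ultimately show ?thesis
        using k p_sym[OF xF y, of n k] p_triangle[OF y xF f0, of n k] p_triangle[OF xF xF f0, of n k 0] by simp
    qed
    then have yU: "y \<in> U" using N y by blast
    \<comment> \<open>Here the comparison with locally uniform convergence enters, applied to a
      single point as compact set.\<close>
    have pointwise: "(\<lambda>k. x k z) \<longlonglongrightarrow> y z" for z
    proof (rule LIMSEQ_I)
      fix r :: real assume "r > 0"
      then obtain V where V: "openin T V" "y \<in> V" "\<forall>g\<in>V. cmod (g z - y z) < r"
        using F_finer y compact_sing[of z] unfolding finer_than_local_uniform_def F_def by (metis singletonI)
      then obtain N' d where "d > 0" and N': "{g\<in>F. \<forall>n\<le>N'. p n (\<lambda>z. g z - y z) < d} \<subseteq> V"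
        using opn by blast
      have "\<forall>\<^sub>F k in sequentially. \<forall>n\<in>{..N'}. p n (\<lambda>z. x k z - y z) < d"
        using order_tendstoD(2)[OF lim \<open>d > 0\<close>] by (intro eventually_ball_finite) auto
      then have "\<forall>\<^sub>F k in sequentially. cmod (x k z - y z) < r"
        by eventually_elim (use N' V xF in blast)
      then show "\<exists>no. \<forall>k\<ge>no. cmod (x k z - y z) < r" by (simp add: eventually_sequentially)
    qed
    \<comment> \<open>All later approximants lie in the \<open>k\<close>-th tube by nesting, and the
      tube is closed under pointwise limits.\<close>
    have yS: "S (s k) y" for k
    proof -
      obtain f Q R \<delta> where sk: "s k = (f, Q, R, \<delta>)" by (cases "s k")
      have "S (s (k + j)) g \<Longrightarrow> S (s k) g" for j g by (induction j) (use nest in auto)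
      moreover have "S (s l) (x l)" for l
        using adm[of l] by (cases "s l") (simp add: S_def x_def adm_def in_tube_def)
      ultimately have "in_tube f Q R \<delta> (x (k + j))" for j using sk by (simp add: S_def) (metis case_prod_conv)
      then have le: "cmod (x (j + k) z - f z) \<le> \<delta> * cmod (poly Q z)" if "z \<in> cball 0 R" for j z
        using that by (simp add: in_tube_def add.commute)
      have "cmod (y z - f z) \<le> \<delta> * cmod (poly Q z)" if "z \<in> cball 0 R" for z
      proof (rule LIMSEQ_le_const2)
        show "(\<lambda>j. cmod (x (j + k) z - f z)) \<longlonglongrightarrow> cmod (y z - f z)"
          by (intro tendsto_intros LIMSEQ_ignore_initial_segment pointwise)
      qed (use le that in auto)
      then show ?thesis by (simp add: sk S_def in_tube_def)
    qed
    have yful: "fulfils (e k) (real k + 1) (per k) y" for k using ful[OF holo[OF y] yS] .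
    \<comment> \<open>The second component is free and serves to make \<open>k\<close> at least
      |z|.\<close>
    have index: "\<exists>k. fst (prod_decode k) = i \<and> cmod z \<le> real k + 1" for i z
    proof -
      define k where "k = prod_encode (i, nat \<lceil>cmod z\<rceil>)"
      have "nat \<lceil>cmod z\<rceil> \<le> k" unfolding k_def by (rule le_prod_encode_2)
      then have "cmod z \<le> real k + 1" by linarith
      then show ?thesis by (intro exI[of _ k]) (simp add: k_def)
    qed
    have enum: "\<exists>k. e k = a \<and> cmod z \<le> real k + 1" if aE: "a \<in> E" for a z
    proof -
      obtain i where "from_nat_into E i = a" using from_nat_into_surj[OF E_countable aE] by blast
      then show ?thesis using index[of i z] unfolding e_def by metis
    qed
    have cyc: "z \<in> E \<and> multiplier y n z \<in> \<Lambda>" if z: "exact_period y n z" for n z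
    proof -
      obtain n' where n': "n = Suc n'" using z by (cases n) (auto simp: exact_period_def)
      obtain k where "fst (prod_decode k) = n'" "cmod z \<le> real k + 1" using index by blast
      then show ?thesis using yful[of k] z n' by (auto simp: fulfils_def per_def)
    qed
    have "y -` E = E"
    proof (intro set_eqI iffI)
      fix a assume "a \<in> y -` E"
      then obtain k where "e k = y a" "cmod a \<le> real k + 1" using enum[of "y a" a] by auto
      then show "a \<in> E" using yful[of k] by (auto simp: fulfils_def)
    next
      fix a assume "a \<in> E"
      then obtain k where "e k = a" using enum by blast
      then show "a \<in> y -` E" using yful[of k] by (auto simp: fulfils_def)
    qed
    then have "y \<in> good"
      unfolding good_def using y cyc exact_period_exists by (auto simp: F_def) blast
    then show ?thesis using yU by blast
  qed
  then have "T closure_of good = topspace T"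
    unfolding closure_of_def F_def by blast
  then show ?thesis by (simp add: good_def)
qed

end
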